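(* Let $T:X\to X$ be a $C^1$-Axiom A system, let $d$ be a hyperbolic metric on $X$ for $T$, and let $q\ge1$. Then the set $$CD_0:=\{\mu\in\mathcal{M}(T): D^+_\mu(q)=0\},$$ where $D^+_\mu(q)$ is computed with respect to the hyperbolic metric $d$, is residual in $\mathcal{M}(T)$.
   Context: $C^1$-Axiom A system: $T:X\to X$ is the restriction of a $C^1$ Axiom A diffeomorphism of a compact Riemannian manifold $M$ to a basic set $X\subset M$ (a compact, invariant, topologically transitive, locally maximal uniformly hyperbolic set in which periodic points are dense). Such a $T$ is an expansive homeomorphism of $X$. $\mathcal{M}(T)$ is the space of $T$-invariant Borel probability measures on $X$ endowed with the weak topology ($\mu_\alpha\to\mu$ if and only if $\int\varphi\,d\mu_\alpha\to\int\varphi\,d\mu$ for every bounded continuous $\varphi$). A set is residual if it contains a countable intersection of dense open sets. Hyperbolic metric: a metric $d$ compatible with the topology of $X$ such that there are numbers $k>1$ and $\varepsilon>0$ with $$\max\{d(T(x),T(y)),d(T^{-1}(x),T^{-1}(y))\}\ge\min\{k\,d(x,y),\varepsilon\}\quad\text{for all }x,y\in X,$$ and such that both $T$ and $T^{-1}$ are Lipschitz for $d$. (By a theorem of Fathi, every expansive homeomorphism of a compact metrizable space admits such a metric.) Upper generalized fractal dimension: for $q\ne1$, $D^+_\mu(q)=\limsup_{r\downarrow0}\frac{\log\int_{\operatorname{supp}(\mu)}\mu(B(x,r))^{q-1}d\mu(x)}{(q-1)\log r}$, and $D^+_\mu(1)=\limsup_{r\downarrow0}\frac{\int_{\operatorname{supp}(\mu)}\log\mu(B(x,r))\,d\mu(x)}{\log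 r}$, where $B(x,r)$ is the open $d$-ball of radius $r$ centered at $x$. *)

theory Defs
  imports "HOL-Probability.Probability"
begin

section \<open>Smooth manifolds, differentials and Riemannian metrics\<close>

text \<open>
  \<open>Ck_on k f U\<close> is meant for open \<open>U\<close>: all iterated directional derivatives of \<open>f\<close> of order
  less than \<open>k\<close> are differentiable on \<open>U\<close> and those of order \<open>k\<close> are continuous on \<open>U\<close>.
\<close>

primrec Ck_on :: "nat \<Rightarrow> ('a::real_normed_vector \<Rightarrow> 'b::real_normed_vector) \<Rightarrow> 'a set \<Rightarrow> bool" where
  "Ck_on 0 f U \<longleftrightarrow> continuous_on U f"
| "Ck_on (Suc k) f U \<longleftrightarrow>
     (\<forall>x\<in>U. f differentiable (at x)) \<and> (\<forall>v. Ck_on k (\<lambda>x. frechet_derivative f (at x) v) U)"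

definition smooth_on :: "('a::real_normed_vector \<Rightarrow> 'b::real_normed_vector) \<Rightarrow> 'a set \<Rightarrow> bool" where
  "smooth_on f U \<longleftrightarrow> (\<forall>k. Ck_on k f U)"

text \<open>A chart is a pair of its domain and its coordinate map; values outside the domain are irrelevant.\<close>

type_synonym ('m, 'e) chart = "'m set \<times> ('m \<Rightarrow> 'e)"

definition chart_inv :: "('m, 'e) chart \<Rightarrow> 'e \<Rightarrow> 'm" where
  "chart_inv c = inv_into (fst c) (snd c)"

text \<open>The manifold (without boundary) is the whole type \<open>'m\<close>, modelled on the Euclidean space \<open>'e\<close>.\<close>

definition compact_smooth_manifold :: "('m::t2_space, 'e::euclidean_space) chart set \<Rightarrow> bool" where
  "compact_smooth_manifold \<A> \<longleftrightarrow>
     compact (UNIV :: 'm set) \<and>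
     (\<forall>c\<in>\<A>. open (fst c) \<and> open (snd c ` fst c) \<and>
        homeomorphism (fst c) (snd c ` fst c) (snd c) (chart_inv c)) \<and>
     (\<Union>c\<in>\<A>. fst c) = UNIV \<and>
     (\<forall>c\<in>\<A>. \<forall>c'\<in>\<A>. smooth_on (snd c' \<circ> chart_inv c) (snd c ` (fst c \<inter> fst c')))"

text \<open>
  The tangent space at \<open>p\<close> is identified with \<open>'e\<close> by means of one preferred chart around \<open>p\<close>,
  chosen once and for all; \<open>mderiv\<close> is the differential of a map under these identifications, and
  \<open>to_tangent \<A> c p\<close> turns the coordinates of a tangent vector at \<open>p\<close> in the chart \<open>c\<close> into the
  element of the tangent space at \<open>p\<close> that it represents.
\<close>

definition chart_at :: "('m, 'e) chart set \<Rightarrow> 'm \<Rightarrow> ('m, 'e) chart" where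
  "chart_at \<A> p = (SOME c. c \<in> \<A> \<and> p \<in> fst c)"

definition mderiv ::
    "('m::t2_space, 'e::euclidean_space) chart set \<Rightarrow> ('m \<Rightarrow> 'm) \<Rightarrow> 'm \<Rightarrow> 'e \<Rightarrow> 'e" where
  "mderiv \<A> f p =
     frechet_derivative (snd (chart_at \<A> (f p)) \<circ> f \<circ> chart_inv (chart_at \<A> p))
       (at (snd (chart_at \<A> p) p))"

definition to_tangent ::
    "('m::t2_space, 'e::euclidean_space) chart set \<Rightarrow> ('m, 'e) chart \<Rightarrow> 'm \<Rightarrow> 'e \<Rightarrow> 'e" where
  "to_tangent \<A> c p = frechet_derivative (snd (chart_at \<A> p) \<circ> chart_inv c) (at (snd c p))"

definition riemannian_metric ::
    "('m::t2_space, 'e::euclidean_space) chart set \<Rightarrow> ('m \<Rightarrow> 'e \<Rightarrow> 'e \<Rightarrow> real) \<Rightarrow> bool" where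
  "riemannian_metric \<A> g \<longleftrightarrow>
     (\<forall>p. bilinear (g p) \<and> (\<forall>v w. g p v w = g p w v) \<and> (\<forall>v. v \<noteq> 0 \<longrightarrow> g p v v > 0)) \<and>
     (\<forall>c\<in>\<A>. \<forall>v w.
        smooth_on (\<lambda>x. g (chart_inv c x) (to_tangent \<A> c (chart_inv c x) v)
                                         (to_tangent \<A> c (chart_inv c x) w)) (snd c ` fst c))"

definition riemannian_norm :: "('m \<Rightarrow> 'e \<Rightarrow> 'e \<Rightarrow> real) \<Rightarrow> 'm \<Rightarrow> 'e \<Rightarrow> real" where
  "riemannian_norm g p v = sqrt (g p v v)"

definition C1_map :: "('m::t2_space, 'e::euclidean_space) chart set \<Rightarrow> ('m \<Rightarrow> 'm) \<Rightarrow> bool" where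
  "C1_map \<A> f \<longleftrightarrow>
     continuous_on UNIV f \<and>
     (\<forall>c\<in>\<A>. \<forall>c'\<in>\<A>. Ck_on 1 (snd c' \<circ> f \<circ> chart_inv c) (snd c ` (fst c \<inter> f -` fst c')))"

definition C1_diffeo :: "('m::t2_space, 'e::euclidean_space) chart set \<Rightarrow> ('m \<Rightarrow> 'm) \<Rightarrow> bool" where
  "C1_diffeo \<A> f \<longleftrightarrow> bij f \<and> C1_map \<A> f \<and> C1_map \<A> (inv f)"


section \<open>Axiom A diffeomorphisms and basic sets\<close>

definition periodic_points :: "('m \<Rightarrow> 'm) \<Rightarrow> 'm set" where
  "periodic_points f = {x. \<exists>n\<ge>1. (f ^^ n) x = x}"

definition nonwandering_set :: "('m::topological_space \<Rightarrow> 'm) \<Rightarrow> 'm set" where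
  "nonwandering_set f = {x. \<forall>U. open U \<and> x \<in> U \<longrightarrow> (\<exists>n\<ge>1. (f ^^ n) ` U \<inter> U \<noteq> {})}"

text \<open>Compact, invariant and uniformly hyperbolic; \<open>E\<^sup>s\<close> and \<open>E\<^sup>u\<close> are allowed to be zero.\<close>

definition hyperbolic_set ::
    "('m::t2_space, 'e::euclidean_space) chart set \<Rightarrow> ('m \<Rightarrow> 'e \<Rightarrow> 'e \<Rightarrow> real)
       \<Rightarrow> ('m \<Rightarrow> 'm) \<Rightarrow> 'm set \<Rightarrow> bool" where
  "hyperbolic_set \<A> g f X \<longleftrightarrow>
     compact X \<and> f ` X = X \<and>
     (\<exists>Es Eu :: 'm \<Rightarrow> 'e set. \<exists>C>0. \<exists>\<kappa>. 0 < \<kappa> \<and> \<kappa> < 1 \<and>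
       (\<forall>p\<in>X.
          subspace (Es p) \<and> subspace (Eu p) \<and>
          Es p \<inter> Eu p = {0} \<and> (\<forall>v. \<exists>a\<in>Es p. \<exists>b\<in>Eu p. v = a + b) \<and>
          mderiv \<A> f p ` Es p = Es (f p) \<and> mderiv \<A> f p ` Eu p = Eu (f p) \<and>
          (\<forall>n. \<forall>v\<in>Es p.
             riemannian_norm g ((f ^^ n) p) (mderiv \<A> (f ^^ n) p v)
               \<le> C * \<kappa> ^ n * riemannian_norm g p v) \<and>
          (\<forall>n. \<forall>v\<in>Eu p.
             riemannian_norm g ((inv f ^^ n) p) (mderiv \<A> (inv f ^^ n) p v)
               \<le> C * \<kappa> ^ n * riemannian_norm g p v)))"

definition axiom_A ::
    "('m::t2_space, 'e::euclidean_space) chart set \<Rightarrow> ('m \<Rightarrow> 'e \<Rightarrow> 'e \<Rightarrow> real)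
       \<Rightarrow> ('m \<Rightarrow> 'm) \<Rightarrow> bool" where
  "axiom_A \<A> g f \<longleftrightarrow>
     hyperbolic_set \<A> g f (nonwandering_set f) \<and>
     nonwandering_set f \<subseteq> closure (periodic_points f)"

definition topologically_transitive_on :: "('m::topological_space \<Rightarrow> 'm) \<Rightarrow> 'm set \<Rightarrow> bool" where
  "topologically_transitive_on f X \<longleftrightarrow>
     (\<forall>U V. open U \<and> open V \<and> U \<inter> X \<noteq> {} \<and> V \<inter> X \<noteq> {} \<longrightarrow>
        (\<exists>n. (f ^^ n) ` (U \<inter> X) \<inter> V \<noteq> {}))"

definition locally_maximal :: "('m::topological_space \<Rightarrow> 'm) \<Rightarrow> 'm set \<Rightarrow> bool" where
  "locally_maximal f X \<longleftrightarrow>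
     (\<exists>V. open V \<and> X \<subseteq> V \<and> X = {x. \<forall>n. (f ^^ n) x \<in> V \<and> (inv f ^^ n) x \<in> V})"

definition basic_set ::
    "('m::t2_space, 'e::euclidean_space) chart set \<Rightarrow> ('m \<Rightarrow> 'e \<Rightarrow> 'e \<Rightarrow> real)
       \<Rightarrow> ('m \<Rightarrow> 'm) \<Rightarrow> 'm set \<Rightarrow> bool" where
  "basic_set \<A> g f X \<longleftrightarrow>
     X \<noteq> {} \<and> hyperbolic_set \<A> g f X \<and> topologically_transitive_on f X \<and>
     locally_maximal f X \<and> X \<subseteq> closure (X \<inter> periodic_points f)"

definition C1_axiom_A_system ::
    "('m::t2_space, 'e::euclidean_space) chart set \<Rightarrow> ('m \<Rightarrow> 'e \<Rightarrow> 'e \<Rightarrow> real)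
       \<Rightarrow> ('m \<Rightarrow> 'm) \<Rightarrow> 'm set \<Rightarrow> ('m \<Rightarrow> 'm) \<Rightarrow> bool" where
  "C1_axiom_A_system \<A> g f X T \<longleftrightarrow>
     compact_smooth_manifold \<A> \<and> riemannian_metric \<A> g \<and>
     C1_diffeo \<A> f \<and> axiom_A \<A> g f \<and> basic_set \<A> g f X \<and> (\<forall>x\<in>X. T x = f x)"


section \<open>Invariant measures, weak topology, residual sets\<close>

definition invariant_measures ::
    "'m::topological_space set \<Rightarrow> ('m \<Rightarrow> 'm) \<Rightarrow> 'm measure set" where
  "invariant_measures X T =
     {\<mu>. space \<mu> = X \<and> sets \<mu> = sets (restrict_space borel X) \<and> prob_space \<mu> \<and>
         T \<in> measurable \<mu> \<mu> \<and> distr \<mu> \<mu> T = \<mu>}"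

text \<open>
  The coarsest topology on \<open>\<M>(T)\<close> that makes \<open>\<mu> \<mapsto> \<integral>\<phi> d\<mu>\<close> continuous for every bounded continuous
  \<open>\<phi> : X \<rightarrow> \<real>\<close>; its convergent nets are exactly those for which all these integrals converge.
\<close>

definition weak_topology ::
    "'m::topological_space set \<Rightarrow> ('m \<Rightarrow> 'm) \<Rightarrow> 'm measure topology" where
  "weak_topology X T =
     topology_generated_by
       {{\<mu> \<in> invariant_measures X T. (\<integral>x. \<phi> x \<partial>\<mu>) \<in> U} | (\<phi> :: 'm \<Rightarrow> real) U.
          continuous_on X \<phi> \<and> bounded (\<phi> ` X) \<and> open U}"

lemma topspace_weak_topology: "topspace (weak_topology X T) = invariant_measures X T"
proof -
  have "invariant_measures X T \<in>
      {{\<mu> \<in> invariant_measures X T. (\<integral>x. \<phi> x \<partial>\<mu>) \<in> U} | (\<phi> :: 'a \<Rightarrow> real) U.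
          continuous_on X \<phi> \<and> bounded (\<phi> ` X) \<and> open U}"
    by (intro CollectI exI[of _ "\<lambda>_. 0::real"] exI[of _ "UNIV :: real set"])
      (auto simp: bounded_iff)
  then show ?thesis
    unfolding weak_topology_def topology_generated_by_topspace by blast
qed

definition residual_in :: "'a topology \<Rightarrow> 'a set \<Rightarrow> bool" where
  "residual_in \<tau> S \<longleftrightarrow>
     S \<subseteq> topspace \<tau> \<and>
     (\<exists>G :: nat \<Rightarrow> 'a set.
        (\<forall>n. openin \<tau> (G n) \<and> \<tau> closure_of G n = topspace \<tau>) \<and> (\<Inter>n. G n) \<subseteq> S)"


section \<open>Hyperbolic metrics and generalized fractal dimensions\<close>

definition hyperbolic_metric ::
    "'m::topological_space set \<Rightarrow> ('m \<Rightarrow> 'm) \<Rightarrow> 'm metric \<Rightarrow> bool" where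
  "hyperbolic_metric X T d \<longleftrightarrow>
     mspace d = X \<and> mtopology_of d = top_of_set X \<and>
     (\<exists>k>1. \<exists>\<epsilon>>0. \<forall>x\<in>X. \<forall>y\<in>X.
        max (mdist d (T x) (T y)) (mdist d (inv_into X T x) (inv_into X T y))
          \<ge> min (k * mdist d x y) \<epsilon>) \<and>
     Lipschitz_continuous_map d d T \<and> Lipschitz_continuous_map d d (inv_into X T)"

definition supp :: "'m::topological_space measure \<Rightarrow> 'm set" where
  "supp \<mu> = {x \<in> space \<mu>. \<forall>U. open U \<and> x \<in> U \<longrightarrow> measure \<mu> (U \<inter> space \<mu>) > 0}"

definition upper_gen_dim :: "'m::topological_space metric \<Rightarrow> 'm measure \<Rightarrow> real \<Rightarrow> ereal" where
  "upper_gen_dim d \<mu> q =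
     (if q = 1 then
        Limsup (at_right 0) (\<lambda>r::real. ereal
          ((LINT x:supp \<mu>|\<mu>. ln (measure \<mu> (mball_of d x r))) / ln r))
      else
        Limsup (at_right 0) (\<lambda>r::real. ereal
          (ln (LINT x:supp \<mu>|\<mu>. measure \<mu> (mball_of d x r) powr (q - 1)) / ((q - 1) * ln r))))"

end

theory Submission
  imports Defs
begin

text \<open>
  Finitely supported invariant measures are dense. A partition of \<open>X\<close> into small cells turns an
  invariant measure into a circulation on the finite graph of transitions between cells; it is a
  combination of cycles, a cycle is a periodic pseudo-orbit, and hyperbolicity together with local
  maximality provides a periodic orbit shadowing it. For the shadowing, the linearized equation along
  a pseudo-orbit is uniformly injective, since otherwise a limit would be a nonzero bounded tangent
  orbit; on sequences of a fixed period it is therefore invertible, and the contraction principle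
  applies.

  Finitely supported measures have neighbourhoods of small dimension. By the expansion property of
  the hyperbolic metric, cylinders of length \<open>2 n + 1\<close> for a fine partition lie in balls of radius
  comparable to \<open>k\<^sup>-\<^sup>n\<close>, so \<open>D\<^sup>+\<close> is bounded by a multiple of the entropy. The latter is bounded by
  means of the Gibbs inequality with a product weight on blocks of length \<open>m\<close>, where \<open>m\<close> is large
  compared with the logarithm of the size of the support, and this bound involves the measure only
  through its mass near the support. For \<open>q > 1\<close> one reduces to \<open>q = 1\<close> by Jensen's inequality.
\<close>

section \<open>Compact spaces with a compatible metric\<close>

text \<open>The space carries only a Hausdorff topology, and \<open>d\<close> lives on
  \<open>X\<close> alone. Pseudo-orbits are therefore compared in charts, limits are taken along
  filters in a compact space of sequences, and the shadowing orbit, which a priori may leave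
  \<open>X\<close>, is brought back by local maximality. The hyperbolic splitting is used over true
  orbits in \<open>X\<close> only, so no extension of it and no continuity of it enters. All
  shadowing constants must be independent of the period, because the cycles of a circulation have
  uncontrolled length.

  The bound on the dimension has to hold at all small scales from one weakly open condition. Scale
  \<open>r\<close> involves about \<open>2 * ln (1 / r) / ln k\<close> symbols, that is
  \<open>1 / m\<close> times as many blocks. A block costs at most \<open>ln (2 * card O')\<close>
  when it starts near the support and about \<open>m * ln K\<close> more otherwise. The former is
  small relative to \<open>m\<close> by the choice of \<open>m\<close>, the latter as soon as the
  mass off the support is small against \<open>1 / ln K\<close>. By invariance this single mass
  governs every block, hence every scale.\<close>

lemma compact_uniform_radius:
  fixes K :: "'s::topological_space set" and P :: "'s \<Rightarrow> real \<Rightarrow> bool"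
  assumes K: "compact K"
    and loc: "\<And>x. x \<in> K \<Longrightarrow> \<exists>U \<rho>. open U \<and> x \<in> U \<and> \<rho> > 0 \<and> (\<forall>y\<in>U \<inter> K. P y \<rho>)"
    and anti: "\<And>y \<rho> \<rho>'. P y \<rho> \<Longrightarrow> 0 < \<rho>' \<Longrightarrow> \<rho>' \<le> \<rho> \<Longrightarrow> P y \<rho>'"
  shows "\<exists>\<rho>>0. \<forall>y\<in>K. P y \<rho>"
proof -
  obtain U \<rho> where U: "\<And>x. x \<in> K \<Longrightarrow> open (U x) \<and> x \<in> U x \<and> \<rho> x > 0 \<and> (\<forall>y\<in>U x \<inter> K. P y (\<rho> x))"
    using loc by metis
  have "\<forall>x\<in>K. open (U x)" "K \<subseteq> (\<Union>x\<in>K. U x)" using U by auto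
  then obtain D where D: "D \<subseteq> K" "finite D" "K \<subseteq> (\<Union>x\<in>D. U x)"
    using compactE_image[OF K] by metis
  \<comment> \<open>The 1 keeps the minimum over a nonempty set when \<open>D\<close> is
    empty.\<close>
  define r where "r = Min (insert 1 (\<rho> ` D))"
  have r0: "r > 0" unfolding r_def using D U by (subst Min_gr_iff) auto
  have "P y r" if y: "y \<in> K" for y
  proof -
    from y D obtain x where x: "x \<in> D" "y \<in> U x" by blast
    have "r \<le> \<rho> x" unfolding r_def using D x by (intro Min_le) auto
    moreover have "P y (\<rho> x)" using U x y D by blast
    ultimately show ?thesis using anti r0 by blast
  qed
  with r0 show ?thesis by blast
qed

locale compact_metrized =
  fixes X :: "'m::t2_space set" and d :: "'m metric"
  assumes compact_X: "compact X"
    and mspace_d [simp]: "mspace d = X"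
    and mtopology_d: "mtopology_of d = top_of_set X"
begin

lemma dist_commute_d: "mdist d x y = mdist d y x"
  by (rule mdist_commute)

lemma dist_triangle_d: "x \<in> X \<Longrightarrow> y \<in> X \<Longrightarrow> z \<in> X \<Longrightarrow> mdist d x z \<le> mdist d x y + mdist d y z"
  using mdist_triangle[of x d y z] by simp

lemma dist_self_d: "x \<in> X \<Longrightarrow> mdist d x x = 0"
  using mdist_zero[of x d x] by simp

lemma dist_pos_d: "x \<in> X \<Longrightarrow> y \<in> X \<Longrightarrow> x \<noteq> y \<Longrightarrow> 0 < mdist d x y"
  using mdist_zero[of x d y] mdist_nonneg[of d x y] by (simp add: less_le)

lemma openin_ball: "openin (top_of_set X) (mball_of d x r)"
  using Metric_space.openin_mball[OF Metric_space_mspace_mdist, of d x r] mtopology_d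
  by (simp add: mball_of_def mtopology_of_def)

lemma open_ball_nhd:
  assumes "a \<in> X" "r > 0"
  obtains U where "open U" "a \<in> U" "\<And>x. x \<in> U \<Longrightarrow> x \<in> X \<Longrightarrow> mdist d a x < r"
proof -
  obtain U where U: "open U" "mball_of d a r = X \<inter> U"
    using openin_ball[of a r] unfolding openin_open by blast
  have "mdist d a a = 0" using assms by simp
  then have "a \<in> mball_of d a r" using assms by (simp only: in_mball_of mspace_d)
  moreover have "mdist d a x < r" if "x \<in> U" "x \<in> X" for x
    using U(2) that by (metis IntI in_mball_of)
  ultimately show ?thesis using U that[of U] by blast
qed

lemma ball_in_openin:
  assumes "openin (top_of_set X) U" "a \<in> U"
  obtains r where "r > 0" "mball_of d a r \<subseteq> U"
proof -
  have "openin (Metric_space.mtopology (mspace d) (mdist d)) U"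
    using assms(1) mtopology_d unfolding mtopology_of_def by simp
  then have "\<forall>x. x \<in> U \<longrightarrow> (\<exists>r>0. mball_of d x r \<subseteq> U)"
    unfolding Metric_space.openin_mtopology[OF Metric_space_mspace_mdist] mball_of_def by simp
  then show ?thesis using assms(2) that by blast
qed

lemma finite_ball_cover:
  assumes "r > 0"
  obtains Z where "finite Z" "Z \<subseteq> X" "X \<subseteq> (\<Union>z\<in>Z. mball_of d z r)"
proof -
  have "\<exists>U. open U \<and> mball_of d z r = X \<inter> U" for z
    using openin_ball[of z r] unfolding openin_open by blast
  then obtain U where U: "\<And>z. open (U z)" "\<And>z. mball_of d z r = X \<inter> U z" by metis
  have "z \<in> U z" if "z \<in> X" for z using U(2)[of z] that assms by (metis IntE in_mball_of mdist_zero mspace_d)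
  then have "X \<subseteq> (\<Union>z\<in>X. U z)" by blast
  then obtain Z where "Z \<subseteq> X" "finite Z" "X \<subseteq> (\<Union>z\<in>Z. U z)"
    using compactE_image[OF compact_X] U(1) by metis
  then show ?thesis using that[of Z] U(2) by blast
qed

lemma continuous_on_dist: "a \<in> X \<Longrightarrow> continuous_on X (mdist d a)"
  unfolding continuous_on_def tendsto_iff
proof (intro ballI allI impI)
  fix x and e :: real assume *: "a \<in> X" "x \<in> X" "e > 0"
  obtain U where U: "open U" "x \<in> U" "\<And>y. y \<in> U \<Longrightarrow> y \<in> X \<Longrightarrow> mdist d x y < e"
    using open_ball_nhd[OF *(2,3)] by blast
  have "dist (mdist d a y) (mdist d a x) < e" if "y \<in> U" "y \<in> X" for y
    using U(3)[OF that] dist_triangle_d[of a x y] dist_triangle_d[of a y x] dist_commute_d[of x y] * that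
    by (auto simp: dist_real_def)
  then show "\<forall>\<^sub>F y in at x within X. dist (mdist d a y) (mdist d a x) < e"
    unfolding eventually_at_topological using U by blast
qed

lemma separated_nhds:
  assumes "a \<in> X" "b \<in> X" "a \<noteq> b"
  shows "\<exists>U V r. open U \<and> a \<in> U \<and> open V \<and> b \<in> V \<and> r > 0 \<and>
    (\<forall>x\<in>U \<inter> X. \<forall>y\<in>V \<inter> X. mdist d x y \<ge> r)"
proof -
  define r where "r = mdist d a b / 3"
  have r: "r > 0" using assms mdist_nonneg[of d a b] mdist_zero[of a d b] by (simp add: r_def less_le)
  obtain U where U: "open U" "a \<in> U" "\<And>x. x \<in> U \<Longrightarrow> x \<in> X \<Longrightarrow> mdist d a x < r"
    using open_ball_nhd[OF assms(1) r] by blast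
  obtain V where V: "open V" "b \<in> V" "\<And>x. x \<in> V \<Longrightarrow> x \<in> X \<Longrightarrow> mdist d b x < r"
    using open_ball_nhd[OF assms(2) r] by blast
  have "mdist d x y \<ge> r" if "x \<in> U" "x \<in> X" "y \<in> V" "y \<in> X" for x y
    using U(3)[of x] V(3)[of y] that dist_triangle_d[of a x b] dist_triangle_d[of x y b]
      dist_commute_d[of y b] assms unfolding r_def by linarith
  then show ?thesis using U(1,2) V(1,2) r by (intro exI[of _ U] exI[of _ V] exI[of _ r]) simp
qed

lemma finite_set_separation:
  assumes "finite O'" "O' \<subseteq> X"
  shows "\<exists>r>0. \<forall>z\<in>O'. \<forall>z'\<in>O'. z \<noteq> z' \<longrightarrow> 2 * r \<le> mdist d z z'"
proof -
  define S where "S = insert 1 ((\<lambda>(z, z'). mdist d z z') ` {(z, z') \<in> O' \<times> O'. z \<noteq> z'})"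
  have "finite {(z, z') \<in> O' \<times> O'. z \<noteq> z'}"
    by (rule finite_subset[of _ "O' \<times> O'"]) (use assms(1) in auto)
  then have fin: "finite S" unfolding S_def by simp
  have pos: "Min S > 0"
  proof -
    have "\<forall>s\<in>S. s > 0"
    proof
      fix s assume "s \<in> S"
      then consider "s = 1" | z z' where "z \<in> O'" "z' \<in> O'" "z \<noteq> z'" "s = mdist d z z'" unfolding S_def by auto
      then show "s > 0"
      proof cases
        case 2
        then show ?thesis using dist_pos_d[of z z'] assms(2) by blast
      qed simp
    qed
    then show ?thesis using fin by (subst Min_gr_iff) (auto simp: S_def)
  qed
  have "Min S \<le> mdist d z z'" if "z \<in> O'" "z' \<in> O'" "z \<noteq> z'" for z z'
    using fin that by (intro Min_le) (auto simp: S_def)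
  then show ?thesis using pos by (intro exI[of _ "Min S / 2"]) auto
qed

text \<open>Where \<open>p1\<close> and \<open>p2\<close> differ, their values stay a fixed distance
  apart nearby, so the premise fails for small \<rho>; where they agree, the local hypothesis
  applies. Compactness of \<open>S\<close> makes one radius serve, and it plays both roles,
  threshold and parameter of \<open>P\<close>.\<close>

lemma near_diagonal:
  fixes S :: "'s::topological_space set"
  assumes S: "compact S" and cont: "continuous_on S p1" "continuous_on S p2"
    and ran: "p1 ` S \<subseteq> X" "p2 ` S \<subseteq> X"
    and loc: "\<And>s. s \<in> S \<Longrightarrow> p1 s = p2 s \<Longrightarrow>
        \<exists>U \<rho>. open U \<and> s \<in> U \<and> \<rho> > 0 \<and> (\<forall>t\<in>U \<inter> S. P t \<rho>)"
    and anti: "\<And>s \<rho> \<rho>'. P s \<rho> \<Longrightarrow> 0 < \<rho>' \<Longrightarrow> \<rho>' \<le> \<rho> \<Longrightarrow> P s \<rho>'"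
  shows "\<exists>\<rho>>0. \<forall>s\<in>S. mdist d (p1 s) (p2 s) < \<rho> \<longrightarrow> P s \<rho>"
proof (rule compact_uniform_radius[OF S])
  fix s assume s: "s \<in> S"
  show "\<exists>U \<rho>. open U \<and> s \<in> U \<and> 0 < \<rho> \<and> (\<forall>y\<in>U \<inter> S. mdist d (p1 y) (p2 y) < \<rho> \<longrightarrow> P y \<rho>)"
  proof (cases "p1 s = p2 s")
    case True
    obtain U \<rho> where "open U" "s \<in> U" "0 < \<rho>" "\<forall>t\<in>U \<inter> S. P t \<rho>"
      using loc[OF s True] by blast
    then show ?thesis by (intro exI[of _ U] exI[of _ \<rho>]) simp
  next
    case False
    obtain U V r where *: "open U" "p1 s \<in> U" "open V" "p2 s \<in> V" "r > 0"
      "\<forall>x\<in>U \<inter> X. \<forall>y\<in>V \<inter> X. mdist d x y \<ge> r"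
      using separated_nhds[OF _ _ False] ran s by (metis image_subset_iff)
    obtain A where A: "open A" "A \<inter> S = p1 -` U \<inter> S"
      using continuous_on_open_invariant[THEN iffD1, rule_format, OF cont(1) *(1)] by blast
    obtain B where B: "open B" "B \<inter> S = p2 -` V \<inter> S"
      using continuous_on_open_invariant[THEN iffD1, rule_format, OF cont(2) *(3)] by blast
    have ge: "mdist d (p1 y) (p2 y) \<ge> r" if "y \<in> A \<inter> B \<inter> S" for y
    proof -
      have "p1 y \<in> U \<inter> X" "p2 y \<in> V \<inter> X" using that A(2) B(2) ran by auto
      then show ?thesis using *(6) by blast
    qed
    have "s \<in> A \<inter> B" using A B s * by blast
    moreover have "\<forall>y\<in>(A \<inter> B) \<inter> S. mdist d (p1 y) (p2 y) < r \<longrightarrow> P y r"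
      using ge by (meson not_less)
    ultimately show ?thesis using A(1) B(1) \<open>r > 0\<close> by (intro exI[of _ "A \<inter> B"] exI[of _ r]) (simp add: open_Int)
  qed
next
  fix y and \<rho> \<rho>' :: real
  assume "mdist d (p1 y) (p2 y) < \<rho> \<longrightarrow> P y \<rho>" "0 < \<rho>'" "\<rho>' \<le> \<rho>"
  then show "mdist d (p1 y) (p2 y) < \<rho>' \<longrightarrow> P y \<rho>'" using anti[of y \<rho> \<rho>'] by auto
qed

lemma uniformly_continuous_X:
  fixes \<phi> :: "'m \<Rightarrow> real"
  assumes \<phi>: "continuous_on X \<phi>" and "\<eta> > 0"
  obtains \<beta> where "\<beta> > 0" "\<And>x y. x \<in> X \<Longrightarrow> y \<in> X \<Longrightarrow> mdist d x y < \<beta> \<Longrightarrow> \<bar>\<phi> x - \<phi> y\<bar> < \<eta>"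
proof -
  have "\<exists>\<rho>>0. \<forall>s\<in>X \<times> X. mdist d (fst s) (snd s) < \<rho> \<longrightarrow> \<bar>\<phi> (fst s) - \<phi> (snd s)\<bar> < \<eta>"
  proof (rule near_diagonal[where S = "X \<times> X" and ?p1.0 = fst and ?p2.0 = snd
      and P = "\<lambda>s _. \<bar>\<phi> (fst s) - \<phi> (snd s)\<bar> < \<eta>"])
    fix s assume s: "s \<in> X \<times> X" "fst s = snd s"
    then obtain a where a: "s = (a, a)" "a \<in> X" by (cases s) auto
    have op: "open {\<phi> a - \<eta>/2 <..< \<phi> a + \<eta>/2}" by simp
    then obtain A where A: "open A" "A \<inter> X = \<phi> -` {\<phi> a - \<eta>/2 <..< \<phi> a + \<eta>/2} \<inter> X"
      using continuous_on_open_invariant[THEN iffD1, rule_format, OF \<phi> op] by blast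
    have "a \<in> A" using A(2) a \<open>\<eta> > 0\<close> by auto
    moreover have "\<bar>\<phi> x - \<phi> y\<bar> < \<eta>" if "x \<in> A \<inter> X" "y \<in> A \<inter> X" for x y
      using that unfolding A(2) by auto
    ultimately show "\<exists>U \<rho>. open U \<and> s \<in> U \<and> (0::real) < \<rho> \<and> (\<forall>t\<in>U \<inter> X \<times> X. \<bar>\<phi> (fst t) - \<phi> (snd t)\<bar> < \<eta>)"
      using A(1) a by (intro exI[of _ "A \<times> A"] exI[of _ 1]) (auto intro: open_Times)
  qed (auto intro!: compact_Times compact_X continuous_on_fst continuous_on_snd)
  then obtain \<rho> where "\<rho> > 0"
    "\<forall>s\<in>X \<times> X. mdist d (fst s) (snd s) < \<rho> \<longrightarrow> \<bar>\<phi> (fst s) - \<phi> (snd s)\<bar> < \<eta>" by blast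
  then show ?thesis using that[of \<rho>] by simp
qed

end

text \<open>The \<open>mod\<close> closes the pseudo-orbit up. It matters that \<alpha> is chosen
  before the period \<open>n\<close>: the cycles to which this is applied have no length
  bound.\<close>

definition periodic_shadowing :: "'m set \<Rightarrow> ('m \<Rightarrow> 'm) \<Rightarrow> 'm metric \<Rightarrow> bool" where
  "periodic_shadowing X T d \<longleftrightarrow>
     (\<forall>\<beta>>0. \<exists>\<alpha>>0. \<forall>n\<ge>1. \<forall>x. (\<forall>i<n. x i \<in> X \<and> mdist d (T (x i)) (x (Suc i mod n)) < \<alpha>) \<longrightarrow>
        (\<exists>z\<in>X. (T ^^ n) z = z \<and> (\<forall>i<n. mdist d ((T ^^ i) z) (x i) < \<beta>)))"

section \<open>Approximation by finitely supported invariant measures\<close>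

text \<open>The flow carried by the walk \<open>c 0, ..., c n\<close>, repeated edges being counted
  with multiplicity; it is a circulation when \<open>c n = c 0\<close>.\<close>

definition cycle_count :: "(nat \<Rightarrow> 'a) \<Rightarrow> nat \<Rightarrow> 'a \<Rightarrow> 'a \<Rightarrow> real" where
  "cycle_count c n a b = (\<Sum>i<n. if c i = a \<and> c (Suc i) = b then 1 else 0)"

lemma cycle_count_out:
  assumes "finite V" "\<And>i. i < n \<Longrightarrow> c (Suc i) \<in> V"
  shows "(\<Sum>b\<in>V. cycle_count c n a b) = (\<Sum>i<n. if c i = a then 1 else 0)"
proof -
  have "(\<Sum>b\<in>V. cycle_count c n a b) = (\<Sum>i<n. \<Sum>b\<in>V. if c (Suc i) = b then (if c i = a then 1 else 0) else 0)"
    unfolding cycle_count_def by (subst sum.swap) (intro sum.cong refl, auto)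
  also have "\<dots> = (\<Sum>i<n. if c i = a then 1 else 0)"
    using assms by (intro sum.cong refl) (simp add: sum.delta')
  finally show ?thesis .
qed

lemma cycle_count_in:
  assumes "finite V" "\<And>i. i < n \<Longrightarrow> c i \<in> V"
  shows "(\<Sum>b\<in>V. cycle_count c n b a) = (\<Sum>i<n. if c (Suc i) = a then 1 else 0)"
proof -
  have "(\<Sum>b\<in>V. cycle_count c n b a) = (\<Sum>i<n. \<Sum>b\<in>V. if c i = b then (if c (Suc i) = a then 1 else 0) else 0)"
    unfolding cycle_count_def by (subst sum.swap) (intro sum.cong refl, auto)
  also have "\<dots> = (\<Sum>i<n. if c (Suc i) = a then 1 else 0)"
    using assms by (intro sum.cong refl) (simp add: sum.delta')
  finally show ?thesis .
qed

lemma cycle_count_sum: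
  fixes h :: "'a \<Rightarrow> 'a \<Rightarrow> real"
  assumes "finite V" "\<And>i. i \<le> n \<Longrightarrow> c i \<in> V"
  shows "(\<Sum>a\<in>V. \<Sum>b\<in>V. cycle_count c n a b * h a b) = (\<Sum>i<n. h (c i) (c (Suc i)))"
proof -
  have "(\<Sum>a\<in>V. \<Sum>b\<in>V. cycle_count c n a b * h a b)
      = (\<Sum>a\<in>V. \<Sum>b\<in>V. \<Sum>i<n. if c i = a then if c (Suc i) = b then h a b else 0 else 0)"
    unfolding cycle_count_def sum_distrib_right by (intro sum.cong refl) auto
  also have "\<dots> = (\<Sum>a\<in>V. \<Sum>i<n. \<Sum>b\<in>V. if c i = a then if c (Suc i) = b then h a b else 0 else 0)"
    by (intro sum.cong refl sum.swap)
  also have "\<dots> = (\<Sum>i<n. \<Sum>a\<in>V. \<Sum>b\<in>V. if c i = a then if c (Suc i) = b then h a b else 0 else 0)"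
    by (rule sum.swap)
  also have "\<dots> = (\<Sum>i<n. h (c i) (c (Suc i)))"
  proof (intro sum.cong refl)
    fix i assume i: "i \<in> {..<n}"
    have "(\<Sum>a\<in>V. \<Sum>b\<in>V. if c i = a then if c (Suc i) = b then h a b else 0 else 0)
       = (\<Sum>a\<in>V. if c i = a then \<Sum>b\<in>V. if c (Suc i) = b then h a b else 0 else 0)"
      by (intro sum.cong refl) simp
    also have "\<dots> = h (c i) (c (Suc i))"
      using assms i by (simp add: sum.delta')
    finally show "(\<Sum>a\<in>V. \<Sum>b\<in>V. if c i = a then if c (Suc i) = b then h a b else 0 else 0) = h (c i) (c (Suc i))" .
  qed
  finally show ?thesis .
qed

lemma sum_shift_cyclic:
  fixes h :: "nat \<Rightarrow> real"
  assumes "h n = h 0"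
  shows "(\<Sum>i<n. h (Suc i)) = (\<Sum>i<n. h i)"
  using sum.lessThan_Suc_shift[of h n] sum.lessThan_Suc[of h n] assms by simp

text \<open>A forward orbit in a finite set repeats, which yields a periodic point. Its least period
  \<open>n\<close> makes the cycle simple, since a coincidence at times \<open>k < l < n\<close>
  would give the smaller period \<open>n - l + k\<close>.\<close>

lemma self_map_has_simple_cycle:
  assumes "finite V" "V \<noteq> {}" "s ` V \<subseteq> V"
  shows "\<exists>a\<in>V. \<exists>n\<ge>1. (s ^^ n) a = a \<and> inj_on (\<lambda>i. (s ^^ i) a) {..<n}"
proof -
  from assms obtain a0 where a0: "a0 \<in> V" by blast
  have iter: "(s ^^ i) x \<in> V" if "x \<in> V" for i x using that assms(3) by (induction i) auto
  have "\<not> inj (\<lambda>i. (s ^^ i) a0)"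
  proof
    assume "inj (\<lambda>i. (s ^^ i) a0)"
    moreover have "finite (range (\<lambda>i. (s ^^ i) a0))"
      using iter[OF a0] by (intro finite_subset[OF _ assms(1)]) auto
    ultimately show False using finite_imageD by blast
  qed
  then obtain i j where ij: "i < j" "(s ^^ i) a0 = (s ^^ j) a0"
    unfolding inj_def by (metis linorder_neqE_nat)
  define a where "a = (s ^^ i) a0"
  have aV: "a \<in> V" using iter a0 a_def by blast
  have ex: "\<exists>n. n \<ge> 1 \<and> (s ^^ n) a = a"
  proof (intro exI conjI)
    have "(s ^^ (j - i)) a = (s ^^ (j - i + i)) a0" by (simp only: funpow_add comp_apply a_def)
    then show "(s ^^ (j - i)) a = a" using ij by (simp add: a_def)
  qed (use ij in simp)
  define n where "n = (LEAST n. n \<ge> 1 \<and> (s ^^ n) a = a)"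
  have n: "n \<ge> 1" "(s ^^ n) a = a" using LeastI_ex[OF ex] unfolding n_def by auto
  have least: "m \<ge> n" if "m \<ge> 1" "(s ^^ m) a = a" for m
    unfolding n_def using that by (intro Least_le) auto
  have no: False if "k < l" "l < n" "(s ^^ k) a = (s ^^ l) a" for k l
  proof -
    have "(s ^^ (n - l + k)) a = (s ^^ (n - l)) ((s ^^ k) a)" by (simp add: funpow_add)
    also have "\<dots> = (s ^^ (n - l + l)) a" using that by (simp only: funpow_add comp_apply)
    also have "\<dots> = a" using that n by simp
    finally have "n \<le> n - l + k" using least[of "n - l + k"] that by auto
    then show False using that by auto
  qed
  have "inj_on (\<lambda>i. (s ^^ i) a) {..<n}"
    by (rule inj_onI) (metis no lessThan_iff linorder_neqE_nat)
  then show ?thesis using aV n by blast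
qed

text \<open>Circulations are the conical combinations of cycles; this is the corresponding induction rule.\<close>

lemma circulation_induct:
  fixes w :: "'a \<Rightarrow> 'a \<Rightarrow> real"
  assumes V: "finite V"
    and nonneg: "\<And>a b. w a b \<ge> 0"
    and supp: "\<And>a b. w a b > 0 \<Longrightarrow> a \<in> V \<and> b \<in> V \<and> E a b"
    and circ: "\<And>a. a \<in> V \<Longrightarrow> (\<Sum>b\<in>V. w a b) = (\<Sum>b\<in>V. w b a)"
    and zero: "Q (\<lambda>_ _. 0)"
    and step: "\<And>w c n t. Q w \<Longrightarrow> t \<ge> 0 \<Longrightarrow> n \<ge> 1 \<Longrightarrow> c n = c 0 \<Longrightarrow>
        (\<And>i. i < n \<Longrightarrow> c i \<in> V \<and> E (c i) (c (Suc i))) \<Longrightarrow> Q (\<lambda>a b. w a b + t * cycle_count c n a b)"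
  shows "Q w"
  using nonneg supp circ
\<comment> \<open>The induction runs over the number of edges of positive weight.\<close>
proof (induction "card {e \<in> V \<times> V. w (fst e) (snd e) > 0}" arbitrary: w rule: less_induct)
  case less
  let ?P = "\<lambda>w. {e \<in> V \<times> V. w (fst e) (snd e) > (0::real)}"
  show ?case
  proof (cases "\<exists>a b. w a b > 0")
    case False
    then have "w = (\<lambda>_ _. 0)" using less.prems(1) by (intro ext) (meson antisym not_less)
    then show ?thesis using zero by simp
  next
    case True
    define W where "W = {a \<in> V. \<exists>b. w a b > 0}"
    define s where "s a = (SOME b. w a b > 0)" for a
    have s: "w a (s a) > 0" if "a \<in> W" for a
      using that someI_ex[of "\<lambda>b. w a b > 0"] unfolding W_def s_def by blast
    \<comment> \<open>Positive weight into \<open>s a\<close> forces, by conservation, positive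
      weight out of it, so following \<open>s\<close> never leaves \<open>W\<close>.\<close>
    have sW: "s a \<in> W" if "a \<in> W" for a
    proof -
      have *: "s a \<in> V" "a \<in> V" using less.prems(2)[OF s[OF that]] by auto
      have "0 < w a (s a)" using s that by blast
      also have "\<dots> \<le> (\<Sum>b\<in>V. w b (s a))"
        using * V less.prems(1) by (intro member_le_sum) auto
      also have "\<dots> = (\<Sum>b\<in>V. w (s a) b)" using less.prems(3)[OF *(1)] by simp
      finally have "\<exists>b\<in>V. w (s a) b > 0"
        by (meson not_less sum_nonpos)
      then show ?thesis using * unfolding W_def by blast
    qed
    have "W \<noteq> {}" using True less.prems(2) unfolding W_def by blast
    moreover have "finite W" using V unfolding W_def by simp
    ultimately obtain a n where a: "a \<in> W" "n \<ge> 1" "(s ^^ n) a = a"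
        and inj: "inj_on (\<lambda>i. (s ^^ i) a) {..<n}"
      using self_map_has_simple_cycle[of W s] sW by blast
    define c where "c i = (s ^^ i) a" for i
    have cW: "c i \<in> W" for i unfolding c_def using a sW by (induction i) auto
    have cV: "c i \<in> V" for i using cW unfolding W_def by blast
    have c_Suc: "c (Suc i) = s (c i)" for i by (simp add: c_def)
    have cn: "c n = c 0" using a by (simp add: c_def)
    have wc: "w (c i) (c (Suc i)) > 0" for i unfolding c_Suc using s cW by blast
    \<comment> \<open>The largest multiple of the cycle that can be removed. An edge attaining the
      minimum drops to weight 0, so fewer positive edges remain.\<close>
    define t where "t = Min ((\<lambda>i. w (c i) (c (Suc i))) ` {..<n})"
    have ne: "(\<lambda>i. w (c i) (c (Suc i))) ` {..<n} \<noteq> {}" using a(2) by (simp add: lessThan_empty_iff)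
    have t0: "t > 0" unfolding t_def using ne wc by (subst Min_gr_iff) auto
    have t_le: "t \<le> w (c i) (c (Suc i))" if "i < n" for i
      unfolding t_def using that by (intro Min_le) auto
    obtain i0 where i0: "i0 < n" "t = w (c i0) (c (Suc i0))"
      using Min_in[OF _ ne] unfolding t_def by auto
    \<comment> \<open>On a simple cycle each edge is met at most once, so removing \<open>t\<close>
      times the count leaves all weights nonnegative.\<close>
    have count: "cycle_count c n x y = (if \<exists>i<n. c i = x \<and> c (Suc i) = y then 1 else 0)" for x y
    proof (cases "\<exists>i<n. c i = x \<and> c (Suc i) = y")
      case True
      then obtain i where i: "i < n" "c i = x" "c (Suc i) = y" by blast
      have "cycle_count c n x y = (\<Sum>k<n. if k = i then 1 else 0)"
        unfolding cycle_count_def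
      proof (intro sum.cong refl)
        fix k assume k: "k \<in> {..<n}"
        have "c k \<noteq> x" if "k \<noteq> i"
          using inj_onD[OF inj, of k i] i(1,2) k that unfolding c_def by auto
        then show "(if c k = x \<and> c (Suc k) = y then 1 else 0) = (if k = i then 1 else (0::real))"
          using i(2,3) by (cases "k = i") simp_all
      qed
      then show ?thesis using True i by (simp add: sum.delta)
    next
      case False
      then show ?thesis unfolding cycle_count_def by (subst sum.neutral) auto
    qed
    define w' where "w' x y = w x y - t * cycle_count c n x y" for x y
    have w'0: "w' x y \<ge> 0" for x y
      unfolding w'_def count using less.prems(1)[of x y] t_le by auto
    have w'le: "w' x y \<le> w x y" for x y unfolding w'_def count using t0 by auto
    have "w' (c i0) (c (Suc i0)) = 0" unfolding w'_def count using i0 by auto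
    then have "(c i0, c (Suc i0)) \<in> ?P w - ?P w'" using wc cV by auto
    moreover have "?P w' \<subseteq> ?P w" using w'le by (auto intro: less_le_trans)
    ultimately have "?P w' \<subset> ?P w" by blast
    moreover have "finite (?P w)" by (rule finite_subset[OF _ finite_cartesian_product[OF V V]]) auto
    ultimately have "card (?P w') < card (?P w)" by (intro psubset_card_mono)
    moreover have "(\<Sum>b\<in>V. w' x b) = (\<Sum>b\<in>V. w' b x)" if "x \<in> V" for x
    proof -
      have "(\<Sum>b\<in>V. cycle_count c n x b) = (\<Sum>b\<in>V. cycle_count c n b x)"
        unfolding cycle_count_out[OF V cV] cycle_count_in[OF V cV]
        using sum_shift_cyclic[of "\<lambda>i. if c i = x then 1 else 0" n] cn by simp
      then show ?thesis unfolding w'_def sum_subtractf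
        using less.prems(3)[OF that] by (simp flip: sum_distrib_left)
    qed
    ultimately have "Q w'"
      using w'0 less.prems(2)[OF less_le_trans[OF _ w'le]] by (intro less.hyps) blast+
    then have "Q (\<lambda>a b. w' a b + t * cycle_count c n a b)"
      using t0 a cn cV wc less.prems(2) by (intro step) auto
    then show ?thesis by (simp add: w'_def)
  qed
qed

section \<open>Invariant measures, their circulations and periodic orbits\<close>

locale compact_system = compact_metrized X d for X :: "'m::t2_space set" and d +
  fixes T :: "'m \<Rightarrow> 'm"
  assumes T_image: "T ` X = X"
    and T_inj: "inj_on T X"
    and T_cont: "continuous_on X T"
begin

lemma T_in: "x \<in> X \<Longrightarrow> T x \<in> X"
  using T_image by blast

lemma funpow_T_in: "x \<in> X \<Longrightarrow> (T ^^ n) x \<in> X"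
  by (induction n) (auto simp: T_in)

abbreviation "B \<equiv> restrict_space borel X"

abbreviation "\<M> \<equiv> invariant_measures X T"

lemma space_B [simp]: "space B = X"
  by (simp add: space_restrict_space)

lemma T_measurable: "T \<in> measurable B B"
  using borel_measurable_continuous_on_restrict[OF T_cont] T_in
  by (intro measurable_restrict_space2) auto

lemma continuous_measurable: "continuous_on X \<phi> \<Longrightarrow> \<phi> \<in> borel_measurable B"
  by (rule borel_measurable_continuous_on_restrict)

lemma openin_sets: "openin (top_of_set X) U \<Longrightarrow> U \<in> sets B"
  by (auto simp: openin_open sets_restrict_space)

lemma ball_sets: "mball_of d x r \<in> sets B"
  by (intro openin_sets openin_ball)

lemma invariantD:
  assumes "\<mu> \<in> \<M>"
  shows "space \<mu> = X" "sets \<mu> = sets B" "prob_space \<mu>" "T \<in> measurable \<mu> \<mu>" "distr \<mu> \<mu> T = \<mu>"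
  using assms unfolding invariant_measures_def by auto

lemma compact_bounded_image:
  fixes \<phi> :: "'m \<Rightarrow> real"
  assumes "continuous_on X \<phi>"
  obtains C where "\<And>x. x \<in> X \<Longrightarrow> \<bar>\<phi> x\<bar> \<le> C"
  using compact_imp_bounded[OF compact_continuous_image[OF assms compact_X]]
  unfolding bounded_iff by auto

lemma integrable_continuous:
  fixes \<phi> :: "'m \<Rightarrow> real"
  assumes \<mu>: "\<mu> \<in> \<M>" and "continuous_on X \<phi>"
  shows "integrable \<mu> \<phi>"
proof -
  interpret prob_space \<mu> using invariantD[OF \<mu>] by simp
  obtain C where "\<And>x. x \<in> X \<Longrightarrow> \<bar>\<phi> x\<bar> \<le> C" using compact_bounded_image assms(2) by blast
  moreover have "\<phi> \<in> borel_measurable \<mu>"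
    using continuous_measurable[OF assms(2)] measurable_cong_sets[OF invariantD(2)[OF \<mu>] refl] by auto
  ultimately show ?thesis
    using invariantD[OF \<mu>] by (intro integrable_const_bound[of _ C]) auto
qed

text \<open>Finite support is encoded by test functions, the form in which it is used: a bump
  function equal to 1 on \<open>O'\<close> must integrate to 1. Forward invariance of
  \<open>O'\<close> allows orbits of nearby points to be compared with orbits inside
  \<open>O'\<close>.\<close>

definition finite_measures :: "'m measure set" where
  "finite_measures = {\<nu> \<in> \<M>. \<exists>O'. finite O' \<and> O' \<subseteq> X \<and> T ` O' \<subseteq> O' \<and>
     (\<forall>\<psi>::'m \<Rightarrow> real. continuous_on X \<psi> \<and> (\<forall>z\<in>O'. \<psi> z = 1) \<longrightarrow> (\<integral>x. \<psi> x \<partial>\<nu>) = 1)}"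

text \<open>Since \<open>T\<close> is injective and \<open>O'\<close> is invariant in both
  directions, pushing forward only reindexes the atoms. The point measure lives on the power set of
  \<open>O'\<close> and is therefore transported to the Borel sets of \<open>X\<close>.\<close>

lemma weights_to_measure:
  fixes m :: "'m \<Rightarrow> real"
  assumes O': "finite O'" "O' \<subseteq> X" "\<And>z. z \<in> X \<Longrightarrow> T z \<in> O' \<longleftrightarrow> z \<in> O'"
    and m: "\<And>z. m z \<ge> 0" "(\<Sum>z\<in>O'. m z) = 1" "\<And>z. z \<in> X \<Longrightarrow> m (T z) = m z"
  shows "\<exists>\<nu>\<in>finite_measures. \<forall>\<phi>::'m \<Rightarrow> real. continuous_on X \<phi> \<longrightarrow> (\<integral>x. \<phi> x \<partial>\<nu>) = (\<Sum>z\<in>O'. m z * \<phi> z)"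
proof -
  let ?pm = "point_measure O' (\<lambda>z. ennreal (m z))"
  define \<nu> where "\<nu> = distr ?pm B (\<lambda>z. z)"
  have meas: "(\<lambda>z. z) \<in> measurable ?pm B"
    using O' by (auto simp: measurable_def space_point_measure sets_point_measure)
  have [simp]: "space \<nu> = X" "sets \<nu> = sets B" unfolding \<nu>_def by auto
  have "prob_space ?pm"
    by (rule prob_spaceI)
      (use O' m in \<open>simp add: space_point_measure emeasure_point_measure_finite sum_ennreal\<close>)
  then have prob: "prob_space \<nu>" unfolding \<nu>_def by (rule prob_space.prob_space_distr[OF _ meas])
  have em: "emeasure \<nu> A = (\<Sum>z\<in>O' \<inter> A. ennreal (m z))" if "A \<in> sets B" for A
    unfolding \<nu>_def using that O'
    by (subst emeasure_distr[OF meas]) (auto simp: space_point_measure emeasure_point_measure_finite Int_commute)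
  have T\<nu>: "T \<in> measurable \<nu> \<nu>" using T_measurable measurable_cong_sets[of \<nu> B \<nu> B] by simp
  have "distr \<nu> \<nu> T = \<nu>"
  proof (rule measure_eqI)
    fix A assume "A \<in> sets (distr \<nu> \<nu> T)"
    then have A: "A \<in> sets B" by simp
    then have TA: "T -` A \<inter> X \<in> sets B" using measurable_sets[OF T_measurable A] by simp
    have inj: "inj_on T (O' \<inter> (T -` A \<inter> X))" using T_inj by (rule inj_on_subset) auto
    have im: "T ` (O' \<inter> (T -` A \<inter> X)) = O' \<inter> A"
    proof
      show "O' \<inter> A \<subseteq> T ` (O' \<inter> (T -` A \<inter> X))"
      proof
        fix z assume z: "z \<in> O' \<inter> A"
        then obtain y where "y \<in> X" "z = T y" using T_image O' by blast
        then show "z \<in> T ` (O' \<inter> (T -` A \<inter> X))" using z O'(3)[of y] by auto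
      qed
    qed (use O' in auto)
    have "emeasure (distr \<nu> \<nu> T) A = (\<Sum>z\<in>O' \<inter> (T -` A \<inter> X). ennreal (m z))"
      using A em[OF TA] by (subst emeasure_distr[OF T\<nu>]) auto
    also have "\<dots> = (\<Sum>z\<in>O' \<inter> (T -` A \<inter> X). ennreal (m (T z)))"
      using m by (intro sum.cong) auto
    also have "\<dots> = (\<Sum>z\<in>O' \<inter> A. ennreal (m z))"
      using sum.reindex[OF inj, of "\<lambda>z. ennreal (m z)"] im by simp
    finally show "emeasure (distr \<nu> \<nu> T) A = emeasure \<nu> A" using em A by simp
  qed simp
  then have inv: "\<nu> \<in> \<M>"
    using prob T\<nu> unfolding invariant_measures_def by simp
  have int: "(\<integral>x. \<phi> x \<partial>\<nu>) = (\<Sum>z\<in>O'. m z * \<phi> z)" if "continuous_on X \<phi>" for \<phi> :: "'m \<Rightarrow> real"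
    unfolding \<nu>_def using continuous_measurable[OF that] O' m
    by (subst integral_distr[OF meas]) (auto simp: lebesgue_integral_point_measure_finite)
  have "\<nu> \<in> finite_measures"
    unfolding finite_measures_def using inv O' m int by (intro CollectI conjI exI[of _ O']) auto
  then show ?thesis using int by blast
qed

lemma orbit_weight_sum:
  fixes h :: "'m \<Rightarrow> real"
  assumes "finite O'" "\<And>i. i < n \<Longrightarrow> (T ^^ i) z \<in> O'"
  shows "(\<Sum>y\<in>O'. (\<Sum>i<n. if (T ^^ i) z = y then 1 else 0) * h y) = (\<Sum>i<n. h ((T ^^ i) z))"
proof -
  have "(\<Sum>y\<in>O'. (\<Sum>i<n. if (T ^^ i) z = y then 1 else 0) * h y)
      = (\<Sum>i<n. \<Sum>y\<in>O'. if (T ^^ i) z = y then h y else 0)"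
    unfolding sum_distrib_right by (subst sum.swap) (intro sum.cong refl, auto)
  also have "\<dots> = (\<Sum>i<n. h ((T ^^ i) z))"
    using assms by (intro sum.cong refl) (simp add: sum.delta')
  finally show ?thesis .
qed

text \<open>Shift along the closed orbit, then cancel \<open>T\<close> by injectivity.\<close>

lemma orbit_weight_invariant:
  assumes "z \<in> X" "(T ^^ n) z = z" "y \<in> X"
  shows "(\<Sum>i<n. if (T ^^ i) z = T y then 1 else 0) = (\<Sum>i<n. if (T ^^ i) z = y then 1 else (0::real))"
proof -
  have "(\<Sum>i<n. if (T ^^ i) z = T y then 1 else (0::real)) = (\<Sum>i<n. if (T ^^ Suc i) z = T y then 1 else 0)"
    using sum_shift_cyclic[of "\<lambda>i. if (T ^^ i) z = T y then 1 else 0" n] assms by simp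
  also have "\<dots> = (\<Sum>i<n. if (T ^^ i) z = y then 1 else 0)"
    using inj_onD[OF T_inj] funpow_T_in assms(1,3) by (intro sum.cong refl) auto
  finally show ?thesis .
qed

lemma uniformly_continuous_family:
  fixes \<Phi> :: "('m \<Rightarrow> real) set"
  assumes "finite \<Phi>" "\<And>\<phi>. \<phi> \<in> \<Phi> \<Longrightarrow> continuous_on X \<phi>" "\<eta> > 0"
  shows "\<exists>\<beta>>0. \<forall>\<phi>\<in>\<Phi>. \<forall>x\<in>X. \<forall>y\<in>X. mdist d x y < \<beta> \<longrightarrow> \<bar>\<phi> x - \<phi> y\<bar> < \<eta>"
  using assms
proof (induction \<Phi>)
  case empty then show ?case by (auto intro: exI[of _ 1])
next
  case (insert \<phi> \<Phi>)
  obtain \<beta> where \<beta>: "\<beta> > 0" "\<forall>\<phi>\<in>\<Phi>. \<forall>x\<in>X. \<forall>y\<in>X. mdist d x y < \<beta> \<longrightarrow> \<bar>\<phi> x - \<phi> y\<bar> < \<eta>"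
    using insert by auto
  obtain \<beta>' where \<beta>': "\<beta>' > 0" "\<And>x y. x \<in> X \<Longrightarrow> y \<in> X \<Longrightarrow> mdist d x y < \<beta>' \<Longrightarrow> \<bar>\<phi> x - \<phi> y\<bar> < \<eta>"
    using uniformly_continuous_X[of \<phi> \<eta>] insert.prems by auto
  show ?case using \<beta> \<beta>' by (intro exI[of _ "min \<beta> \<beta>'"]) auto
qed

text \<open>Each cycle in the decomposition is traded for the visit counts of a periodic orbit
  shadowing it. The error per step is at most \<eta>, so the errors add up to at most \<eta> times
  the total weight, however long the cycles are. The point \<open>pt a b\<close> represents the edge
  from \<open>a\<close> to \<open>b\<close>.\<close>

lemma weighted_orbits_of_circulation:
  fixes \<Phi> :: "('m \<Rightarrow> real) set" and pt :: "'a \<Rightarrow> 'a \<Rightarrow> 'm" and w :: "'a \<Rightarrow> 'a \<Rightarrow> real"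
  assumes V: "finite V"
    and nonneg: "\<And>a b. w a b \<ge> 0"
    and supp: "\<And>a b. w a b > 0 \<Longrightarrow> a \<in> V \<and> b \<in> V \<and> E a b"
    and circ: "\<And>a. a \<in> V \<Longrightarrow> (\<Sum>b\<in>V. w a b) = (\<Sum>b\<in>V. w b a)"
    and shadow: "\<And>c n. n \<ge> 1 \<Longrightarrow> c n = c 0 \<Longrightarrow> (\<And>i. i < n \<Longrightarrow> E (c i) (c (Suc i))) \<Longrightarrow>
      \<exists>z\<in>X. (T ^^ n) z = z \<and> (\<forall>\<phi>\<in>\<Phi>. \<forall>i<n. \<bar>\<phi> ((T ^^ i) z) - \<phi> (pt (c i) (c (Suc i)))\<bar> \<le> \<eta>)"
  shows "\<exists>m. finite {z. m z \<noteq> 0} \<and> {z. m z \<noteq> 0} \<subseteq> X \<and> (\<forall>z. m z \<ge> 0) \<and> (\<forall>z\<in>X. m (T z) = m z) \<and>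
      (\<Sum>z | m z \<noteq> 0. m z) = (\<Sum>a\<in>V. \<Sum>b\<in>V. w a b) \<and>
      (\<forall>\<phi>\<in>\<Phi>. \<bar>(\<Sum>z | m z \<noteq> 0. m z * \<phi> z) - (\<Sum>a\<in>V. \<Sum>b\<in>V. w a b * \<phi> (pt a b))\<bar>
          \<le> \<eta> * (\<Sum>a\<in>V. \<Sum>b\<in>V. w a b))"
    (is "?Q w")
proof (rule circulation_induct[OF V nonneg supp circ, where Q = ?Q])
  show "?Q (\<lambda>_ _. 0)" by (intro exI[of _ "\<lambda>_. 0"]) simp
next
  fix w :: "'a \<Rightarrow> 'a \<Rightarrow> real" and c :: "nat \<Rightarrow> 'a" and n :: nat and t :: real
  assume Qw: "?Q w" and t: "t \<ge> 0" and n: "n \<ge> 1" "c n = c 0"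
    and cE: "\<And>i. i < n \<Longrightarrow> c i \<in> V \<and> E (c i) (c (Suc i))"
  obtain m where m: "finite {z. m z \<noteq> 0}" "{z. m z \<noteq> 0} \<subseteq> X" "\<forall>z. m z \<ge> 0" "\<forall>z\<in>X. m (T z) = m z"
    "(\<Sum>z | m z \<noteq> 0. m z) = (\<Sum>a\<in>V. \<Sum>b\<in>V. w a b)"
    "\<forall>\<phi>\<in>\<Phi>. \<bar>(\<Sum>z | m z \<noteq> 0. m z * \<phi> z) - (\<Sum>a\<in>V. \<Sum>b\<in>V. w a b * \<phi> (pt a b))\<bar>
          \<le> \<eta> * (\<Sum>a\<in>V. \<Sum>b\<in>V. w a b)"
    using Qw by blast
  have cV: "c i \<in> V" if "i \<le> n" for i
    using that cE[of i] cE[of 0] n by (cases "i = n") auto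
  obtain z where z: "z \<in> X" "(T ^^ n) z = z"
    "\<forall>\<phi>\<in>\<Phi>. \<forall>i<n. \<bar>\<phi> ((T ^^ i) z) - \<phi> (pt (c i) (c (Suc i)))\<bar> \<le> \<eta>"
    using shadow[of n c] n cE by blast
  \<comment> \<open>Number of visits to \<open>y\<close> during \<open>n\<close> steps;
    \<open>n\<close> may be a proper multiple of the least period, and then visits repeat.\<close>
  define u where "u y = (\<Sum>i<n. if (T ^^ i) z = y then 1 else (0::real))" for y
  define m' where "m' y = m y + t * u y" for y
  define O' where "O' = {z. m z \<noteq> 0} \<union> (\<lambda>i. (T ^^ i) z) ` {..<n}"
  have O': "finite O'" "O' \<subseteq> X" unfolding O'_def using m z(1) funpow_T_in by auto
  have u0: "u y \<ge> 0" for y unfolding u_def by (intro sum_nonneg) auto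
  have uO: "u y = 0" if "y \<notin> O'" for y
    unfolding u_def using that by (intro sum.neutral) (auto simp: O'_def)
  have mO: "m y = 0" if "y \<notin> O'" for y using that by (auto simp: O'_def)
  have "m' y = 0" if "y \<notin> O'" for y using uO[OF that] mO[OF that] by (simp add: m'_def)
  then have supp': "{y. m' y \<noteq> 0} \<subseteq> O'" by blast
  have sum': "(\<Sum>y | m' y \<noteq> 0. m' y * h y) = (\<Sum>y | m y \<noteq> 0. m y * h y) + t * (\<Sum>i<n. h ((T ^^ i) z))"
    for h :: "'m \<Rightarrow> real"
  proof -
    have "(\<Sum>y | m' y \<noteq> 0. m' y * h y) = (\<Sum>y\<in>O'. m' y * h y)"
      using O' supp' by (intro sum.mono_neutral_left) auto
    also have "\<dots> = (\<Sum>y\<in>O'. m y * h y) + t * (\<Sum>y\<in>O'. u y * h y)"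
      unfolding m'_def by (simp add: sum.distrib sum_distrib_left algebra_simps)
    also have "(\<Sum>y\<in>O'. m y * h y) = (\<Sum>y | m y \<noteq> 0. m y * h y)"
      using O' by (intro sum.mono_neutral_right) (auto simp: O'_def)
    also have "(\<Sum>y\<in>O'. u y * h y) = (\<Sum>i<n. h ((T ^^ i) z))"
      unfolding u_def using O' by (intro orbit_weight_sum) (auto simp: O'_def)
    finally show ?thesis .
  qed
  have sumw: "(\<Sum>a\<in>V. \<Sum>b\<in>V. (w a b + t * cycle_count c n a b) * h a b)
      = (\<Sum>a\<in>V. \<Sum>b\<in>V. w a b * h a b) + t * (\<Sum>i<n. h (c i) (c (Suc i)))" for h
  proof -
    have "(\<Sum>a\<in>V. \<Sum>b\<in>V. (w a b + t * cycle_count c n a b) * h a b)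
      = (\<Sum>a\<in>V. \<Sum>b\<in>V. w a b * h a b) + t * (\<Sum>a\<in>V. \<Sum>b\<in>V. cycle_count c n a b * h a b)"
      by (simp add: sum.distrib sum_distrib_left algebra_simps)
    then show ?thesis using cycle_count_sum[OF V cV] by simp
  qed
  have sumw1: "(\<Sum>a\<in>V. \<Sum>b\<in>V. w a b + t * cycle_count c n a b) = (\<Sum>a\<in>V. \<Sum>b\<in>V. w a b) + t * n"
    using sumw[of "\<lambda>_ _. 1"] by simp
  show "?Q (\<lambda>a b. w a b + t * cycle_count c n a b)"
  proof (intro exI[of _ m'] conjI allI ballI)
    show "finite {z. m' z \<noteq> 0}" "{z. m' z \<noteq> 0} \<subseteq> X" using supp' O' by (auto intro: finite_subset)
    show "m' y \<ge> 0" for y unfolding m'_def using m(3) t u0 by simp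
    show "m' (T y) = m' y" if "y \<in> X" for y
      unfolding m'_def u_def using m(4) that orbit_weight_invariant[OF z(1,2) that] by simp
    show "(\<Sum>z | m' z \<noteq> 0. m' z) = (\<Sum>a\<in>V. \<Sum>b\<in>V. w a b + t * cycle_count c n a b)"
      using sum'[of "\<lambda>_. 1"] m(5) sumw1 by simp
    fix \<phi> assume \<phi>: "\<phi> \<in> \<Phi>"
    have "\<bar>(\<Sum>i<n. \<phi> ((T ^^ i) z)) - (\<Sum>i<n. \<phi> (pt (c i) (c (Suc i))))\<bar> \<le> (\<Sum>i<n. \<eta>)"
      unfolding sum_subtractf[symmetric] using z(3) \<phi> by (intro order_trans[OF sum_abs] sum_mono) auto
    then have "\<bar>t * ((\<Sum>i<n. \<phi> ((T ^^ i) z)) - (\<Sum>i<n. \<phi> (pt (c i) (c (Suc i)))))\<bar> \<le> t * (n * \<eta>)"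
      unfolding abs_mult using t by (simp add: mult_left_mono)
    then show "\<bar>(\<Sum>z | m' z \<noteq> 0. m' z * \<phi> z) - (\<Sum>a\<in>V. \<Sum>b\<in>V. (w a b + t * cycle_count c n a b) * \<phi> (pt a b))\<bar>
          \<le> \<eta> * (\<Sum>a\<in>V. \<Sum>b\<in>V. w a b + t * cycle_count c n a b)"
      unfolding sum' sumw sumw1 using m(6) \<phi> by (force simp: algebra_simps)
  qed
qed

text \<open>Choosing the first set that contains a point turns a cover by Borel sets into a
  measurable partition.\<close>

lemma least_index:
  fixes A :: "nat \<Rightarrow> 'm set"
  assumes cover: "X \<subseteq> (\<Union>i<K. A i)" and A: "\<And>i. A i \<in> sets B"
  defines "c \<equiv> \<lambda>x. LEAST i. x \<in> A i"
  shows "\<And>x. x \<in> X \<Longrightarrow> c x < K" "\<And>x. x \<in> X \<Longrightarrow> x \<in> A (c x)"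
    "c \<in> measurable B (count_space UNIV)"
proof -
  fix x assume "x \<in> X"
  then obtain i where i: "i < K" "x \<in> A i" using cover by blast
  then show "c x < K" unfolding c_def by (meson Least_le le_less_trans)
  show "x \<in> A (c x)" unfolding c_def using i(2) by (rule LeastI)
next
  have "{x \<in> X. x \<in> A i} = A i" for i using sets.sets_into_space[OF A[of i]] by auto
  then show "c \<in> measurable B (count_space UNIV)"
    unfolding c_def using A by (intro measurable_Least) (simp add: pred_def)
qed

text \<open>Both sums are the mass of the cell with index \<open>a\<close>: the left one splits it
  by the next cell, the right one is the mass of its preimage under \<open>T\<close>, and \<mu> is
  invariant.\<close>

lemma measure_circulation:
  assumes \<mu>: "\<mu> \<in> \<M>"
    and c: "c \<in> measurable B (count_space UNIV)" and cK: "\<And>x. x \<in> X \<Longrightarrow> c x < (K::nat)"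
  defines "cell \<equiv> \<lambda>a b. {x \<in> X. c x = a \<and> c (T x) = b}"
  shows "\<And>a b. cell a b \<in> sets \<mu>"
    "\<And>a. (\<Sum>b<K. measure \<mu> (cell a b)) = (\<Sum>b<K. measure \<mu> (cell b a))"
proof -
  note inv = invariantD[OF \<mu>]
  interpret prob_space \<mu> using inv by simp
  have c\<mu> [measurable]: "c \<in> measurable \<mu> (count_space UNIV)"
    using c measurable_cong_sets[OF inv(2) refl] by blast
  have [measurable]: "T \<in> measurable \<mu> \<mu>" by (rule inv)
  have cell_alt: "cell a b = {x \<in> space \<mu>. c x = a \<and> c (T x) = b}" for a b
    unfolding cell_def inv by simp
  show cell_sets: "cell a b \<in> sets \<mu>" for a b
    unfolding cell_alt by measurable
  fix a
  have "(\<Sum>b<K. measure \<mu> (cell a b)) = measure \<mu> (\<Union>b<K. cell a b)"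
    using cell_sets by (intro finite_measure_finite_Union[symmetric]) (auto simp: disjoint_family_on_def cell_def)
  also have "(\<Union>b<K. cell a b) = {x \<in> space \<mu>. c x = a}"
    using cK T_in unfolding cell_def inv by auto
  finally have 1: "(\<Sum>b<K. measure \<mu> (cell a b)) = measure \<mu> {x \<in> space \<mu>. c x = a}" .
  have "(\<Sum>b<K. measure \<mu> (cell b a)) = measure \<mu> (\<Union>b<K. cell b a)"
    using cell_sets by (intro finite_measure_finite_Union[symmetric]) (auto simp: disjoint_family_on_def cell_def)
  also have "(\<Union>b<K. cell b a) = T -` {x \<in> space \<mu>. c x = a} \<inter> space \<mu>"
    using cK T_in unfolding cell_def inv by auto
  also have "measure \<mu> (T -` {x \<in> space \<mu>. c x = a} \<inter> space \<mu>) = measure (distr \<mu> \<mu> T) {x \<in> space \<mu>. c x = a}"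
    by (intro measure_distr[symmetric]) simp_all
  also have "\<dots> = measure \<mu> {x \<in> space \<mu>. c x = a}" using inv by simp
  finally show "(\<Sum>b<K. measure \<mu> (cell a b)) = (\<Sum>b<K. measure \<mu> (cell b a))" using 1 by simp
qed

lemma finite_measures_approximate:
  fixes \<Phi> :: "('m \<Rightarrow> real) set"
  assumes \<mu>: "\<mu> \<in> \<M>" and shadowing: "periodic_shadowing X T d"
    and \<Phi>: "finite \<Phi>" "\<And>\<phi>. \<phi> \<in> \<Phi> \<Longrightarrow> continuous_on X \<phi>" and \<eta>: "\<eta> > 0"
  shows "\<exists>\<nu>\<in>finite_measures. \<forall>\<phi>\<in>\<Phi>. \<bar>(\<integral>x. \<phi> x \<partial>\<nu>) - (\<integral>x. \<phi> x \<partial>\<mu>)\<bar> < \<eta>"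
proof -
  note inv = invariantD[OF \<mu>]
  interpret prob_space \<mu> using inv by simp
  \<comment> \<open>Two errors of size \<open>\<eta> / 3\<close> occur, one from replacing \<phi> by
    a step function on the cells and one from shadowing; their sum is strictly below \<eta>.\<close>
  have "\<eta> / 3 > 0" using \<eta> by simp
  then obtain \<beta> where \<beta>: "\<beta> > 0"
    "\<forall>\<phi>\<in>\<Phi>. \<forall>x\<in>X. \<forall>y\<in>X. mdist d x y < \<beta> \<longrightarrow> \<bar>\<phi> x - \<phi> y\<bar> < \<eta> / 3"
    using uniformly_continuous_family[OF \<Phi>] by blast
  obtain \<alpha> where \<alpha>: "\<alpha> > 0"
    "\<forall>n\<ge>1. \<forall>x. (\<forall>i<n. x i \<in> X \<and> mdist d (T (x i)) (x (Suc i mod n)) < \<alpha>) \<longrightarrow>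
        (\<exists>z\<in>X. (T ^^ n) z = z \<and> (\<forall>i<n. mdist d ((T ^^ i) z) (x i) < \<beta>))"
    using shadowing[unfolded periodic_shadowing_def, rule_format, OF \<beta>(1)] by (elim exE conjE)
  \<comment> \<open>Half, so that two points of one ball are closer than both \<alpha> and
    \<beta>.\<close>
  define r where "r = min \<alpha> \<beta> / 2"
  have r: "r > 0" using \<alpha> \<beta> by (simp add: r_def)
  obtain Z where Z: "finite Z" "Z \<subseteq> X" "X \<subseteq> (\<Union>z\<in>Z. mball_of d z r)"
    using finite_ball_cover[OF r] by blast
  obtain e where e: "bij_betw e {0..<card Z} Z" using ex_bij_betw_nat_finite[OF Z(1)] by blast
  define K where "K = card Z"
  have eZ: "e ` {..<K} = Z" using e by (simp add: bij_betw_def K_def atLeast0LessThan)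
  then have cover: "X \<subseteq> (\<Union>i<K. mball_of d (e i) r)" using Z(3) by auto
  define c where "c x = (LEAST i. x \<in> mball_of d (e i) r)" for x
  note c = least_index[OF cover ball_sets, folded c_def]
  have same: "mdist d x y < min \<alpha> \<beta>" if "x \<in> X" "y \<in> X" "c x = c y" for x y
  proof -
    have "mdist d (e (c x)) x < r" "mdist d (e (c x)) y < r" "e (c x) \<in> X"
      using c(2)[of x] c(2)[of y] that by auto
    then show ?thesis
      using dist_triangle_d[of x "e (c x)" y] dist_commute_d[of x] that unfolding r_def by auto
  qed
  define cell where "cell a b = {x \<in> X. c x = a \<and> c (T x) = b}" for a b
  note cell = measure_circulation[OF \<mu> c(3) c(1), folded cell_def]
  define w where "w a b = (measure \<mu> (cell a b))" for a b
  define pt where "pt a b = (SOME x. x \<in> cell a b)" for a b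
  have pt: "pt a b \<in> cell a b" if "cell a b \<noteq> {}" for a b
    using that unfolding pt_def by (meson ex_in_conv someI_ex)
  have "\<exists>m. finite {z. m z \<noteq> 0} \<and> {z. m z \<noteq> 0} \<subseteq> X \<and> (\<forall>z. m z \<ge> 0) \<and> (\<forall>z\<in>X. m (T z) = m z) \<and>
      (\<Sum>z | m z \<noteq> 0. m z) = (\<Sum>a<K. \<Sum>b<K. w a b) \<and>
      (\<forall>\<phi>\<in>\<Phi>. \<bar>(\<Sum>z | m z \<noteq> 0. m z * \<phi> z) - (\<Sum>a<K. \<Sum>b<K. w a b * \<phi> (pt a b))\<bar>
          \<le> \<eta> / 3 * (\<Sum>a<K. \<Sum>b<K. w a b))"
  proof (rule weighted_orbits_of_circulation[where E = "\<lambda>a b. cell a b \<noteq> {}"])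
    show "w a b \<ge> 0" for a b by (simp add: w_def)
    show "a \<in> {..<K} \<and> b \<in> {..<K} \<and> cell a b \<noteq> {}" if "w a b > 0" for a b
    proof -
      have "cell a b \<noteq> {}" using that by (auto simp: w_def)
      then show ?thesis using c(1) T_in by (auto simp: cell_def)
    qed
    show "(\<Sum>b<K. w a b) = (\<Sum>b<K. w b a)" for a unfolding w_def by (rule cell(2))
  next
    fix g :: "nat \<Rightarrow> nat" and n :: nat
    assume n: "n \<ge> 1" "g n = g 0" and ne: "\<And>i. i < n \<Longrightarrow> cell (g i) (g (Suc i)) \<noteq> {}"
    have *: "pt (g i) (g (Suc i)) \<in> X" "c (pt (g i) (g (Suc i))) = g i" "c (T (pt (g i) (g (Suc i)))) = g (Suc i)"
      if "i < n" for i using pt[OF ne[OF that]] by (auto simp: cell_def)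
    have "g (Suc i mod n) = g (Suc i)" if "i < n" for i
      using that n by (cases "Suc i = n") auto
    \<comment> \<open>The image of one representative and the next representative lie in the same
      cell, so the jump is below \<alpha>.\<close>
    then have "mdist d (T (pt (g i) (g (Suc i)))) (pt (g (Suc i mod n)) (g (Suc (Suc i mod n)))) < \<alpha>" if "i < n" for i
      using same[of "T (pt (g i) (g (Suc i)))" "pt (g (Suc i mod n)) (g (Suc (Suc i mod n)))"]
        *[OF that] *[of "Suc i mod n"] T_in that by simp
    then obtain z where z: "z \<in> X" "(T ^^ n) z = z" "\<forall>i<n. mdist d ((T ^^ i) z) (pt (g i) (g (Suc i))) < \<beta>"
      using \<alpha>(2)[rule_format, of n "\<lambda>i. pt (g i) (g (Suc i))"] n * by auto
    then show "\<exists>z\<in>X. (T ^^ n) z = z \<and> (\<forall>\<phi>\<in>\<Phi>. \<forall>i<n. \<bar>\<phi> ((T ^^ i) z) - \<phi> (pt (g i) (g (Suc i)))\<bar> \<le> \<eta> / 3)"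
      using \<beta>(2) * funpow_T_in by (intro bexI[of _ z] conjI ballI allI impI) (simp_all add: less_imp_le)
  qed simp
  then obtain m where m: "finite {z. m z \<noteq> 0}" "{z. m z \<noteq> 0} \<subseteq> X" "\<And>z. m z \<ge> 0" "\<And>z. z \<in> X \<Longrightarrow> m (T z) = m z"
    "(\<Sum>z | m z \<noteq> 0. m z) = (\<Sum>a<K. \<Sum>b<K. w a b)"
    "\<And>\<phi>. \<phi> \<in> \<Phi> \<Longrightarrow> \<bar>(\<Sum>z | m z \<noteq> 0. m z * \<phi> z) - (\<Sum>a<K. \<Sum>b<K. w a b * \<phi> (pt a b))\<bar>
          \<le> \<eta> / 3 * (\<Sum>a<K. \<Sum>b<K. w a b)"
    by blast
  have int_ind: "integrable \<mu> (\<lambda>x. t * indicator (cell a b) x)" for t :: real and a b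
    using cell(1)[of a b] by (intro integrable_mult_right integrable_real_indicator)
      (simp_all add: emeasure_finite less_top[symmetric])
  have int_ind_eq: "(\<integral>x. t * indicator (cell a b) x \<partial>\<mu>) = w a b * t" for t a b
    using cell(1)[of a b] sets.sets_into_space[OF cell(1)[of a b]] by (simp add: w_def Int_absorb2)
  have step_int: "(\<integral>x. (\<Sum>a<K. \<Sum>b<K. h a b * indicator (cell a b) x) \<partial>\<mu>) = (\<Sum>a<K. \<Sum>b<K. w a b * h a b)"
    "integrable \<mu> (\<lambda>x. \<Sum>a<K. \<Sum>b<K. h a b * indicator (cell a b) x)" for h :: "nat \<Rightarrow> nat \<Rightarrow> real"
  proof -
    show "integrable \<mu> (\<lambda>x. \<Sum>a<K. \<Sum>b<K. h a b * indicator (cell a b) x)"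
      by (intro Bochner_Integration.integrable_sum int_ind)
    show "(\<integral>x. (\<Sum>a<K. \<Sum>b<K. h a b * indicator (cell a b) x) \<partial>\<mu>) = (\<Sum>a<K. \<Sum>b<K. w a b * h a b)"
      by (subst Bochner_Integration.integral_sum, intro Bochner_Integration.integrable_sum int_ind,
          intro sum.cong refl, subst Bochner_Integration.integral_sum, rule int_ind)
        (simp only: int_ind_eq)
  qed
  have step_val: "(\<Sum>a<K. \<Sum>b<K. h a b * indicator (cell a b) x) = h (c x) (c (T x))"
    if "x \<in> X" for x and h :: "nat \<Rightarrow> nat \<Rightarrow> real"
  proof -
    have "(\<Sum>a<K. \<Sum>b<K. h a b * indicator (cell a b) x)
        = (\<Sum>a<K. if c x = a then \<Sum>b<K. if c (T x) = b then h a b else 0 else 0)"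
      using that by (intro sum.cong refl) (auto simp: cell_def indicator_def intro!: sum.cong)
    also have "\<dots> = h (c x) (c (T x))" using c(1)[OF that] c(1)[OF T_in[OF that]] by (simp add: sum.delta')
    finally show ?thesis .
  qed
  have "(\<Sum>a<K. \<Sum>b<K. w a b) = (\<integral>x. 1 \<partial>\<mu>)"
    unfolding step_int(1)[of "\<lambda>_ _. 1", simplified, symmetric]
    using step_val[of _ "\<lambda>_ _. 1"] inv(1) by (intro Bochner_Integration.integral_cong) auto
  then have w1: "(\<Sum>a<K. \<Sum>b<K. w a b) = 1" using prob_space by simp
  have "{z. m z \<noteq> 0} \<subseteq> X" by (rule m)
  moreover have "T z \<in> {z. m z \<noteq> 0} \<longleftrightarrow> z \<in> {z. m z \<noteq> 0}" if "z \<in> X" for z using m(4)[OF that] by simp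
  ultimately obtain \<nu> where \<nu>: "\<nu> \<in> finite_measures"
    "\<And>\<phi>::'m\<Rightarrow>real. continuous_on X \<phi> \<Longrightarrow> (\<integral>x. \<phi> x \<partial>\<nu>) = (\<Sum>z | m z \<noteq> 0. m z * \<phi> z)"
    using weights_to_measure[OF m(1), of m] m(3,4,5) w1 by auto
  have "\<bar>(\<integral>x. \<phi> x \<partial>\<nu>) - (\<integral>x. \<phi> x \<partial>\<mu>)\<bar> < \<eta>" if \<phi>: "\<phi> \<in> \<Phi>" for \<phi>
  proof -
    let ?s = "\<lambda>x. \<Sum>a<K. \<Sum>b<K. \<phi> (pt a b) * indicator (cell a b) x"
    have i\<phi>: "integrable \<mu> \<phi>" using integrable_continuous[OF \<mu> \<Phi>(2)[OF \<phi>]] .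
    have close: "\<bar>\<phi> x - ?s x\<bar> \<le> \<eta> / 3" if x: "x \<in> X" for x
    proof -
      have "x \<in> cell (c x) (c (T x))" using x by (simp add: cell_def)
      then have "pt (c x) (c (T x)) \<in> cell (c x) (c (T x))" by (intro pt) blast
      then have "mdist d x (pt (c x) (c (T x))) < \<beta>" "pt (c x) (c (T x)) \<in> X"
        using same[OF x, of "pt (c x) (c (T x))"] by (auto simp: cell_def)
      then show ?thesis unfolding step_val[OF x] using \<beta>(2) \<phi> x by (simp add: less_imp_le)
    qed
    have "\<bar>(\<integral>x. \<phi> x \<partial>\<mu>) - (\<integral>x. ?s x \<partial>\<mu>)\<bar> = \<bar>\<integral>x. \<phi> x - ?s x \<partial>\<mu>\<bar>"
      using i\<phi> step_int(2) by (subst Bochner_Integration.integral_diff) auto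
    also have "\<dots> \<le> (\<integral>x. \<bar>\<phi> x - ?s x\<bar> \<partial>\<mu>)" by (rule integral_abs_bound)
    also have "\<dots> \<le> (\<integral>x. \<eta> / 3 \<partial>\<mu>)"
      using close i\<phi> step_int(2) inv(1) by (intro integral_mono integrable_abs Bochner_Integration.integrable_diff) auto
    also have "\<dots> = \<eta> / 3" using prob_space by simp
    finally have "\<bar>(\<integral>x. \<phi> x \<partial>\<mu>) - (\<Sum>a<K. \<Sum>b<K. w a b * \<phi> (pt a b))\<bar> \<le> \<eta> / 3"
      unfolding step_int(1) .
    moreover have "\<bar>(\<Sum>z | m z \<noteq> 0. m z * \<phi> z) - (\<Sum>a<K. \<Sum>b<K. w a b * \<phi> (pt a b))\<bar> \<le> \<eta> / 3"
      using m(6)[OF \<phi>] w1 by simp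
    ultimately show ?thesis unfolding \<nu>(2)[OF \<Phi>(2)[OF \<phi>]] using \<eta> by linarith
  qed
  then show ?thesis using \<nu>(1) by blast
qed

end

section \<open>Entropy and dimension\<close>

lemma measurable_PiE_count_space:
  assumes "finite I" "\<And>i. i \<in> I \<Longrightarrow> finite (A i)"
    and "\<And>i. i \<in> I \<Longrightarrow> g i \<in> measurable M (count_space (A i))"
  shows "(\<lambda>y. \<lambda>i\<in>I. g i y) \<in> measurable M (count_space (PiE I A))"
proof -
  have fin: "finite (PiE I A)" using assms by (intro finite_PiE) auto
  have A: "g i y \<in> A i" if "y \<in> space M" "i \<in> I" for i y
    using measurable_space[OF assms(3)[OF that(2)] that(1)] by simp
  have "(\<lambda>y. \<lambda>i\<in>I. g i y) -` {w} \<inter> space M \<in> sets M" if w: "w \<in> PiE I A" for w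
  proof -
    have "(\<lambda>y. \<lambda>i\<in>I. g i y) -` {w} \<inter> space M = {y \<in> space M. \<forall>i\<in>I. g i y = w i}"
      using w by (auto simp: PiE_def intro!: extensionalityI[of _ I])
    also have "\<dots> \<in> sets M"
    proof (intro sets.sets_Collect_finite_All assms(1))
      fix i assume i: "i \<in> I"
      have "g i -` {w i} \<inter> space M \<in> sets M"
        using w i by (intro measurable_sets[OF assms(3)[OF i]]) auto
      then show "{y \<in> space M. g i y = w i} \<in> sets M"
        by (rule back_subst[of "\<lambda>A. A \<in> sets M"]) auto
    qed
    finally show ?thesis .
  qed
  then show ?thesis using A fin by (subst measurable_count_space_eq2[OF fin]) auto
qed

context prob_space
begin

lemma integral_finite_range:
  fixes h :: "'b \<Rightarrow> real"
  assumes W: "W \<in> measurable M (count_space A)" and A: "finite A"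
  shows "integrable M (\<lambda>x. h (W x))"
    "(\<integral>x. h (W x) \<partial>M) = (\<Sum>w\<in>A. h w * prob (W -` {w} \<inter> space M))"
proof -
  let ?C = "\<lambda>w. W -` {w} \<inter> space M"
  have C: "?C w \<in> events" if "w \<in> A" for w using measurable_sets[OF W, of "{w}"] that by simp
  have WA: "W x \<in> A" if "x \<in> space M" for x using measurable_space[OF W that] by simp
  have eq: "h (W x) = (\<Sum>w\<in>A. h w * indicator (?C w) x)" if "x \<in> space M" for x
  proof -
    have "(\<Sum>w\<in>A. h w * indicator (?C w) x) = (\<Sum>w\<in>A. if W x = w then h w else 0)"
      using that by (intro sum.cong) (auto simp: indicator_def)
    then show ?thesis using A WA[OF that] by (simp add: sum.delta')
  qed
  have ind: "integrable M (\<lambda>x. h w * indicator (?C w) x)" if "w \<in> A" for w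
    using C[OF that] by (intro integrable_mult_right integrable_real_indicator)
      (simp_all add: emeasure_finite less_top[symmetric])
  have "integrable M (\<lambda>x. \<Sum>w\<in>A. h w * indicator (?C w) x)"
    using ind by (intro Bochner_Integration.integrable_sum)
  then show "integrable M (\<lambda>x. h (W x))"
    by (subst Bochner_Integration.integrable_cong[OF refl eq])
  have "(\<integral>x. h (W x) \<partial>M) = (\<integral>x. (\<Sum>w\<in>A. h w * indicator (?C w) x) \<partial>M)"
    by (intro Bochner_Integration.integral_cong refl eq)
  also have "\<dots> = (\<Sum>w\<in>A. \<integral>x. h w * indicator (?C w) x \<partial>M)"
    using ind by (rule Bochner_Integration.integral_sum)
  also have "\<dots> = (\<Sum>w\<in>A. h w * prob (?C w))"
    by (intro sum.cong refl) simp
  finally show "(\<integral>x. h (W x) \<partial>M) = (\<Sum>w\<in>A. h w * prob (W -` {w} \<inter> space M))" .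
qed

text \<open>Since \<open>ln 0 = 0\<close>, the logarithm is not monotone at 0. Logarithms of
  measures are therefore compared off the null set formed by the atoms of mass 0.\<close>

lemma AE_finite_range_positive:
  assumes W: "W \<in> measurable M (count_space A)" and A: "finite A"
  shows "AE x in M. prob (W -` {W x} \<inter> space M) > 0"
proof -
  have "AE x in M. W x = w \<longrightarrow> prob (W -` {w} \<inter> space M) > 0" if "w \<in> A" for w
  proof (cases "prob (W -` {w} \<inter> space M) = 0")
    case True
    have "W -` {w} \<inter> space M \<in> null_sets M"
      using True measurable_sets[OF W, of "{w}"] that by (intro null_setsI) (auto simp: emeasure_eq_measure)
    then show ?thesis by (rule AE_I') auto
  next
    case False
    then show ?thesis by (simp add: zero_less_measure_iff)
  qed
  then have "AE x in M. \<forall>w\<in>A. W x = w \<longrightarrow> prob (W -` {w} \<inter> space M) > 0"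
    using A by (intro AE_finite_allI)
  then show ?thesis
    by (rule AE_mp) (use measurable_space[OF W] in \<open>intro AE_I2 impI, auto\<close>)
qed

text \<open>This is \<open>ln t \<le> t - 1\<close> at the quotient of \<open>Q w\<close> by the
  mass of the atom of \<open>w\<close>, weighted by these masses and summed. An atom of mass 0
  contributes nothing on the left and \<open>Q w > 0\<close> on the right.\<close>

lemma gibbs_inequality:
  fixes Q :: "'b \<Rightarrow> real"
  assumes W: "W \<in> measurable M (count_space A)" and A: "finite A"
    and Q: "\<And>w. w \<in> A \<Longrightarrow> Q w > 0" "(\<Sum>w\<in>A. Q w) \<le> 1"
  shows "(\<integral>x. ln (Q (W x)) \<partial>M) \<le> (\<integral>x. ln (prob (W -` {W x} \<inter> space M)) \<partial>M)"
proof -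
  let ?P = "\<lambda>w. prob (W -` {w} \<inter> space M)"
  have total: "(\<Sum>w\<in>A. ?P w) = 1"
    using integral_finite_range(2)[OF W A, of "\<lambda>_. 1"] prob_space by simp
  have "ln (Q w) * ?P w - ln (?P w) * ?P w \<le> Q w - ?P w" if w: "w \<in> A" for w
  proof (cases "?P w = 0")
    case True then show ?thesis using Q(1)[OF w] by simp
  next
    case False
    then have pos: "?P w > 0" by (simp add: zero_less_measure_iff)
    have "ln (Q w) - ln (?P w) = ln (Q w / ?P w)" using pos Q(1)[OF w] by (simp add: ln_div)
    also have "\<dots> \<le> Q w / ?P w - 1" using pos Q(1)[OF w] by (intro ln_le_minus_one) simp
    finally have "(ln (Q w) - ln (?P w)) * ?P w \<le> (Q w / ?P w - 1) * ?P w"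
      using pos by (intro mult_right_mono) auto
    moreover have "(Q w / ?P w - 1) * ?P w = Q w - ?P w" using pos by (simp add: left_diff_distrib)
    ultimately show ?thesis by (simp add: left_diff_distrib)
  qed
  then have "(\<Sum>w\<in>A. ln (Q w) * ?P w - ln (?P w) * ?P w) \<le> (\<Sum>w\<in>A. Q w - ?P w)"
    by (rule sum_mono)
  then show ?thesis
    using Q(2) total integral_finite_range(2)[OF W A, of "\<lambda>w. ln (Q w)"]
      integral_finite_range(2)[OF W A, of "\<lambda>w. ln (?P w)"]
    by (simp add: sum_subtractf)
qed

text \<open>The tangent line of \<open>exp\<close> at the mean of \<open>l\<close> lies below
  \<open>exp\<close>; integrate it.\<close>

lemma jensen_exp:
  fixes l :: "'a \<Rightarrow> real"
  assumes "integrable M l" "integrable M (\<lambda>x. exp (l x))"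
  shows "exp (\<integral>x. l x \<partial>M) \<le> (\<integral>x. exp (l x) \<partial>M)"
proof -
  define a where "a = (\<integral>x. l x \<partial>M)"
  have "exp a * (1 + (l x - a)) \<le> exp (l x)" for x
  proof -
    have "exp a * (1 + (l x - a)) \<le> exp a * exp (l x - a)"
      by (intro mult_left_mono exp_ge_add_one_self) simp
    then show ?thesis by (simp flip: exp_add)
  qed
  then have "(\<integral>x. exp a * (1 + (l x - a)) \<partial>M) \<le> (\<integral>x. exp (l x) \<partial>M)"
    using assms by (intro integral_mono) auto
  moreover have "(\<integral>x. exp a * (1 + (l x - a)) \<partial>M) = exp a"
    using assms prob_space by (simp add: a_def)
  ultimately show ?thesis by (simp add: a_def)
qed

end

section \<open>Exponential separation in a hyperbolic metric\<close>

text \<open>One step of growth fixes the direction: once \<open>k * b j \<le> b (Suc j)\<close>, the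
  term \<open>b j\<close> is smaller than \<open>k * b (Suc j)\<close> and cannot be what realizes
  the next maximum, so the growth goes on.\<close>

lemma growth_of_expansive_sequence:
  fixes b :: "nat \<Rightarrow> real"
  assumes k: "k > 1" and b: "\<And>j. b j \<ge> 0" "b 0 > 0" "b 1 \<ge> k * b 0"
    and ex: "\<And>j. 1 \<le> j \<Longrightarrow> j < n \<Longrightarrow> k * b j \<le> max (b (Suc j)) (b (j - 1))"
  shows "k ^ n * b 0 \<le> b n"
proof -
  have "j \<le> n \<Longrightarrow> k ^ j * b 0 \<le> b j \<and> (j < n \<longrightarrow> k * b j \<le> b (Suc j))" for j
  proof (induction j)
    case 0 then show ?case using b by simp
  next
    case (Suc j)
    then have IH: "k ^ j * b 0 \<le> b j" "k * b j \<le> b (Suc j)" by auto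
    have 1: "k ^ Suc j * b 0 \<le> b (Suc j)"
    proof -
      have "k ^ Suc j * b 0 = k * (k ^ j * b 0)" by simp
      also have "\<dots> \<le> k * b j" using IH k by (intro mult_left_mono) auto
      finally show ?thesis using IH by simp
    qed
    have pos: "b (Suc j) > 0" using 1 b(2) k by (smt (verit) zero_less_mult_iff zero_less_power)
    have "b j < k * b (Suc j)"
    proof -
      have "b j \<le> k * b j" using k b(1)[of j] by (simp add: mult_le_cancel_right1)
      also have "\<dots> \<le> b (Suc j)" by (rule IH)
      also have "\<dots> < k * b (Suc j)" using pos k by simp
      finally show ?thesis .
    qed
    then show ?case using 1 ex[of "Suc j"] by (auto simp: max_def split: if_splits)
  qed
  then show ?thesis by simp
qed

locale hyperbolic_system = compact_system X d T for X :: "'m::t2_space set" and d T +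
  fixes k \<epsilon> :: real
  assumes k: "k > 1" and \<epsilon>: "\<epsilon> > 0"
    and expansive: "\<And>x y. x \<in> X \<Longrightarrow> y \<in> X \<Longrightarrow>
      min (k * mdist d x y) \<epsilon> \<le> max (mdist d (T x) (T y)) (mdist d (inv_into X T x) (inv_into X T y))"
begin

text \<open>From the middle time \<open>n\<close> the distance grows by the factor \<open>k\<close>
  in at least one direction of time, and then at each further step in that direction. After
  \<open>n\<close> steps it is still below \<epsilon>. Since the direction is unknown, both sides of
  the middle time have to be controlled.\<close>

lemma bowen_ball:
  assumes xy: "x \<in> X" "y \<in> X" and close: "\<And>i. i \<le> 2 * n \<Longrightarrow> mdist d ((T ^^ i) x) ((T ^^ i) y) < \<epsilon>"
  shows "mdist d ((T ^^ n) x) ((T ^^ n) y) \<le> \<epsilon> / k ^ n"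
proof -
  define a where "a i = mdist d ((T ^^ i) x) ((T ^^ i) y)" for i
  have a0: "a i \<ge> 0" for i by (simp add: a_def)
  have step: "k * a i \<le> max (a (Suc i)) (a (i - 1))" if i: "1 \<le> i" "i < 2 * n" for i
  proof -
    obtain j where j: "i = Suc j" using i by (cases i) auto
    have "inv_into X T ((T ^^ i) u) = (T ^^ j) u" if "u \<in> X" for u
      using funpow_T_in[OF that, of j] by (simp add: j inv_into_f_f[OF T_inj])
    then have "min (k * a i) \<epsilon> \<le> max (a (Suc i)) (a (i - 1))"
      using expansive[OF funpow_T_in[OF xy(1), of i] funpow_T_in[OF xy(2), of i]] xy
      unfolding a_def by (simp add: j)
    \<comment> \<open>Neighbouring distances are below \<epsilon>, so the minimum in the expansion
      inequality must be \<open>k * a i\<close>.\<close>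
    moreover have "max (a (Suc i)) (a (i - 1)) < \<epsilon>"
      using close[of "Suc i"] close[of "i - 1"] i by (simp add: a_def)
    ultimately show ?thesis by (auto simp: min_def split: if_splits)
  qed
  show ?thesis
  proof (cases "a n = 0 \<or> n = 0")
    case True
    then show ?thesis
    proof
      assume "a n = 0"
      then show ?thesis using \<epsilon> k unfolding a_def by simp
    next
      assume "n = 0"
      then show ?thesis using close[of 0] by simp
    qed
  next
    case False
    then have n: "n \<ge> 1" and "a n \<noteq> 0" by simp_all
    then have an: "a n > 0" using a0[of n] by linarith
    have "k ^ n * a n \<le> max (a (2 * n)) (a 0)"
    proof (cases "k * a n \<le> a (Suc n)")
      case True
      have "k ^ n * a (n + 0) \<le> a (n + n)"
      proof (rule growth_of_expansive_sequence[OF k, of "\<lambda>j. a (n + j)"])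
        fix j assume j: "1 \<le> j" "j < n"
        show "k * a (n + j) \<le> max (a (n + Suc j)) (a (n + (j - 1)))" using step[of "n + j"] j by simp
      qed (use a0 an True in auto)
      then show ?thesis by (simp add: mult_2)
    next
      case False
      then have b: "k * a n \<le> a (n - 1)" using step[OF n] n by (auto simp: max_def split: if_splits)
      have "k ^ n * a (n - 0) \<le> a (n - n)"
      proof (rule growth_of_expansive_sequence[OF k, of "\<lambda>j. a (n - j)"])
        fix j assume j: "1 \<le> j" "j < n"
        have "n - (j - 1) = Suc (n - j)" "n - Suc j = n - j - 1" using j by auto
        then show "k * a (n - j) \<le> max (a (n - Suc j)) (a (n - (j - 1)))"
          using step[of "n - j"] j by (simp add: max.commute)
      qed (use a0 an b in auto)
      then show ?thesis by simp
    qed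
    also have "\<dots> \<le> \<epsilon>" using close[of "2 * n"] close[of 0] unfolding a_def by simp
    finally show ?thesis using k unfolding a_def by (simp add: field_simps)
  qed
qed

end

context compact_system
begin

lemma distr_funpow:
  assumes \<mu>: "\<mu> \<in> \<M>"
  shows "(T ^^ n) \<in> measurable \<mu> \<mu>" "distr \<mu> \<mu> (T ^^ n) = \<mu>"
proof -
  note inv = invariantD[OF \<mu>]
  have meas: "(T ^^ n) \<in> measurable \<mu> \<mu>" for n
  proof (induction n)
    case (Suc n) then show ?case using measurable_compose[OF Suc inv(4)] by (simp add: comp_def)
  qed simp
  then show "(T ^^ n) \<in> measurable \<mu> \<mu>" .
  show "distr \<mu> \<mu> (T ^^ n) = \<mu>"
  proof (induction n)
    case 0 then show ?case by (simp add: distr_id2)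
  next
    case (Suc n)
    have "distr \<mu> \<mu> (T ^^ Suc n) = distr (distr \<mu> \<mu> (T ^^ n)) \<mu> T"
      using distr_distr[OF inv(4) meas[of n]] by (simp only: funpow.simps)
    then show ?case by (simp only: Suc inv(5))
  qed
qed

lemma integral_funpow:
  fixes g :: "'m \<Rightarrow> real"
  assumes \<mu>: "\<mu> \<in> \<M>" and g: "g \<in> borel_measurable \<mu>"
  shows "(\<integral>x. g ((T ^^ n) x) \<partial>\<mu>) = (\<integral>x. g x \<partial>\<mu>)"
  using integral_distr[OF distr_funpow(1)[OF \<mu>, of n] g] distr_funpow(2)[OF \<mu>, of n] by simp

end

section \<open>Entropy of block codes\<close>

text \<open>
  The function \<open>c\<close> numbers the cells of a partition, which is read along orbits in words of length
  \<open>m\<close>; only few words, those of \<open>O'\<close>, occur on \<open>V\<close>.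
\<close>

locale coded_measure = compact_system X d T for X :: "'m::t2_space set" and d T +
  fixes \<mu> :: "'m measure" and c :: "'m \<Rightarrow> nat" and K m :: nat and O' V :: "'m set"
  assumes \<mu>: "\<mu> \<in> \<M>"
    and c_meas: "c \<in> measurable B (count_space UNIV)" and c_less: "\<And>x. x \<in> X \<Longrightarrow> c x < K"
    and m: "m \<ge> 1"
    and O': "finite O'" "O' \<noteq> {}" "O' \<subseteq> X"
    and V: "V \<in> sets B"
      "\<And>y. y \<in> V \<Longrightarrow> \<exists>z\<in>O'. \<forall>i<m. c ((T ^^ i) y) = c ((T ^^ i) z)"
begin

lemmas inv = invariantD[OF \<mu>]

sublocale prob_space \<mu> by (rule inv)

definition word :: "'m \<Rightarrow> nat \<Rightarrow> nat" where
  "word y = (\<lambda>i\<in>{..<m}. c ((T ^^ i) y))"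

definition words :: "(nat \<Rightarrow> nat) set" where
  "words = PiE {..<m} (\<lambda>_. {..<K})"

definition block_code :: "nat \<Rightarrow> 'm \<Rightarrow> nat \<Rightarrow> nat \<Rightarrow> nat" where
  "block_code b y = (\<lambda>j\<in>{..<b}. word ((T ^^ (m * j)) y))"

definition block_codes :: "nat \<Rightarrow> (nat \<Rightarrow> nat \<Rightarrow> nat) set" where
  "block_codes b = PiE {..<b} (\<lambda>_. words)"

text \<open>The atom of \<open>y\<close> in the partition by the cells visited at times
  \<open>0, ..., m * b - 1\<close>.\<close>

definition cyl :: "nat \<Rightarrow> 'm \<Rightarrow> 'm set" where
  "cyl b y = block_code b -` {block_code b y} \<inter> space \<mu>"

text \<open>
  The cost \<open>- ln (weight v)\<close> of a word of \<open>O'\<close> does not grow with \<open>m\<close>, that of any other word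
  grows only linearly in \<open>m\<close>.
\<close>

definition weight :: "(nat \<Rightarrow> nat) \<Rightarrow> real" where
  "weight v = (if v \<in> word ` O' then 1 / (2 * real (card (word ` O'))) else 0) + 1 / (2 * real K ^ m)"

text \<open>Bound for the mean cost of one block: the first term is paid on every block, the second
  only on blocks starting off \<open>V\<close>, whose share is the mass of
  \<open>X - V\<close>.\<close>

definition rate :: real where
  "rate = ln (2 * card O') + (1 - prob V) * (ln 2 + m * ln K)"

lemma K_pos: "K > 0"
proof -
  obtain x where "x \<in> X" using not_empty inv(1) by blast
  then show ?thesis using c_less by fastforce
qed

lemma finite_words: "finite words" and card_words: "card words = K ^ m"
  unfolding words_def by (auto intro: finite_PiE simp: card_PiE)

lemma finite_block_codes: "finite (block_codes b)"
  unfolding block_codes_def using finite_words by (intro finite_PiE) auto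

lemma word_in: "y \<in> X \<Longrightarrow> word y \<in> words"
  unfolding word_def words_def using c_less funpow_T_in by auto

lemma word_meas: "word \<in> measurable \<mu> (count_space words)"
proof -
  have "(\<lambda>y. c ((T ^^ i) y)) \<in> measurable \<mu> (count_space {..<K})" for i
  proof -
    have "(\<lambda>y. c ((T ^^ i) y)) \<in> measurable \<mu> (count_space UNIV)"
      using measurable_compose[OF distr_funpow(1)[OF \<mu>, of i]] c_meas
        measurable_cong_sets[OF inv(2) refl, of "count_space UNIV"] by blast
    then have "(\<lambda>y. c ((T ^^ i) y)) -` {a} \<inter> space \<mu> \<in> sets \<mu>" for a by (auto intro: measurable_sets)
    then show ?thesis using c_less funpow_T_in inv(1) by (subst measurable_count_space_eq2) auto
  qed
  then show ?thesis unfolding word_def[abs_def] words_def by (intro measurable_PiE_count_space) auto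
qed

lemma word_funpow_meas: "(\<lambda>y. word ((T ^^ i) y)) \<in> measurable \<mu> (count_space words)"
  using measurable_compose[OF distr_funpow(1)[OF \<mu>, of i] word_meas] .

lemma block_code_meas: "block_code b \<in> measurable \<mu> (count_space (block_codes b))"
  unfolding block_code_def[abs_def] block_codes_def
  using word_funpow_meas finite_words by (intro measurable_PiE_count_space) auto

lemma good_words: "finite (word ` O')" "card (word ` O') \<ge> 1" "card (word ` O') \<le> card O'"
  "word ` O' \<subseteq> words"
proof -
  show "finite (word ` O')" "card (word ` O') \<le> card O'" using O' card_image_le by auto
  show "card (word ` O') \<ge> 1" using O' by (simp add: Suc_le_eq card_gt_0_iff)
  show "word ` O' \<subseteq> words" using O' word_in by auto
qed

lemma weight_pos: "weight v > 0"
  unfolding weight_def using K_pos good_words(2) by (auto intro!: add_pos_pos)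

lemma weight_nonzero: "weight v \<noteq> 0"
  using weight_pos[of v] by simp

text \<open>Half of the mass is uniform on the words of \<open>O'\<close>, the other half uniform on
  all words. Products of \<open>weight\<close> over the blocks are then probability vectors as
  well.\<close>

lemma weight_sum: "(\<Sum>v\<in>words. weight v) = 1"
proof -
  let ?G = "word ` O'"
  have "(\<Sum>v\<in>words. if v \<in> ?G then 1 / (2 * real (card ?G)) else 0) = (\<Sum>v\<in>?G. 1 / (2 * real (card ?G)))"
    using finite_words good_words by (simp add: sum.If_cases Int_absorb1)
  also have "\<dots> = 1 / 2" using good_words(2) by simp
  finally have 1: "(\<Sum>v\<in>words. if v \<in> ?G then 1 / (2 * real (card ?G)) else 0) = 1 / 2" .
  have 2: "(\<Sum>v\<in>words. 1 / (2 * real K ^ m)) = 1 / 2" using K_pos by (simp add: card_words)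
  show ?thesis unfolding weight_def sum.distrib 1 2 by simp
qed

lemma ln_weight_bound:
  assumes y: "y \<in> X"
  shows "ln (weight (word y)) \<ge> - (ln (2 * card O') + (ln 2 + m * ln K) * indicator (X - V) y)"
proof (cases "y \<in> V")
  case True
  then obtain z where "z \<in> O'" "\<forall>i<m. c ((T ^^ i) y) = c ((T ^^ i) z)" using V(2) by blast
  then have "word y \<in> word ` O'" unfolding word_def by (intro image_eqI[of _ _ z]) auto
  then have 1: "1 / (2 * real (card (word ` O'))) \<le> weight (word y)" unfolding weight_def using K_pos by simp
  have "1 / (2 * card O') \<le> 1 / (2 * real (card (word ` O')))"
    using good_words by (intro divide_left_mono) auto
  also note 1
  finally have "weight (word y) \<ge> 1 / (2 * card O')" .
  moreover have pos: "1 / (2 * real (card O')) > 0" using good_words by simp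
  ultimately have "ln (weight (word y)) \<ge> ln (1 / (2 * card O'))" using weight_pos by (subst ln_le_cancel_iff) auto
  moreover have "ln (1 / (2 * real (card O'))) = - ln (2 * card O')" using pos by (simp add: ln_div)
  ultimately show ?thesis using True by simp
next
  case False
  have "weight (word y) \<ge> 1 / (2 * real K ^ m)" unfolding weight_def by simp
  then have "ln (weight (word y)) \<ge> ln (1 / (2 * real K ^ m))"
    using weight_pos K_pos by (subst ln_le_cancel_iff) auto
  moreover have "ln (1 / (2 * real K ^ m)) = - (ln 2 + m * ln K)" using K_pos by (simp add: ln_div ln_mult ln_realpow)
  ultimately have "ln (weight (word y)) \<ge> - (ln 2 + m * ln K)" by simp
  moreover have "ln (2 * real (card O')) \<ge> 0" using good_words by (intro ln_ge_zero) auto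
  ultimately show ?thesis using False y by simp
qed

lemma rate_nonneg: "rate \<ge> 0"
  unfolding rate_def using good_words K_pos
  by (intro add_nonneg_nonneg mult_nonneg_nonneg ln_ge_zero) auto

lemma integral_ln_weight: "(\<integral>y. ln (weight (word y)) \<partial>\<mu>) \<ge> - rate"
proof -
  have V': "X - V \<in> sets \<mu>" using V(1) inv(1,2) sets.compl_sets[of V \<mu>] by simp
  have pV: "prob (X - V) = 1 - prob V" using prob_compl[of V] V(1) inv by simp
  have int: "integrable \<mu> (\<lambda>y. indicator (X - V) y :: real)"
    using V' by (intro integrable_real_indicator) (simp_all add: emeasure_finite less_top[symmetric])
  have "- rate = (\<integral>y. - (ln (2 * card O') + (ln 2 + m * ln K) * indicator (X - V) y) \<partial>\<mu>)"
    using int prob_space sets.sets_into_space[OF V'] by (simp add: rate_def pV Int_absorb2 algebra_simps)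
  also have "\<dots> \<le> (\<integral>y. ln (weight (word y)) \<partial>\<mu>)"
    using int ln_weight_bound inv(1) integral_finite_range(1)[OF word_meas finite_words, of "\<lambda>v. ln (weight v)"]
    by (intro integral_mono) auto
  finally show ?thesis .
qed

text \<open>The Gibbs inequality compares the true law of the block codes with independent blocks of
  law \<open>weight\<close>. The logarithm of the product is a sum over the blocks, and invariance
  of \<mu> gives every summand the same integral.\<close>

lemma block_entropy_bound:
  "integrable \<mu> (\<lambda>y. ln (prob (cyl b y)))" "(\<integral>y. ln (prob (cyl b y)) \<partial>\<mu>) \<ge> - (b * rate)"
proof -
  let ?Q = "\<lambda>w. \<Prod>j<b. weight (w j)"
  show "integrable \<mu> (\<lambda>y. ln (prob (cyl b y)))"
    unfolding cyl_def
    using integral_finite_range(1)[OF block_code_meas finite_block_codes, of "\<lambda>w. ln (prob (block_code b -` {w} \<inter> space \<mu>))" b] .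
  have "(\<Sum>w\<in>block_codes b. ?Q w) = (\<Prod>j<b. \<Sum>v\<in>words. weight v)"
    unfolding block_codes_def using finite_words by (intro prod_sum_PiE[symmetric]) auto
  then have Q1: "(\<Sum>w\<in>block_codes b. ?Q w) = 1" using weight_sum by simp
  have lnQ: "ln (?Q (block_code b y)) = (\<Sum>j<b. ln (weight (word ((T ^^ (m * j)) y))))" for y
  proof -
    have "?Q (block_code b y) = (\<Prod>j<b. weight (word ((T ^^ (m * j)) y)))"
      by (intro prod.cong refl) (simp add: block_code_def)
    then show ?thesis using ln_prod[of "{..<b}" "\<lambda>j. weight (word ((T ^^ (m * j)) y))"] weight_nonzero by simp
  qed
  have lnw: "(\<lambda>y. ln (weight (word y))) \<in> borel_measurable \<mu>"
    using integral_finite_range(1)[OF word_meas finite_words, of "\<lambda>v. ln (weight v)"] by simp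
  have int: "integrable \<mu> (\<lambda>y. ln (weight (word ((T ^^ i) y))))" for i
    using integral_finite_range(1)[OF word_funpow_meas finite_words, of "\<lambda>v. ln (weight v)"] .
  have "- (b * rate) = (\<Sum>j<b. - rate)" by simp
  also have "\<dots> \<le> (\<Sum>j<b. \<integral>y. ln (weight (word ((T ^^ (m * j)) y))) \<partial>\<mu>)"
    using integral_ln_weight integral_funpow[OF \<mu> lnw] by (intro sum_mono) simp
  also have "\<dots> = (\<integral>y. (\<Sum>j<b. ln (weight (word ((T ^^ (m * j)) y)))) \<partial>\<mu>)"
    using int by (intro Bochner_Integration.integral_sum[symmetric])
  also have "\<dots> = (\<integral>y. ln (?Q (block_code b y)) \<partial>\<mu>)" by (simp only: lnQ)
  also have "\<dots> \<le> (\<integral>y. ln (prob (cyl b y)) \<partial>\<mu>)"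
    unfolding cyl_def using gibbs_inequality[OF block_code_meas finite_block_codes, of b ?Q] Q1 weight_pos
    by (simp add: prod_pos)
  finally show "(\<integral>y. ln (prob (cyl b y)) \<partial>\<mu>) \<ge> - (b * rate)" .
qed

lemma cyl_same_code:
  assumes "y \<in> X" "y' \<in> cyl b y" "i < m * b"
  shows "y' \<in> X" "c ((T ^^ i) y') = c ((T ^^ i) y)"
proof -
  show "y' \<in> X" using assms(2) inv(1) unfolding cyl_def by simp
  have j: "i div m < b" using assms(3) m by (simp add: less_mult_imp_div_less mult.commute)
  have "block_code b y' (i div m) = block_code b y (i div m)" using assms(2) unfolding cyl_def by simp
  then have "word ((T ^^ (m * (i div m))) y') (i mod m) = word ((T ^^ (m * (i div m))) y) (i mod m)"
    using j by (simp add: block_code_def)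
  moreover have "word ((T ^^ (m * (i div m))) u) (i mod m) = c ((T ^^ i) u)" for u
  proof -
    have "(T ^^ (i mod m)) ((T ^^ (m * (i div m))) u) = (T ^^ (i mod m + m * (i div m))) u"
      by (simp only: funpow_add comp_apply)
    then show ?thesis using m by (simp add: word_def)
  qed
  ultimately show "c ((T ^^ i) y') = c ((T ^^ i) y)" by simp
qed

end

section \<open>Supports and generalized dimensions\<close>

context compact_system
begin

text \<open>Finite nets at the scales \<open>1 / (n + 1)\<close> give countably many balls, and
  every point off the support lies in a null ball among them.\<close>

lemma AE_supp:
  assumes \<mu>: "\<mu> \<in> \<M>"
  shows "AE x in \<mu>. x \<in> supp \<mu>"
proof -
  note inv = invariantD[OF \<mu>]
  interpret prob_space \<mu> by (rule inv)
  have "\<exists>Z. finite Z \<and> Z \<subseteq> X \<and> X \<subseteq> (\<Union>z\<in>Z. mball_of d z (inverse (Suc n)))" for n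
    using finite_ball_cover[of "inverse (real (Suc n))"] by (metis inverse_positive_iff_positive of_nat_0_less_iff zero_less_Suc)
  then obtain Z where Z: "\<And>n. finite (Z n)" "\<And>n. Z n \<subseteq> X"
    "\<And>n. X \<subseteq> (\<Union>z\<in>Z n. mball_of d z (inverse (real (Suc n))))" by metis
  define N where "N = (\<Union>n. \<Union>z\<in>{z \<in> Z n. prob (mball_of d z (inverse (real (Suc n)))) = 0}. mball_of d z (inverse (real (Suc n))))"
  have "N \<in> null_sets \<mu>"
    unfolding N_def using Z(1) ball_sets inv(2)
    by (intro null_sets_UN null_sets.finite_UN) (auto intro!: null_setsI simp: emeasure_eq_measure)
  moreover have "{x \<in> space \<mu>. x \<notin> supp \<mu>} \<subseteq> N"
  proof
    fix x assume "x \<in> {x \<in> space \<mu>. x \<notin> supp \<mu>}"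
    then obtain U where x: "x \<in> X" and U: "open U" "x \<in> U" "\<not> prob (U \<inter> X) > 0"
      unfolding supp_def using inv(1) by auto
    have "openin (top_of_set X) (X \<inter> U)" using U(1) by (rule openin_open_Int)
    then obtain r where r: "r > 0" "mball_of d x r \<subseteq> X \<inter> U" using ball_in_openin x U(2) by blast
    obtain n where n: "inverse (real (Suc n)) < r / 2" using reals_Archimedean[of "r / 2"] r by auto
    obtain z where z: "z \<in> Z n" "x \<in> mball_of d z (inverse (real (Suc n)))" using Z(3)[of n] x by blast
    have "mball_of d z (inverse (real (Suc n))) \<subseteq> mball_of d x r"
    proof
      fix y assume y: "y \<in> mball_of d z (inverse (real (Suc n)))"
      then show "y \<in> mball_of d x r"
        using z n dist_triangle_d[of x z y] dist_commute_d[of x z] by auto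
    qed
    then have "prob (mball_of d z (inverse (real (Suc n)))) \<le> prob (U \<inter> X)"
      using r U(1) inv(2) by (intro finite_measure_mono) (auto simp: sets_restrict_space Int_commute)
    then have "prob (mball_of d z (inverse (real (Suc n)))) = 0" using U(3) measure_nonneg[of \<mu>] by (smt (verit))
    then show "x \<in> N" unfolding N_def using z by blast
  qed
  ultimately show ?thesis by (rule AE_I'[of N])
qed

text \<open>The part of the dimension quotient that is divided by \<open>ln r\<close>; under one
  name, \<open>q = 1\<close> and \<open>q \<noteq> 1\<close> pass through the same limit
  superior.\<close>

definition log_moment :: "'m measure \<Rightarrow> real \<Rightarrow> real \<Rightarrow> real" where
  "log_moment \<mu> q r = (if q = 1 then (LINT x:supp \<mu>|\<mu>. ln (measure \<mu> (mball_of d x r)))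
     else ln (LINT x:supp \<mu>|\<mu>. measure \<mu> (mball_of d x r) powr (q - 1)) / (q - 1))"

lemma upper_gen_dim_eq:
  "upper_gen_dim d \<mu> q = Limsup (at_right 0) (\<lambda>r. ereal (log_moment \<mu> q r / ln r))"
  unfolding upper_gen_dim_def log_moment_def by (simp add: mult.commute)

text \<open>Ball measures are at most 1. The sign survives the default values: an integral that does
  not exist is 0, and \<open>ln 0 = 0\<close>.\<close>

lemma log_moment_nonpos:
  assumes \<mu>: "\<mu> \<in> \<M>" and q: "q \<ge> 1"
  shows "log_moment \<mu> q r \<le> 0"
proof -
  interpret prob_space \<mu> using invariantD[OF \<mu>] by simp
  have ln0: "ln (prob A) \<le> 0" for A
    using measure_nonneg[of \<mu> A] prob_le_1[of A] by (cases "prob A = 0") (auto simp: less_le)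
  show ?thesis
  proof (cases "q = 1")
    case True
    have "(LINT x|\<mu>. - (indicator (supp \<mu>) x * ln (prob (mball_of d x r)))) \<ge> 0"
      using ln0 by (intro Bochner_Integration.integral_nonneg) (simp add: mult_nonneg_nonpos)
    then show ?thesis using True by (simp add: log_moment_def set_lebesgue_integral_def)
  next
    case False
    let ?I = "LINT x:supp \<mu>|\<mu>. prob (mball_of d x r) powr (q - 1)"
    let ?G = "\<lambda>x. indicator (supp \<mu>) x * prob (mball_of d x r) powr (q - 1)"
    have I: "?I = (LINT x|\<mu>. ?G x)" by (simp add: set_lebesgue_integral_def)
    have G: "0 \<le> ?G x" "?G x \<le> 1" for x
      using False q prob_le_1 by (auto simp: indicator_def intro!: powr_le1)
    have "?I \<ge> 0" unfolding I using G by (intro Bochner_Integration.integral_nonneg) auto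
    moreover have "?I \<le> 1"
    proof (cases "integrable \<mu> ?G")
      case True
      then have "(LINT x|\<mu>. ?G x) \<le> (LINT x|\<mu>. 1)" using G by (intro integral_mono) auto
      then show ?thesis using I prob_space by simp
    next
      case False
      then show ?thesis unfolding I by (simp add: not_integrable_integral_eq)
    qed
    ultimately have "ln ?I \<le> 0" by (cases "?I = 0") (auto simp: less_le)
    then show ?thesis using False q by (simp add: log_moment_def divide_nonpos_pos)
  qed
qed

end

locale coded_hyperbolic = hyperbolic_system X d T k \<epsilon> + coded_measure X d T \<mu> c K m O' V
  for X :: "'m::t2_space set" and d T k \<epsilon> \<mu> c K m O' V +
  assumes c_close: "\<And>x y. x \<in> X \<Longrightarrow> y \<in> X \<Longrightarrow> c x = c y \<Longrightarrow> mdist d x y < \<epsilon>"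
begin

text \<open>The cylinder of \<open>y\<close> fixes the cells at times \<open>0, ..., 2 * n\<close>,
  so \<open>bowen_ball\<close> makes \<open>T ^^ n\<close> map it into the ball, and invariance
  compares the masses. The ball is centered at \<open>(T ^^ n) y\<close>, which under an integral is
  as good as \<open>y\<close>.\<close>

lemma cyl_le_ball:
  assumes y: "y \<in> X" and n: "2 * n < m * b" and r: "\<epsilon> / k ^ n < r"
  shows "prob (cyl b y) \<le> prob (mball_of d ((T ^^ n) y) r)"
proof -
  let ?Bl = "mball_of d ((T ^^ n) y) r"
  have Bl: "?Bl \<in> sets \<mu>" using ball_sets inv(2) by simp
  have "cyl b y \<subseteq> (T ^^ n) -` ?Bl \<inter> space \<mu>"
  proof
    fix y' assume y': "y' \<in> cyl b y"
    have X': "y' \<in> X" using y' inv(1) by (simp add: cyl_def)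
    have "mdist d ((T ^^ i) y) ((T ^^ i) y') < \<epsilon>" if "i \<le> 2 * n" for i
      using cyl_same_code(2)[OF y y', of i] that n X' y funpow_T_in by (intro c_close) auto
    then have "mdist d ((T ^^ n) y) ((T ^^ n) y') < r" using bowen_ball[OF y X', of n] r by fastforce
    then show "y' \<in> (T ^^ n) -` ?Bl \<inter> space \<mu>" using X' y funpow_T_in inv(1) by simp
  qed
  then have "prob (cyl b y) \<le> prob ((T ^^ n) -` ?Bl \<inter> space \<mu>)"
    using distr_funpow(1)[OF \<mu>] Bl by (intro finite_measure_mono measurable_sets[of _ _ \<mu>]) auto
  also have "\<dots> = measure (distr \<mu> \<mu> (T ^^ n)) ?Bl"
    using distr_funpow(1)[OF \<mu>] Bl by (intro measure_distr[symmetric])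
  finally show ?thesis using distr_funpow(2)[OF \<mu>] by simp
qed

lemma AE_cyl_pos: "AE y in \<mu>. prob (cyl b y) > 0"
  unfolding cyl_def by (rule AE_finite_range_positive[OF block_code_meas finite_block_codes])

text \<open>After the substitution \<open>x = (T ^^ n) y\<close>, balls dominate cylinders in
  measure. For \<open>q = 1\<close> the entropy bound applies at once; for \<open>q > 1\<close>
  Jensen's inequality first moves the logarithm inside the integral.\<close>

lemma log_moment_bound:
  assumes n: "2 * n < m * b" and r: "\<epsilon> / k ^ n < r" and q: "q \<ge> 1"
  shows "log_moment \<mu> q r \<ge> - (b * rate)"
proof (cases "q = 1")
  case True
  let ?G = "\<lambda>x. indicator (supp \<mu>) x * ln (prob (mball_of d x r))"
  have eq: "log_moment \<mu> q r = (LINT x|\<mu>. ?G x)"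
    using True by (simp add: log_moment_def set_lebesgue_integral_def)
  show ?thesis
  proof (cases "integrable \<mu> ?G")
    case False
    \<comment> \<open>The integral is 0 by default, and the claimed lower bound is not
      positive.\<close>
    then show ?thesis unfolding eq using rate_nonneg by (simp add: not_integrable_integral_eq)
  next
    case int: True
    then have meas: "?G \<in> borel_measurable \<mu>" by simp
    have int': "integrable \<mu> (\<lambda>y. ?G ((T ^^ n) y))"
      using integrable_distr[OF distr_funpow(1)[OF \<mu>, of n], of ?G] int distr_funpow(2)[OF \<mu>, of n] by simp
    have "(LINT y|\<mu>. ln (prob (cyl b y))) \<le> (LINT y|\<mu>. ?G ((T ^^ n) y))"
    proof (rule integral_mono_AE[OF block_entropy_bound(1) int'])
      show "AE y in \<mu>. ln (prob (cyl b y)) \<le> ?G ((T ^^ n) y)"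
        using AE_cyl_pos[of b] AE_space
      proof eventually_elim
        case (elim y)
        have "ln (prob (cyl b y)) \<le> ln (prob (mball_of d ((T ^^ n) y) r))"
          using cyl_le_ball[of y, OF _ n r] elim inv(1) by simp
        \<comment> \<open>Off the support the right-hand side is 0, which still dominates.\<close>
        moreover have "ln (prob (cyl b y)) \<le> 0" using elim by simp
        ultimately show ?case by (simp add: indicator_def)
      qed
    qed
    then show ?thesis using block_entropy_bound(2)[of b] integral_funpow[OF \<mu> meas, of n] eq by simp
  qed
next
  case False
  let ?G = "\<lambda>x. indicator (supp \<mu>) x * prob (mball_of d x r) powr (q - 1)"
  have eq: "log_moment \<mu> q r = ln (LINT x|\<mu>. ?G x) / (q - 1)"
    using False by (simp add: log_moment_def set_lebesgue_integral_def)
  show ?thesis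
  proof (cases "integrable \<mu> ?G")
    case False
    \<comment> \<open>Here the default integral 0 is followed by \<open>ln 0 = 0\<close>.\<close>
    then show ?thesis unfolding eq using rate_nonneg by (simp add: not_integrable_integral_eq)
  next
    case int: True
    then have meas: "?G \<in> borel_measurable \<mu>" by simp
    let ?l = "\<lambda>y. (q - 1) * ln (prob (cyl b y))"
    have int': "integrable \<mu> (\<lambda>y. ?G ((T ^^ n) y))"
      using integrable_distr[OF distr_funpow(1)[OF \<mu>, of n], of ?G] int distr_funpow(2)[OF \<mu>, of n] by simp
    have int_l: "integrable \<mu> ?l" using block_entropy_bound(1) by simp
    have int_exp: "integrable \<mu> (\<lambda>y. exp (?l y))"
      unfolding cyl_def
      using integral_finite_range(1)[OF block_code_meas finite_block_codes,
          of "\<lambda>w. exp ((q - 1) * ln (prob (block_code b -` {w} \<inter> space \<mu>)))" b] .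
    have "exp (\<integral>y. ?l y \<partial>\<mu>) \<le> (\<integral>y. exp (?l y) \<partial>\<mu>)" by (rule jensen_exp[OF int_l int_exp])
    also have "\<dots> \<le> (LINT y|\<mu>. ?G ((T ^^ n) y))"
    proof (rule integral_mono_AE[OF int_exp int'])
      \<comment> \<open>The left-hand side is now positive, so the indicator of the support has to
        be 1 almost everywhere.\<close>
      have "AE y in distr \<mu> \<mu> (T ^^ n). y \<in> supp \<mu>"
        unfolding distr_funpow(2)[OF \<mu>] by (rule AE_supp[OF \<mu>])
      then have "AE y in \<mu>. (T ^^ n) y \<in> supp \<mu>"
        by (rule AE_distrD[OF distr_funpow(1)[OF \<mu>]])
      then show "AE y in \<mu>. exp (?l y) \<le> ?G ((T ^^ n) y)"
        using AE_cyl_pos[of b] AE_space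
      proof eventually_elim
        case (elim y)
        have "exp (?l y) = prob (cyl b y) powr (q - 1)" using elim by (simp add: powr_def)
        also have "\<dots> \<le> prob (mball_of d ((T ^^ n) y) r) powr (q - 1)"
          using cyl_le_ball[of y, OF _ n r] elim q inv(1) by (intro powr_mono2) auto
        finally show ?case using elim by simp
      qed
    qed
    also have "\<dots> = (LINT x|\<mu>. ?G x)" by (rule integral_funpow[OF \<mu> meas])
    finally have *: "exp (\<integral>y. ?l y \<partial>\<mu>) \<le> (LINT x|\<mu>. ?G x)" .
    have "(LINT x|\<mu>. ?G x) > 0" using less_le_trans[OF exp_gt_zero *] .
    then have "(\<integral>y. ?l y \<partial>\<mu>) \<le> ln (LINT x|\<mu>. ?G x)"
      using * by (simp only: ln_ge_iff)
    moreover have "(\<integral>y. ?l y \<partial>\<mu>) = (q - 1) * (\<integral>y. ln (prob (cyl b y)) \<partial>\<mu>)" by simp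
    moreover have "(q - 1) * - (b * rate) \<le> (q - 1) * (\<integral>y. ln (prob (cyl b y)) \<partial>\<mu>)"
      using block_entropy_bound(2)[of b] q by (intro mult_left_mono) auto
    ultimately have "(q - 1) * - (b * rate) \<le> ln (LINT x|\<mu>. ?G x)" by linarith
    then show ?thesis unfolding eq using q \<open>q \<noteq> 1\<close> by (simp add: pos_le_divide_eq mult.commute)
  qed
qed

text \<open>At scale \<open>r\<close>, take \<open>n\<close> just above
  \<open>(ln \<epsilon> - ln r) / ln k\<close> and the fewest blocks that cover times
  \<open>0, ..., 2 * n\<close>. The number of blocks divided by \<open>- ln r\<close> tends to
  \<open>2 / (m * ln k)\<close>, and each block costs at most \<open>rate\<close>.\<close>

lemma upper_gen_dim_le:
  assumes q: "q \<ge> 1"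
  shows "upper_gen_dim d \<mu> q \<le> ereal (2 * rate / (m * ln k))"
proof -
  \<comment> \<open>What remains of the total cost once the part proportional to
    \<open>- ln r\<close> is split off.\<close>
  define C where "C = (2 * (ln \<epsilon> / ln k + 1) / m + 1) * rate"
  define g where "g r = C / (- ln r) + 2 * rate / (m * ln k)" for r
  have lnk: "ln k > 0" using k by simp
  have lim: "(g \<longlongrightarrow> 0 + 2 * rate / (m * ln k)) (at_right 0)"
    unfolding g_def
  proof (intro tendsto_add tendsto_const tendsto_divide_0[OF tendsto_const])
    show "filterlim (\<lambda>r. - ln r :: real) at_infinity (at_right 0)"
      by (intro filterlim_at_top_imp_at_infinity) (use ln_at_0 in \<open>simp add: filterlim_uminus_at_top\<close>)
  qed
  have "\<forall>\<^sub>F r in at_right 0. ereal (log_moment \<mu> q r / ln r) \<le> ereal (g r)"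
  proof -
    have "\<forall>\<^sub>F r in at_right (0::real). r \<in> {0 <..< min 1 \<epsilon>}"
      using \<epsilon> by (intro eventually_at_right_real) simp
    then show ?thesis
    proof eventually_elim
      case (elim r)
      define s where "s = (ln \<epsilon> - ln r) / ln k"
      have s0: "s \<ge> 0" unfolding s_def using elim lnk by (intro divide_nonneg_pos) (auto simp: less_imp_le)
      define n where "n = nat \<lfloor>s\<rfloor> + 1"
      have n: "s < n" "n \<le> s + 1" unfolding n_def using s0 by linarith+
      have "ln \<epsilon> - ln r < n * ln k" using n(1) lnk by (simp add: s_def pos_divide_less_eq)
      then have "ln (\<epsilon> / r) < ln (k ^ n)" using \<epsilon> elim k by (simp add: ln_div ln_realpow)
      then have "\<epsilon> / r < k ^ n" using \<epsilon> elim k by (subst (asm) ln_less_cancel_iff) auto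
      then have r: "\<epsilon> / k ^ n < r" using elim k by (simp add: field_simps)
      \<comment> \<open>The \<open>+ 1\<close> makes \<open>m * b\<close> exceed
        \<open>2 * n\<close>, so that time \<open>2 * n\<close> is included.\<close>
      define b where "b = 2 * n div m + 1"
      have b1: "2 * n < m * b"
        using m dividend_less_times_div[of m "2 * n"] by (simp add: b_def mult.commute)
      have "real (2 * n div m) * real m \<le> real (2 * n)"
        unfolding of_nat_mult[symmetric] of_nat_le_iff by (rule div_times_less_eq_dividend)
      then have "real (2 * n div m) \<le> real (2 * n) / real m" using m by (simp add: pos_le_divide_eq)
      then have "real b \<le> 2 * n / m + 1" by (simp add: b_def)
      also have "\<dots> \<le> 2 * (s + 1) / m + 1" using n(2) m by (simp add: divide_right_mono)
      finally have b2: "real b \<le> 2 * (s + 1) / m + 1" .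
      have lnr: "- ln r > 0" using elim by simp
      have "log_moment \<mu> q r / ln r = - log_moment \<mu> q r / (- ln r)" by simp
      also have "\<dots> \<le> (b * rate) / (- ln r)"
        using log_moment_bound[OF b1 r q] lnr by (intro divide_right_mono) auto
      also have "\<dots> \<le> ((2 * (s + 1) / m + 1) * rate) / (- ln r)"
        using b2 rate_nonneg lnr by (intro divide_right_mono mult_right_mono) auto
      also have "\<dots> = g r"
        using lnr lnk m unfolding g_def C_def s_def by (simp add: field_simps)
      finally show ?case by simp
    qed
  qed
  then have "Limsup (at_right 0) (\<lambda>r. ereal (log_moment \<mu> q r / ln r)) \<le> Limsup (at_right 0) (\<lambda>r. ereal (g r))"
    by (rule Limsup_mono)
  also have "\<dots> = ereal (2 * rate / (m * ln k))"
    using lim by (intro lim_imp_Limsup) simp_all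
  finally show ?thesis unfolding upper_gen_dim_eq .
qed

end

section \<open>Neighbourhoods of finitely supported measures\<close>

context hyperbolic_system
begin

text \<open>A neighbourhood of each point of \<open>O'\<close> must lie in a single cell, so that
  nearby points receive the same code. The radius \<open>r\<close> is at most half the least
  distance in \<open>O'\<close>, which makes the balls around \<open>O'\<close> disjoint, and all
  balls have radius at most \<open>\<epsilon> / 2\<close>, which keeps points of one cell closer
  than \<epsilon>.\<close>

lemma adapted_partition:
  assumes O': "finite O'" "O' \<subseteq> X"
  shows "\<exists>c (K :: nat) r. r > 0 \<and> c \<in> measurable B (count_space UNIV) \<and> (\<forall>x\<in>X. c x < K) \<and>
    (\<forall>x\<in>X. \<forall>y\<in>X. c x = c y \<longrightarrow> mdist d x y < \<epsilon>) \<and>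
    (\<forall>z\<in>O'. \<forall>y\<in>X. mdist d z y < r \<longrightarrow> c y = c z)"
proof -
  obtain r1 where r1: "r1 > 0" "\<forall>z\<in>O'. \<forall>z'\<in>O'. z \<noteq> z' \<longrightarrow> 2 * r1 \<le> mdist d z z'"
    using finite_set_separation[OF O'] by blast
  define r where "r = min r1 (\<epsilon> / 2)"
  have r: "r > 0" "r \<le> \<epsilon> / 2" "r \<le> r1" using r1 \<epsilon> by (auto simp: r_def)
  have "\<epsilon> / 2 > 0" using \<epsilon> by simp
  then obtain Z where Z: "finite Z" "Z \<subseteq> X" "X \<subseteq> (\<Union>z\<in>Z. mball_of d z (\<epsilon> / 2))"
    using finite_ball_cover by blast
  obtain e where e: "bij_betw e {0..<card Z} Z" using ex_bij_betw_nat_finite[OF Z(1)] by blast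
  obtain o' where o': "bij_betw o' {0..<card O'} O'" using ex_bij_betw_nat_finite[OF O'(1)] by blast
  define p where "p = card O'"
  define K where "K = p + card Z"
  \<comment> \<open>The balls around \<open>O'\<close> come first, so the least index prefers them
    and they are not cut by the others.\<close>
  define A where "A i = (if i < p then mball_of d (o' i) r else if i < K then mball_of d (e (i - p)) (\<epsilon> / 2) else {})" for i
  have A_sets: "A i \<in> sets B" for i unfolding A_def using ball_sets by simp
  have cover: "X \<subseteq> (\<Union>i<K. A i)"
  proof
    fix x assume "x \<in> X"
    then obtain z where z: "z \<in> Z" "x \<in> mball_of d z (\<epsilon> / 2)" using Z(3) by blast
    moreover have "e ` {0..<card Z} = Z" using e by (simp add: bij_betw_def)
    ultimately obtain j where j: "j < card Z" "z = e j" by fastforce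
    then have "x \<in> A (p + j)" using z by (simp add: A_def K_def)
    then show "x \<in> (\<Union>i<K. A i)" using j by (auto simp: K_def)
  qed
  define c where "c x = (LEAST i. x \<in> A i)" for x
  note c = least_index[OF cover A_sets, folded c_def]
  have A_small: "\<exists>a\<in>X. \<forall>x\<in>A i. mdist d a x < \<epsilon> / 2" if "x \<in> A i" for x i
    using that r(2) unfolding A_def by (force split: if_splits)
  show ?thesis
  proof (intro exI[of _ c] exI[of _ K] exI[of _ r] conjI ballI impI r(1) c(3) c(1))
    fix x y assume xy: "x \<in> X" "y \<in> X" "c x = c y"
    obtain a where a: "a \<in> X" "\<forall>x\<in>A (c x). mdist d a x < \<epsilon> / 2" using A_small[OF c(2)[OF xy(1)]] by blast
    have "mdist d a x < \<epsilon> / 2" "mdist d a y < \<epsilon> / 2" using a(2) c(2)[OF xy(1)] c(2)[OF xy(2)] xy(3) by auto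
    then show "mdist d x y < \<epsilon>"
      using dist_triangle_d[OF xy(1) a(1) xy(2)] dist_commute_d[of x a] by simp
  next
    fix z y assume z: "z \<in> O'" and y: "y \<in> X" "mdist d z y < r"
    have o'_im: "o' ` {0..<p} = O'" and o'_inj: "inj_on o' {0..<p}"
      using o' by (simp_all add: bij_betw_def p_def)
    obtain i where i: "i < p" "o' i = z" using o'_im z by fastforce
    have "c u = i" if u: "u \<in> X" "mdist d z u < r" for u
      unfolding c_def
    proof (rule Least_equality)
      show "u \<in> A i" using i u z O' by (auto simp: A_def)
      fix j assume j: "u \<in> A j"
      show "i \<le> j"
      proof (rule ccontr)
        assume "\<not> i \<le> j"
        then have "j < p" "j < i" using i by auto
        have oj: "o' j \<in> O'" using o'_im \<open>j < p\<close> by fastforce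
        have ne: "z \<noteq> o' j" using inj_onD[OF o'_inj, of i j] i \<open>j < p\<close> \<open>j < i\<close> by auto
        have "mdist d (o' j) u < r" using j \<open>j < p\<close> by (simp add: A_def)
        moreover have "2 * r1 \<le> mdist d z (o' j)" using r1(2) z oj ne by blast
        ultimately show False
          using u r(3) dist_triangle_d[of z u "o' j"] dist_commute_d[of u "o' j"] O' z oj by auto
      qed
    qed
    moreover have "mdist d z z < r" using z O' r(1) dist_self_d[of z] by (metis subsetD)
    ultimately show "c y = c z" using y z O' by auto
  qed
qed

text \<open>The test function \<psi> is a bump at \<open>O'\<close>: an integral close to 1 forces
  most of the mass into the set \<open>V\<close> where \<psi> is positive, and points of
  \<open>V\<close> share the code of some point of \<open>O'\<close> for \<open>m\<close> steps. The
  partition is fixed before \<open>m\<close>, and the width of the bump after it.\<close>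

lemma small_dimension_near_finite:
  assumes Lip: "\<And>x y. x \<in> X \<Longrightarrow> y \<in> X \<Longrightarrow> mdist d (T x) (T y) \<le> L * mdist d x y" "L \<ge> 1"
    and \<nu>: "\<nu> \<in> finite_measures" and \<delta>: "\<delta> > 0" and q: "q \<ge> 1"
  shows "\<exists>(\<psi>::'m \<Rightarrow> real) t. continuous_on X \<psi> \<and> t < (\<integral>x. \<psi> x \<partial>\<nu>) \<and>
    (\<forall>\<mu>\<in>\<M>. t < (\<integral>x. \<psi> x \<partial>\<mu>) \<longrightarrow> upper_gen_dim d \<mu> q \<le> ereal \<delta>)"
proof -
  obtain O' where O': "finite O'" "O' \<subseteq> X" "T ` O' \<subseteq> O'"
    and \<nu>_all: "\<forall>\<psi>::'m\<Rightarrow>real. continuous_on X \<psi> \<and> (\<forall>z\<in>O'. \<psi> z = 1) \<longrightarrow> (\<integral>x. \<psi> x \<partial>\<nu>) = 1"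
    using \<nu> unfolding finite_measures_def mem_Collect_eq by (elim exE conjE)
  have \<nu>_int: "(\<integral>x. \<psi> x \<partial>\<nu>) = 1" if "continuous_on X \<psi>" "\<And>z. z \<in> O' \<Longrightarrow> \<psi> z = 1" for \<psi> :: "'m \<Rightarrow> real"
    using \<nu>_all that by blast
  have O'_ne: "O' \<noteq> {}" using \<nu>_int[of "\<lambda>_. 0"] by auto
  have O'_iter: "(T ^^ i) z \<in> O'" if "z \<in> O'" for z i using that O'(3) by (induction i) auto
  have lnk: "ln k > 0" using k by simp
  obtain c and K :: nat and r where r: "r > 0" and c: "c \<in> measurable B (count_space UNIV)" "\<forall>x\<in>X. c x < K"
    "\<forall>x\<in>X. \<forall>y\<in>X. c x = c y \<longrightarrow> mdist d x y < \<epsilon>"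
    "\<forall>z\<in>O'. \<forall>y\<in>X. mdist d z y < r \<longrightarrow> c y = c z"
    using adapted_partition[OF O'(1,2)] by (elim exE conjE)
  have K: "K > 0" using O'_ne O'(2) c(2) by fastforce
  \<comment> \<open>The bound will be \<open>2 * rate / (m * ln k)\<close> with \<open>rate\<close>
    at most \<open>2 * \<theta> * m\<close>, hence the 4.\<close>
  define \<theta> where "\<theta> = \<delta> * ln k / 4"
  have \<theta>: "\<theta> > 0" using \<delta> lnk by (simp add: \<theta>_def)
  obtain m0 :: nat where m0: "ln (2 * card O') / \<theta> < m0" using reals_Archimedean2 by blast
  define m where "m = Suc m0"
  have m_large: "m \<ge> 1" "ln (2 * card O') \<le> m * \<theta>"
  proof -
    have "ln (2 * card O') < m0 * \<theta>" using m0 \<theta> by (simp add: pos_divide_less_eq)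
    then show "ln (2 * card O') \<le> m * \<theta>" using \<theta> by (simp add: m_def algebra_simps)
  qed (simp add: m_def)
  have lnK: "ln 2 + ln (real K) > 0" using K by (simp add: add_pos_nonneg)
  \<comment> \<open>Keeps the mass off \<open>V\<close> times the cost
    \<open>ln 2 + m * ln K\<close> of an arbitrary word at most \<open>m * \<theta>\<close>, for
    every \<open>m \<ge> 1\<close>.\<close>
  define \<eta> where "\<eta> = \<theta> / (ln 2 + ln (real K))"
  have \<eta>: "\<eta> > 0" using \<theta> lnK by (simp add: \<eta>_def)
  \<comment> \<open>Points closer than \<rho> stay closer than \<open>r\<close> at all times before
    \<open>m\<close>, hence in the same cells near \<open>O'\<close>.\<close>
  define \<rho> where "\<rho> = r / L ^ m"
  have \<rho>: "\<rho> > 0" using r Lip(2) by (simp add: \<rho>_def)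
  have Lip_iter: "mdist d ((T ^^ i) x) ((T ^^ i) y) \<le> L ^ i * mdist d x y" if "x \<in> X" "y \<in> X" for x y i
  proof (induction i)
    case (Suc i)
    have "mdist d ((T ^^ Suc i) x) ((T ^^ Suc i) y) \<le> L * mdist d ((T ^^ i) x) ((T ^^ i) y)"
      using Lip(1) funpow_T_in that by simp
    also have "\<dots> \<le> L * (L ^ i * mdist d x y)" using Suc Lip(2) by (intro mult_left_mono) auto
    finally show ?case by simp
  qed simp
  \<comment> \<open>The product vanishes on \<open>O'\<close> and is 1 at points of distance at
    least \<rho> from all of \<open>O'\<close>.\<close>
  define \<psi> where "\<psi> y = 1 - (\<Prod>z\<in>O'. min 1 (mdist d z y / \<rho>))" for y
  have \<psi>_cont: "continuous_on X \<psi>"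
    unfolding \<psi>_def using O'(2) \<rho> continuous_on_dist by (intro continuous_intros) auto
  have \<psi>_O: "\<psi> z = 1" if "z \<in> O'" for z
  proof -
    have "mdist d z z = 0" using that O'(2) dist_self_d by blast
    then have "(\<Prod>w\<in>O'. min 1 (mdist d w z / \<rho>)) = 0"
      using that O'(1) by (intro prod_zero bexI[of _ z]) simp_all
    then show ?thesis by (simp add: \<psi>_def)
  qed
  have \<psi>_le1: "\<psi> y \<le> 1" for y unfolding \<psi>_def using \<rho> by (simp add: prod_nonneg)
  define V where "V = {y \<in> X. \<psi> y > 0}"
  have V_sets: "V \<in> sets B"
  proof -
    have "\<psi> -` {0<..} \<inter> space B \<in> sets B" using continuous_measurable[OF \<psi>_cont] by (rule measurable_sets) simp
    then show ?thesis by (rule back_subst[of "\<lambda>A. A \<in> sets B"]) (auto simp: V_def)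
  qed
  have V_near: "\<exists>z\<in>O'. \<forall>i<m. c ((T ^^ i) y) = c ((T ^^ i) z)" if "y \<in> V" for y
  proof -
    have y: "y \<in> X" "\<psi> y > 0" using that by (auto simp: V_def)
    have "\<exists>z\<in>O'. mdist d z y < \<rho>"
    proof (rule ccontr)
      assume "\<not> ?thesis"
      then have "(\<Prod>z\<in>O'. min 1 (mdist d z y / \<rho>)) = (\<Prod>z\<in>O'. 1)"
        using \<rho> by (intro prod.cong refl) (auto simp: not_less min_def)
      then show False using y(2) by (simp add: \<psi>_def)
    qed
    then obtain z where z: "z \<in> O'" "mdist d z y < \<rho>" by blast
    have "c ((T ^^ i) y) = c ((T ^^ i) z)" if "i < m" for i
    proof (rule c(4)[rule_format, OF O'_iter[OF z(1)] funpow_T_in[OF y(1)]])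
      have "mdist d ((T ^^ i) z) ((T ^^ i) y) \<le> L ^ i * mdist d z y"
        using Lip_iter z(1) O'(2) y(1) by blast
      also have "\<dots> \<le> L ^ m * mdist d z y"
        using Lip(2) that by (intro mult_right_mono power_increasing) auto
      also have "\<dots> < L ^ m * \<rho>" using z(2) Lip(2) by (intro mult_strict_left_mono) auto
      also have "\<dots> = r" using Lip(2) by (simp add: \<rho>_def)
      finally show "mdist d ((T ^^ i) z) ((T ^^ i) y) < r" .
    qed
    then show ?thesis using z(1) by blast
  qed
  have "upper_gen_dim d \<mu> q \<le> ereal \<delta>" if \<mu>: "\<mu> \<in> \<M>" and big: "1 - \<eta> < (\<integral>x. \<psi> x \<partial>\<mu>)" for \<mu>
  proof -
    interpret coded_hyperbolic X d T k \<epsilon> \<mu> c K m O' V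
      using \<mu> c m_large(1) O' O'_ne V_sets V_near by unfold_locales auto
    have V\<mu>: "V \<in> sets \<mu>" using V_sets inv(2) by simp
    have "(\<integral>x. \<psi> x \<partial>\<mu>) \<le> (\<integral>x. indicator V x \<partial>\<mu>)"
    proof (intro integral_mono)
      show "integrable \<mu> \<psi>" using integrable_continuous[OF \<mu> \<psi>_cont] .
      show "integrable \<mu> (\<lambda>x. indicator V x :: real)"
        using V\<mu> by (intro integrable_real_indicator) (simp_all add: emeasure_finite less_top[symmetric])
      show "\<psi> x \<le> indicator V x" if "x \<in> space \<mu>" for x
        using that inv(1) \<psi>_le1[of x] by (auto simp: V_def indicator_def)
    qed
    also have "\<dots> = prob V" using V\<mu> sets.sets_into_space[OF V\<mu>] by (simp add: Int_absorb2)
    finally have pV: "1 - prob V < \<eta>" using big by simp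
    have "(1 - prob V) * (ln 2 + m * ln K) \<le> \<eta> * (m * (ln 2 + ln K))"
      using pV m_large(1) K \<eta> prob_le_1 by (intro mult_mono) (auto simp: algebra_simps mult_le_cancel_right1)
    also have "\<dots> = m * \<theta>" using lnK by (simp add: \<eta>_def)
    finally have "rate \<le> 2 * (\<theta> * m)" unfolding rate_def using m_large(2) by (simp add: mult.commute)
    then have "2 * rate / (m * ln k) \<le> 2 * (2 * (\<theta> * m)) / (m * ln k)"
      using lnk m_large(1) by (intro divide_right_mono) auto
    also have "\<dots> = \<delta>" using lnk m_large(1) by (simp add: \<theta>_def)
    finally show ?thesis using upper_gen_dim_le[OF q] order_trans ereal_less_eq(3) by blast
  qed
  moreover have "1 - \<eta> < (\<integral>x. \<psi> x \<partial>\<nu>)" using \<nu>_int[OF \<psi>_cont] \<psi>_O \<eta> by simp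
  ultimately show ?thesis using \<psi>_cont by (intro exI[of _ \<psi>] exI[of _ "1 - \<eta>"]) blast
qed

end

section \<open>A residual set of measures of dimension zero\<close>

context compact_system
begin

lemma openin_weak_topology:
  fixes \<phi> :: "'m \<Rightarrow> real"
  assumes "continuous_on X \<phi>" "open U"
  shows "openin (weak_topology X T) {\<mu> \<in> \<M>. (\<integral>x. \<phi> x \<partial>\<mu>) \<in> U}"
  unfolding weak_topology_def
  using compact_imp_bounded[OF compact_continuous_image[OF assms(1) compact_X]] assms
  by (intro topology_generated_by_Basis) blast

text \<open>The generating sets form only a subbase; intersections are absorbed by uniting the
  finite sets of test functions and taking the smaller \<eta>.\<close>

lemma weak_topology_nhd:
  assumes W: "openin (weak_topology X T) W" and \<mu>: "\<mu> \<in> W"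
  shows "\<exists>(\<Phi>::('m \<Rightarrow> real) set) \<eta>. finite \<Phi> \<and> (\<forall>\<phi>\<in>\<Phi>. continuous_on X \<phi>) \<and> \<eta> > 0 \<and>
    (\<forall>\<nu>\<in>\<M>. (\<forall>\<phi>\<in>\<Phi>. \<bar>(\<integral>x. \<phi> x \<partial>\<nu>) - (\<integral>x. \<phi> x \<partial>\<mu>)\<bar> < \<eta>) \<longrightarrow> \<nu> \<in> W)"
    (is "?Q W")
proof -
  have "generate_topology_on {{\<mu> \<in> \<M>. (\<integral>x. \<phi> x \<partial>\<mu>) \<in> U} | (\<phi> :: 'm \<Rightarrow> real) U.
          continuous_on X \<phi> \<and> bounded (\<phi> ` X) \<and> open U} W"
    using W unfolding weak_topology_def openin_topology_generated_by_iff .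
  then show ?thesis using \<mu>
  proof (induction rule: generate_topology_on.induct)
    case Empty then show ?case by simp
  next
    case (Int a b)
    obtain \<Phi>1 \<eta>1 where 1: "finite \<Phi>1" "\<forall>\<phi>\<in>\<Phi>1. continuous_on X (\<phi> :: 'm \<Rightarrow> real)" "\<eta>1 > 0"
      "\<forall>\<nu>\<in>\<M>. (\<forall>\<phi>\<in>\<Phi>1. \<bar>(\<integral>x. \<phi> x \<partial>\<nu>) - (\<integral>x. \<phi> x \<partial>\<mu>)\<bar> < \<eta>1) \<longrightarrow> \<nu> \<in> a"
      using Int.IH(1) Int.prems by blast
    obtain \<Phi>2 \<eta>2 where 2: "finite \<Phi>2" "\<forall>\<phi>\<in>\<Phi>2. continuous_on X (\<phi> :: 'm \<Rightarrow> real)" "\<eta>2 > 0"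
      "\<forall>\<nu>\<in>\<M>. (\<forall>\<phi>\<in>\<Phi>2. \<bar>(\<integral>x. \<phi> x \<partial>\<nu>) - (\<integral>x. \<phi> x \<partial>\<mu>)\<bar> < \<eta>2) \<longrightarrow> \<nu> \<in> b"
      using Int.IH(2) Int.prems by blast
    show ?case
      using 1 2 by (intro exI[of _ "\<Phi>1 \<union> \<Phi>2"] exI[of _ "min \<eta>1 \<eta>2"]) auto
  next
    case (UN K)
    then obtain k where k: "k \<in> K" "\<mu> \<in> k" by blast
    obtain \<Phi> \<eta> where 1: "finite \<Phi>" "\<forall>\<phi>\<in>\<Phi>. continuous_on X (\<phi> :: 'm \<Rightarrow> real)" "\<eta> > 0"
      "\<forall>\<nu>\<in>\<M>. (\<forall>\<phi>\<in>\<Phi>. \<bar>(\<integral>x. \<phi> x \<partial>\<nu>) - (\<integral>x. \<phi> x \<partial>\<mu>)\<bar> < \<eta>) \<longrightarrow> \<nu> \<in> k"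
      using UN.IH[OF k] by blast
    show ?case using 1 k(1) by (intro exI[of _ \<Phi>] exI[of _ \<eta>]) auto
  next
    case (Basis s)
    then obtain \<phi> :: "'m \<Rightarrow> real" and U where s: "s = {\<mu> \<in> \<M>. (\<integral>x. \<phi> x \<partial>\<mu>) \<in> U}"
      "continuous_on X \<phi>" "open U" by blast
    then obtain e where e: "e > 0" "\<And>y. dist y (\<integral>x. \<phi> x \<partial>\<mu>) < e \<Longrightarrow> y \<in> U"
      using Basis.prems unfolding open_dist by blast
    show ?case using s e by (intro exI[of _ "{\<phi>}"] exI[of _ e]) (auto simp: dist_real_def)
  qed
qed

lemma finite_measures_dense:
  assumes "periodic_shadowing X T d" "openin (weak_topology X T) W" "W \<noteq> {}"
  shows "finite_measures \<inter> W \<noteq> {}"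
proof -
  obtain \<mu> where \<mu>: "\<mu> \<in> W" using assms(3) by blast
  then have \<mu>_inv: "\<mu> \<in> \<M>"
    using openin_subset[OF assms(2)] unfolding topspace_weak_topology by blast
  obtain \<Phi> \<eta> where 1: "finite \<Phi>" "\<forall>\<phi>\<in>\<Phi>. continuous_on X (\<phi> :: 'm \<Rightarrow> real)" "\<eta> > 0"
    "\<forall>\<nu>\<in>\<M>. (\<forall>\<phi>\<in>\<Phi>. \<bar>(\<integral>x. \<phi> x \<partial>\<nu>) - (\<integral>x. \<phi> x \<partial>\<mu>)\<bar> < \<eta>) \<longrightarrow> \<nu> \<in> W"
    using weak_topology_nhd[OF assms(2) \<mu>] by blast
  obtain \<nu> where \<nu>: "\<nu> \<in> finite_measures" "\<forall>\<phi>\<in>\<Phi>. \<bar>(\<integral>x. \<phi> x \<partial>\<nu>) - (\<integral>x. \<phi> x \<partial>\<mu>)\<bar> < \<eta>"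
    using finite_measures_approximate[OF \<mu>_inv assms(1) 1(1) _ 1(3)] 1(2) by blast
  moreover have "\<nu> \<in> \<M>" using \<nu>(1) by (simp add: finite_measures_def)
  ultimately show ?thesis using 1(4) by blast
qed

lemma upper_gen_dim_nonneg:
  assumes \<mu>: "\<mu> \<in> \<M>" and q: "q \<ge> 1"
  shows "upper_gen_dim d \<mu> q \<ge> 0"
proof -
  have "\<forall>\<^sub>F r in at_right (0::real). r \<in> {0 <..< 1}" by (intro eventually_at_right_real) simp
  then have "\<forall>\<^sub>F r in at_right 0. 0 \<le> ereal (log_moment \<mu> q r / ln r)"
  proof eventually_elim
    case (elim r)
    then have "ln r < 0" by simp
    then show ?case using log_moment_nonpos[OF \<mu> q, of r] by (simp add: divide_nonpos_neg)
  qed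
  then have "Limsup (at_right (0::real)) (\<lambda>_. 0) \<le> Limsup (at_right 0) (\<lambda>r. ereal (log_moment \<mu> q r / ln r))"
    by (rule Limsup_mono)
  then show ?thesis unfolding upper_gen_dim_eq by (simp add: Limsup_const)
qed

end

context hyperbolic_system
begin

theorem residual_zero_dimension:
  assumes Lip: "\<And>x y. x \<in> X \<Longrightarrow> y \<in> X \<Longrightarrow> mdist d (T x) (T y) \<le> L * mdist d x y" "L \<ge> 1"
    and shadowing: "periodic_shadowing X T d" and q: "q \<ge> 1"
  shows "residual_in (weak_topology X T) {\<mu> \<in> \<M>. upper_gen_dim d \<mu> q = 0}"
proof -
  define \<delta> where "\<delta> j = 1 / real (Suc j)" for j
  have \<delta>: "\<delta> j > 0" for j by (simp add: \<delta>_def)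
  have "\<forall>j. \<forall>\<nu>\<in>finite_measures. \<exists>U. openin (weak_topology X T) U \<and> \<nu> \<in> U \<and>
      (\<forall>\<mu>\<in>U. upper_gen_dim d \<mu> q \<le> ereal (\<delta> j))"
  proof (intro allI ballI)
    fix j \<nu> assume \<nu>: "\<nu> \<in> finite_measures"
    obtain \<psi> :: "'m \<Rightarrow> real" and t where \<psi>: "continuous_on X \<psi>" "t < (\<integral>x. \<psi> x \<partial>\<nu>)"
      "\<forall>\<mu>\<in>\<M>. t < (\<integral>x. \<psi> x \<partial>\<mu>) \<longrightarrow> upper_gen_dim d \<mu> q \<le> ereal (\<delta> j)"
      using small_dimension_near_finite[OF Lip \<nu> \<delta>[of j] q] by blast
    have "openin (weak_topology X T) {\<mu> \<in> \<M>. (\<integral>x. \<psi> x \<partial>\<mu>) \<in> {t<..}}"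
      by (rule openin_weak_topology[OF \<psi>(1)]) simp
    moreover have "\<nu> \<in> {\<mu> \<in> \<M>. (\<integral>x. \<psi> x \<partial>\<mu>) \<in> {t<..}}" using \<nu> \<psi>(2) by (simp add: finite_measures_def)
    ultimately show "\<exists>U. openin (weak_topology X T) U \<and> \<nu> \<in> U \<and> (\<forall>\<mu>\<in>U. upper_gen_dim d \<mu> q \<le> ereal (\<delta> j))"
      using \<psi>(3) by (intro exI[of _ "{\<mu> \<in> \<M>. (\<integral>x. \<psi> x \<partial>\<mu>) \<in> {t<..}}"]) auto
  qed
  then obtain U where U: "\<And>j \<nu>. \<nu> \<in> finite_measures \<Longrightarrow> openin (weak_topology X T) (U j \<nu>)"
    "\<And>j \<nu>. \<nu> \<in> finite_measures \<Longrightarrow> \<nu> \<in> U j \<nu>"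
    "\<And>j \<nu> \<mu>. \<nu> \<in> finite_measures \<Longrightarrow> \<mu> \<in> U j \<nu> \<Longrightarrow> upper_gen_dim d \<mu> q \<le> ereal (\<delta> j)"
    by metis
  \<comment> \<open>Open as a union, and dense because it contains all of
    \<open>finite_measures\<close>.\<close>
  define G where "G j = (\<Union>\<nu>\<in>finite_measures. U j \<nu>)" for j
  have G_open: "openin (weak_topology X T) (G j)" for j
    unfolding G_def using U(1) by (intro openin_Union) auto
  have G_dense: "weak_topology X T closure_of G j = topspace (weak_topology X T)" for j
    unfolding dense_intersects_open
  proof (intro allI impI)
    fix W assume "openin (weak_topology X T) W \<and> W \<noteq> {}"
    then obtain \<nu> where "\<nu> \<in> finite_measures" "\<nu> \<in> W" using finite_measures_dense[OF shadowing] by blast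
    then show "G j \<inter> W \<noteq> {}" using U(2) unfolding G_def by blast
  qed
  have "(\<Inter>j. G j) \<subseteq> {\<mu> \<in> \<M>. upper_gen_dim d \<mu> q = 0}"
  proof
    fix \<mu> assume \<mu>: "\<mu> \<in> (\<Inter>j. G j)"
    then have \<mu>_inv: "\<mu> \<in> \<M>" using openin_subset[OF G_open[of 0]] unfolding topspace_weak_topology by blast
    have le: "upper_gen_dim d \<mu> q \<le> ereal (\<delta> j)" for j
    proof -
      have "\<mu> \<in> G j" using \<mu> by blast
      then obtain \<nu> where "\<nu> \<in> finite_measures" "\<mu> \<in> U j \<nu>" unfolding G_def by blast
      then show ?thesis by (rule U(3))
    qed
    have "(\<lambda>j. ereal (\<delta> j)) \<longlonglongrightarrow> ereal 0"
      unfolding \<delta>_def tendsto_ereal using LIMSEQ_inverse_real_of_nat by (simp add: inverse_eq_divide)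
    then have "upper_gen_dim d \<mu> q \<le> ereal 0" using LIMSEQ_le_const le by blast
    then show "\<mu> \<in> {\<mu> \<in> \<M>. upper_gen_dim d \<mu> q = 0}"
      using upper_gen_dim_nonneg[OF \<mu>_inv q] \<mu>_inv by (simp add: order_antisym zero_ereal_def)
  qed
  then show ?thesis
    unfolding residual_in_def topspace_weak_topology using G_open G_dense
    by (intro conjI exI[of _ G]) (auto simp: topspace_weak_topology)
qed

end

section \<open>Differentials in charts\<close>

text \<open>In a compact topological space a sequence need not have a convergent subsequence. The
  filter \<open>G\<close> refines both the sequence and the neighbourhoods of a cluster point, so
  limits along \<open>G\<close> take the place of subsequences.\<close>

lemma compact_cluster_sequence:
  fixes \<omega> :: "nat \<Rightarrow> 's::topological_space"
  assumes "compact \<Omega>" "\<And>k. \<omega> k \<in> \<Omega>"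
  obtains y G where "y \<in> \<Omega>" "G \<noteq> bot" "G \<le> nhds y" "G \<le> filtermap \<omega> sequentially"
proof -
  have "filtermap \<omega> sequentially \<noteq> bot" by (simp add: filtermap_bot_iff)
  moreover have "eventually (\<lambda>x. x \<in> \<Omega>) (filtermap \<omega> sequentially)"
    using assms(2) by (simp add: eventually_filtermap)
  ultimately obtain y where "y \<in> \<Omega>" "inf (nhds y) (filtermap \<omega> sequentially) \<noteq> bot"
    using assms(1) unfolding compact_filter by blast
  then show ?thesis using that[of y "inf (nhds y) (filtermap \<omega> sequentially)"] by simp
qed

lemma compact_sequences:
  fixes C :: "'s::topological_space set"
  assumes "compact C"
  shows "compact {\<omega> :: int \<Rightarrow> 's. \<forall>i. \<omega> i \<in> C}"
proof -
  have "compactin (product_topology (\<lambda>_. euclidean) UNIV) (PiE (UNIV :: int set) (\<lambda>_. C))"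
    using assms by (subst compactin_PiE) (simp add: compactin_euclidean_iff)
  moreover have "PiE (UNIV :: int set) (\<lambda>_. C) = {\<omega>. \<forall>i. \<omega> i \<in> C}" by (auto simp: PiE_def Pi_def)
  ultimately show ?thesis by (simp add: euclidean_product_topology compactin_euclidean_iff)
qed

text \<open>\<open>Ck_on\<close> controls the derivative one direction at a time; this passes from
  the basis directions to all vectors at the cost of a factor \<open>DIM('e)\<close>.\<close>

lemma norm_linear_diff_bound:
  fixes D D' :: "'e::euclidean_space \<Rightarrow> 'e" and e :: real
  assumes "linear D" "linear D'" and b: "\<And>b. b \<in> Basis \<Longrightarrow> norm (D b - D' b) \<le> e"
  shows "norm (D w - D' w) \<le> DIM('e) * e * norm w"
proof -
  have lin: "linear (\<lambda>w. D w - D' w)" using assms(1,2) by (rule linear_compose_sub)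
  have "D w - D' w = (\<Sum>b\<in>Basis. (w \<bullet> b) *\<^sub>R (D b - D' b))"
    using linear_sum[OF lin, of "\<lambda>b. (w \<bullet> b) *\<^sub>R b" Basis] linear_cmul[OF lin]
    by (simp add: euclidean_representation)
  also have "norm \<dots> \<le> (\<Sum>b\<in>Basis. norm ((w \<bullet> b) *\<^sub>R (D b - D' b)))" by (rule norm_sum)
  also have "\<dots> \<le> (\<Sum>b\<in>(Basis::'e set). norm w * e)"
    unfolding norm_scaleR using b Basis_le_norm[of _ w] by (intro sum_mono mult_mono) auto
  finally show ?thesis by (simp add: mult_ac)
qed

locale smooth_manifold =
  fixes \<A> :: "('m::t2_space, 'e::euclidean_space) chart set"
  assumes manifold: "compact_smooth_manifold \<A>"
begin

lemma compact_UNIV_m: "compact (UNIV :: 'm set)"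
  using manifold by (simp add: compact_smooth_manifold_def)

lemma chart:
  assumes "c \<in> \<A>"
  shows "open (fst c)" "open (snd c ` fst c)" "continuous_on (fst c) (snd c)"
    "continuous_on (snd c ` fst c) (chart_inv c)"
    "\<And>p. p \<in> fst c \<Longrightarrow> chart_inv c (snd c p) = p"
    "\<And>u. u \<in> snd c ` fst c \<Longrightarrow> chart_inv c u \<in> fst c"
    "\<And>u. u \<in> snd c ` fst c \<Longrightarrow> snd c (chart_inv c u) = u"
proof -
  have *: "open (fst c)" "open (snd c ` fst c)" "homeomorphism (fst c) (snd c ` fst c) (snd c) (chart_inv c)"
    using manifold assms by (auto simp: compact_smooth_manifold_def)
  then show "open (fst c)" "open (snd c ` fst c)" "continuous_on (fst c) (snd c)"
    "continuous_on (snd c ` fst c) (chart_inv c)" by (auto simp: homeomorphism_def)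
  show "\<And>p. p \<in> fst c \<Longrightarrow> chart_inv c (snd c p) = p"
    "\<And>u. u \<in> snd c ` fst c \<Longrightarrow> chart_inv c u \<in> fst c"
    "\<And>u. u \<in> snd c ` fst c \<Longrightarrow> snd c (chart_inv c u) = u"
    using *(3) unfolding homeomorphism_def by auto
qed

lemma chart_at: "chart_at \<A> p \<in> \<A>" "p \<in> fst (chart_at \<A> p)"
proof -
  have "(\<Union>c\<in>\<A>. fst c) = UNIV" using manifold by (simp add: compact_smooth_manifold_def)
  then have "\<exists>c. c \<in> \<A> \<and> p \<in> fst c" by blast
  then have "chart_at \<A> p \<in> \<A> \<and> p \<in> fst (chart_at \<A> p)" unfolding chart_at_def by (rule someI_ex)
  then show "chart_at \<A> p \<in> \<A>" "p \<in> fst (chart_at \<A> p)" by auto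
qed

lemma open_chart_image:
  assumes c: "c \<in> \<A>" and U: "open U" "U \<subseteq> fst c"
  shows "open (snd c ` U)"
proof -
  have "snd c ` U = snd c ` fst c \<inter> chart_inv c -` U"
    using chart(5,6,7)[OF c] U(2) by force
  then show ?thesis using continuous_open_preimage[OF chart(4,2)[OF c] U(1)] by simp
qed

definition loc :: "('m, 'e) chart \<Rightarrow> ('m, 'e) chart \<Rightarrow> ('m \<Rightarrow> 'm) \<Rightarrow> 'e \<Rightarrow> 'e" where
  "loc c c' f = snd c' \<circ> f \<circ> chart_inv c"

text \<open>\<open>mderiv\<close> uses a chart that may jump from point to point. In fixed charts
  the derivative of a C1 map depends continuously on \<open>p\<close>, which taking limits
  requires.\<close>

definition dloc :: "('m, 'e) chart \<Rightarrow> ('m, 'e) chart \<Rightarrow> ('m \<Rightarrow> 'm) \<Rightarrow> 'm \<Rightarrow> 'e \<Rightarrow> 'e" where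
  "dloc c c' f p = frechet_derivative (loc c c' f) (at (snd c p))"

text \<open>Enough regularity for the chain rule, and stable under composition. Chart changes appear
  as \<open>loc c c' id\<close>.\<close>

definition diff_map :: "('m \<Rightarrow> 'm) \<Rightarrow> bool" where
  "diff_map f \<longleftrightarrow> continuous_on UNIV f \<and>
     (\<forall>c\<in>\<A>. \<forall>c'\<in>\<A>. \<forall>p\<in>fst c. f p \<in> fst c' \<longrightarrow> loc c c' f differentiable (at (snd c p)))"

lemma C1_map_diff_map: "C1_map \<A> f \<Longrightarrow> diff_map f"
  unfolding C1_map_def diff_map_def loc_def by (auto simp: One_nat_def)

lemma diff_map_id: "diff_map id"
proof -
  have "smooth_on (snd c' \<circ> chart_inv c) (snd c ` (fst c \<inter> fst c'))" if "c \<in> \<A>" "c' \<in> \<A>" for c c'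
    using manifold that by (simp add: compact_smooth_manifold_def)
  then have "Ck_on (Suc 0) (snd c' \<circ> chart_inv c) (snd c ` (fst c \<inter> fst c'))" if "c \<in> \<A>" "c' \<in> \<A>" for c c'
    using that unfolding smooth_on_def by blast
  then show ?thesis unfolding diff_map_def loc_def by auto
qed

lemma has_derivative_loc:
  assumes "diff_map f" "c \<in> \<A>" "c' \<in> \<A>" "p \<in> fst c" "f p \<in> fst c'"
  shows "(loc c c' f has_derivative dloc c c' f p) (at (snd c p))"
  using assms unfolding diff_map_def dloc_def by (subst frechet_derivative_works[symmetric]) blast

lemma linear_dloc:
  assumes "diff_map f" "c \<in> \<A>" "c' \<in> \<A>" "p \<in> fst c" "f p \<in> fst c'"
  shows "linear (dloc c c' f p)"
  using has_derivative_loc[OF assms] by (rule has_derivative_linear)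

lemma open_vimage_diff_map: "diff_map f \<Longrightarrow> open U \<Longrightarrow> open (f -` U)"
  unfolding diff_map_def by (auto intro: open_vimage)

lemma has_derivative_comp:
  assumes f: "diff_map f" and g: "diff_map g" and c: "c \<in> \<A>" "c' \<in> \<A>" "c'' \<in> \<A>"
    and p: "p \<in> fst c" "f p \<in> fst c'" "g (f p) \<in> fst c''"
  shows "(loc c c'' (g \<circ> f) has_derivative dloc c' c'' g (f p) \<circ> dloc c c' f p) (at (snd c p))"
proof -
  have val: "loc c c' f (snd c p) = snd c' (f p)" using chart(5)[OF c(1) p(1)] by (simp add: loc_def)
  have "(loc c' c'' g \<circ> loc c c' f has_derivative dloc c' c'' g (f p) \<circ> dloc c c' f p) (at (snd c p))"
    using has_derivative_loc[OF f c(1,2) p(1,2)] has_derivative_loc[OF g c(2,3) p(2,3)]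
    by (intro diff_chain_at) (simp_all add: val)
  then show ?thesis
  proof (rule has_derivative_transform_within_open)
    \<comment> \<open>The chart formula for the composition is valid only where \<open>f\<close>
      stays in the domain of \<open>c'\<close>.\<close>
    show "open (snd c ` (fst c \<inter> f -` fst c'))"
      using chart(1) c open_vimage_diff_map[OF f] by (intro open_chart_image open_Int) auto
    show "snd c p \<in> snd c ` (fst c \<inter> f -` fst c')" using p by auto
    show "(loc c' c'' g \<circ> loc c c' f) u = loc c c'' (g \<circ> f) u" if "u \<in> snd c ` (fst c \<inter> f -` fst c')" for u
      using that chart(5)[OF c(1)] chart(5)[OF c(2)] by (auto simp: loc_def)
  qed
qed

lemma diff_map_comp:
  assumes "diff_map f" "diff_map g"
  shows "diff_map (g \<circ> f)"
  unfolding diff_map_def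
proof (intro conjI ballI impI)
  show "continuous_on UNIV (g \<circ> f)"
    using assms unfolding diff_map_def by (intro continuous_on_compose) (auto intro: continuous_on_subset)
  fix c c'' p assume "c \<in> \<A>" "c'' \<in> \<A>" "p \<in> fst c" "(g \<circ> f) p \<in> fst c''"
  then show "loc c c'' (g \<circ> f) differentiable at (snd c p)"
    using has_derivative_comp[OF assms _ chart_at(1) _ _ chart_at(2)] unfolding differentiable_def by fastforce
qed

lemma dloc_comp:
  assumes f: "diff_map f" and g: "diff_map g" and c: "c \<in> \<A>" "c' \<in> \<A>" "c'' \<in> \<A>"
    and p: "p \<in> fst c" "f p \<in> fst c'" "g (f p) \<in> fst c''"
  shows "dloc c c'' (g \<circ> f) p = dloc c' c'' g (f p) \<circ> dloc c c' f p"
  unfolding dloc_def[of c c''] using frechet_derivative_at[OF has_derivative_comp[OF assms]] by simp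

lemma dloc_id:
  assumes "c \<in> \<A>" "p \<in> fst c"
  shows "dloc c c id p = id"
proof -
  have "(loc c c id has_derivative (\<lambda>v. v)) (at (snd c p))"
  proof (rule has_derivative_transform_within_open[OF has_derivative_ident])
    show "open (snd c ` fst c)" "snd c p \<in> snd c ` fst c" using chart(2)[OF assms(1)] assms by auto
    show "u = loc c c id u" if "u \<in> snd c ` fst c" for u
      using chart(7)[OF assms(1) that] by (simp add: loc_def)
  qed
  from frechet_derivative_at[OF this] show ?thesis unfolding dloc_def by (simp add: id_def)
qed

lemma mderiv_eq: "mderiv \<A> f p = dloc (chart_at \<A> p) (chart_at \<A> (f p)) f p"
  by (simp add: mderiv_def dloc_def loc_def)

lemma to_tangent_eq: "to_tangent \<A> c p = dloc c (chart_at \<A> p) id p"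
  by (simp add: to_tangent_def dloc_def loc_def)

lemma mderiv_comp:
  assumes "diff_map f" "diff_map g"
  shows "mderiv \<A> (g \<circ> f) p = mderiv \<A> g (f p) \<circ> mderiv \<A> f p"
  unfolding mderiv_eq
  using dloc_comp[OF assms chart_at(1) chart_at(1) chart_at(1) chart_at(2) chart_at(2) chart_at(2)] by simp

lemma mderiv_id: "mderiv \<A> id p = id"
  unfolding mderiv_eq using dloc_id chart_at by simp

lemma linear_mderiv: "diff_map f \<Longrightarrow> linear (mderiv \<A> f p)"
  unfolding mderiv_eq by (intro linear_dloc chart_at)

lemma diff_map_funpow: "diff_map f \<Longrightarrow> diff_map (f ^^ n)"
proof (induction n)
  case 0 then show ?case unfolding funpow.simps by (intro diff_map_id)
next
  case (Suc n) then show ?case unfolding funpow.simps by (intro diff_map_comp)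
qed

lemma mderiv_funpow_Suc: "diff_map f \<Longrightarrow> mderiv \<A> (f ^^ Suc n) p v = mderiv \<A> f ((f ^^ n) p) (mderiv \<A> (f ^^ n) p v)"
  using mderiv_comp[OF diff_map_funpow, of f f n p] by simp

lemma mderiv_inverse:
  assumes "diff_map f" "diff_map h" "\<And>x. h (f x) = x"
  shows "mderiv \<A> h (f p) (mderiv \<A> f p v) = v"
proof -
  have "h \<circ> f = id" using assms(3) by auto
  then show ?thesis using mderiv_comp[OF assms(1,2), of p] mderiv_id by (metis comp_apply id_apply)
qed

text \<open>Read \<open>f\<close> from \<open>c\<close> to the preferred chart at
  \<open>f p\<close>, and factor it once through \<open>c'\<close> and once through the preferred
  chart at \<open>p\<close>.\<close>

lemma to_tangent_dloc:
  assumes f: "diff_map f" and c: "c \<in> \<A>" "c' \<in> \<A>" "p \<in> fst c" "f p \<in> fst c'"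
  shows "to_tangent \<A> c' (f p) (dloc c c' f p v) = mderiv \<A> f p (to_tangent \<A> c p v)"
proof -
  have "dloc c (chart_at \<A> (f p)) (id \<circ> f) p = dloc c' (chart_at \<A> (f p)) id (f p) \<circ> dloc c c' f p"
    using c chart_at by (intro dloc_comp f diff_map_id) auto
  moreover have "dloc c (chart_at \<A> (f p)) (f \<circ> id) p
      = dloc (chart_at \<A> p) (chart_at \<A> (f p)) f (id p) \<circ> dloc c (chart_at \<A> p) id p"
    using c chart_at by (intro dloc_comp f diff_map_id) auto
  ultimately show ?thesis unfolding to_tangent_eq mderiv_eq by (metis comp_apply comp_id id_apply id_comp)
qed

text \<open>The derivative of the chart change back to \<open>c\<close> is a left inverse.\<close>

lemma to_tangent_injective:
  assumes c: "c \<in> \<A>" "p \<in> fst c" and "to_tangent \<A> c p v = 0"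
  shows "v = 0"
proof -
  have "dloc c c (id \<circ> id) p = dloc (chart_at \<A> p) c id (id p) \<circ> dloc c (chart_at \<A> p) id p"
    using c chart_at by (intro dloc_comp diff_map_id) auto
  then have "v = dloc (chart_at \<A> p) c id p (to_tangent \<A> c p v)"
    using dloc_id[OF c] unfolding to_tangent_eq by (metis comp_apply id_apply id_comp)
  also have "\<dots> = 0" unfolding assms(3) using c chart_at
    by (intro linear_0 linear_dloc diff_map_id) auto
  finally show ?thesis .
qed

text \<open>Smoothness is given for the coefficients of the metric on fixed coordinate vectors.
  These are bounded on a compact set, and a vector of norm at most 1 has coordinates of size at most
  1.\<close>

lemma riemannian_bound:
  assumes g: "riemannian_metric \<A> g" and c: "c \<in> \<A>" and K: "compact K" "K \<subseteq> fst c"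
  shows "\<exists>C. \<forall>p\<in>K. \<forall>v. norm v \<le> 1 \<longrightarrow> g p (to_tangent \<A> c p v) (to_tangent \<A> c p v) \<le> C"
proof -
  let ?L = "\<lambda>p. to_tangent \<A> c p"
  have "\<exists>C. \<forall>p\<in>K. \<bar>g p (?L p b) (?L p b')\<bar> \<le> C" for b b'
  proof -
    have "smooth_on (\<lambda>x. g (chart_inv c x) (?L (chart_inv c x) b) (?L (chart_inv c x) b')) (snd c ` fst c)"
      using g c by (simp add: riemannian_metric_def)
    then have "Ck_on 0 (\<lambda>x. g (chart_inv c x) (?L (chart_inv c x) b) (?L (chart_inv c x) b')) (snd c ` fst c)"
      unfolding smooth_on_def by blast
    then have cont: "continuous_on (snd c ` K) (\<lambda>x. g (chart_inv c x) (?L (chart_inv c x) b) (?L (chart_inv c x) b'))"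
      using K(2) by (auto intro: continuous_on_subset)
    have "compact (snd c ` K)"
      using K chart(3)[OF c] by (intro compact_continuous_image) (auto intro: continuous_on_subset)
    then have "bounded ((\<lambda>x. g (chart_inv c x) (?L (chart_inv c x) b) (?L (chart_inv c x) b')) ` snd c ` K)"
      by (intro compact_imp_bounded compact_continuous_image[OF cont])
    then obtain C where "\<forall>p\<in>K. \<bar>g (chart_inv c (snd c p)) (?L (chart_inv c (snd c p)) b) (?L (chart_inv c (snd c p)) b')\<bar> \<le> C"
      unfolding bounded_iff by auto
    then show ?thesis using chart(5)[OF c] K(2) by (metis subsetD)
  qed
  then obtain C where C: "\<And>b b' p. p \<in> K \<Longrightarrow> \<bar>g p (?L p b) (?L p b')\<bar> \<le> C b b'" by metis
  have "g p (?L p v) (?L p v) \<le> (\<Sum>(b, b')\<in>Basis \<times> Basis. C b b')" if p: "p \<in> K" and v: "norm v \<le> 1" for p v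
  proof -
    have lin: "linear (?L p)"
      unfolding to_tangent_eq using c p K(2) chart_at by (intro linear_dloc diff_map_id) auto
    have bil: "bilinear (g p)" using g by (simp add: riemannian_metric_def)
    have "?L p v = ?L p (\<Sum>b\<in>Basis. (v \<bullet> b) *\<^sub>R b)" by (simp add: euclidean_representation)
    also have "\<dots> = (\<Sum>b\<in>Basis. (v \<bullet> b) *\<^sub>R ?L p b)" by (simp add: linear_sum[OF lin] linear_cmul[OF lin])
    finally have "g p (?L p v) (?L p v) = (\<Sum>(b, b')\<in>Basis \<times> Basis. g p ((v \<bullet> b) *\<^sub>R ?L p b) ((v \<bullet> b') *\<^sub>R ?L p b'))"
      using bilinear_sum[OF bil, of "\<lambda>b. (v \<bullet> b) *\<^sub>R ?L p b" Basis "\<lambda>b. (v \<bullet> b) *\<^sub>R ?L p b" Basis] by simp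
    also have "\<dots> \<le> (\<Sum>(b, b')\<in>Basis \<times> Basis. C b b')"
    proof (intro sum_mono, clarify)
      fix b b' :: 'e assume b: "b \<in> Basis" "b' \<in> Basis"
      have "\<bar>v \<bullet> b\<bar> \<le> 1" "\<bar>v \<bullet> b'\<bar> \<le> 1" using v b Basis_le_norm by (meson order_trans)+
      then have "\<bar>v \<bullet> b\<bar> * (\<bar>v \<bullet> b'\<bar> * \<bar>g p (?L p b) (?L p b')\<bar>) \<le> 1 * (1 * C b b')"
        using C[OF p] by (intro mult_mono) auto
      moreover have "g p ((v \<bullet> b) *\<^sub>R ?L p b) ((v \<bullet> b') *\<^sub>R ?L p b') = (v \<bullet> b) * ((v \<bullet> b') * g p (?L p b) (?L p b'))"
        by (simp add: bilinear_lmul[OF bil] bilinear_rmul[OF bil])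
      ultimately show "g p ((v \<bullet> b) *\<^sub>R ?L p b) ((v \<bullet> b') *\<^sub>R ?L p b') \<le> C b b'"
        by (metis abs_le_D1 abs_mult mult_1)
    qed
    finally show ?thesis .
  qed
  then show ?thesis by blast
qed

text \<open>Pull back closed coordinate balls; the open balls inside them already cover, and
  finitely many suffice. Compactness of the pieces is what makes points together with a chart index
  a compact space later.\<close>

lemma finite_compact_chart_cover:
  "\<exists>(N::nat) ch K. (\<forall>j<N. ch j \<in> \<A> \<and> compact (K j) \<and> K j \<subseteq> fst (ch j)) \<and> (\<Union>j<N. K j) = UNIV"
proof -
  have "\<exists>K U. compact K \<and> K \<subseteq> fst (chart_at \<A> x) \<and> open U \<and> x \<in> U \<and> U \<subseteq> K" for x
  proof -
    let ?c = "chart_at \<A> x"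
    note c = chart[OF chart_at(1)[of x]]
    obtain r where r: "r > 0" "cball (snd ?c x) r \<subseteq> snd ?c ` fst ?c"
      using c(2) chart_at(2)[of x] by (metis imageI open_contains_cball)
    let ?K = "chart_inv ?c ` cball (snd ?c x) r" and ?U = "fst ?c \<inter> snd ?c -` ball (snd ?c x) r"
    have "compact ?K" using r(2) c(4) by (intro compact_continuous_image) (auto intro: continuous_on_subset)
    moreover have "?K \<subseteq> fst ?c" using r(2) c(6) by auto
    moreover have "open ?U" by (intro continuous_open_preimage c(3) c(1)) simp
    moreover have "x \<in> ?U" using chart_at(2) r(1) by auto
    moreover have "?U \<subseteq> ?K"
    proof
      fix y assume "y \<in> ?U"
      then have "y = chart_inv ?c (snd ?c y)" "snd ?c y \<in> cball (snd ?c x) r" using c(5) by (auto simp: less_imp_le)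
      then show "y \<in> ?K" by (metis imageI)
    qed
    ultimately show ?thesis by blast
  qed
  then obtain K U where KU: "\<And>x. compact (K x)" "\<And>x. K x \<subseteq> fst (chart_at \<A> x)" "\<And>x. open (U x)"
    "\<And>x. x \<in> U x" "\<And>x. U x \<subseteq> K x" by metis
  have cov: "UNIV \<subseteq> (\<Union>x\<in>UNIV. U x)" using KU(4) by blast
  have "\<exists>D. finite D \<and> UNIV \<subseteq> (\<Union>x\<in>D. U x)"
    by (rule compactE_image[OF compact_UNIV_m KU(3) cov]) blast
  then obtain D where D: "finite D" "UNIV \<subseteq> (\<Union>x\<in>D. U x)" by (elim exE conjE)
  obtain e where "bij_betw e {0..<card D} D" using ex_bij_betw_nat_finite[OF D(1)] by blast
  then have e: "e ` {..<card D} = D" by (simp add: bij_betw_def atLeast0LessThan)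
  have "(\<Union>j<card D. K (e j)) = UNIV"
  proof -
    have "(\<Union>j<card D. K (e j)) = (\<Union>x\<in>e ` {..<card D}. K x)" by simp
    also have "\<dots> = (\<Union>x\<in>D. K x)" by (simp only: e)
    also have "\<dots> = UNIV" using order_trans[OF D(2) UN_mono[OF subset_refl KU(5)]] by (simp only: top.extremum_unique)
    finally show ?thesis .
  qed
  then show ?thesis
    by (intro exI[of _ "card D"] exI[of _ "\<lambda>j. chart_at \<A> (e j)"] exI[of _ "\<lambda>j. K (e j)"] conjI allI impI
        chart_at KU(1,2))
qed

lemma riemannian_metricD:
  assumes "riemannian_metric \<A> g"
  shows "bilinear (g p)" "g p v w = g p w v" "v \<noteq> 0 \<Longrightarrow> g p v v > 0" "g p v v \<ge> 0"
proof -
  show bil: "bilinear (g p)" and "g p v w = g p w v" and pos: "v \<noteq> 0 \<Longrightarrow> g p v v > 0"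
    using assms by (auto simp: riemannian_metric_def)
  show "g p v v \<ge> 0" using pos bilinear_lzero[OF bil] by (cases "v = 0") (auto simp: less_imp_le)
qed

text \<open>A substitute for the triangle inequality, read off from the sign of
  \<open>g p (v + w) (v + w)\<close>.\<close>

lemma riemannian_parallelogram:
  assumes g: "riemannian_metric \<A> g"
  shows "g p (v - w) (v - w) \<le> 2 * g p v v + 2 * g p w w"
proof -
  note bil = riemannian_metricD(1)[OF g, of p]
  have "0 \<le> g p (v + w) (v + w)" by (rule riemannian_metricD(4)[OF g])
  then show ?thesis
    by (simp add: bilinear_ladd[OF bil] bilinear_radd[OF bil] bilinear_lsub[OF bil] bilinear_rsub[OF bil])
qed

lemma mderiv_funpow_inverse:
  assumes "diff_map f" "diff_map h" "\<And>x. h (f x) = x"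
  shows "mderiv \<A> (h ^^ n) ((f ^^ n) p) (mderiv \<A> (f ^^ n) p v) = v"
proof (rule mderiv_inverse)
  show "(h ^^ n) ((f ^^ n) x) = x" for x
  proof (induction n)
    case (Suc n)
    have "(h ^^ Suc n) ((f ^^ Suc n) x) = (h ^^ n) (h (f ((f ^^ n) x)))" by (simp add: funpow_swap1)
    then show ?case using Suc assms(3) by simp
  qed simp
qed (use assms diff_map_funpow in auto)

section \<open>Absence of nonzero bounded tangent orbits\<close>

text \<open>The forward images of \<open>a + b\<close> and of \<open>a\<close> are bounded, so those
  of \<open>b\<close> are bounded by some \<open>D\<close>. Pulling back from time \<open>n\<close>
  contracts by \<open>C * \<kappa> ^ n\<close>, and letting \<open>n\<close> grow leaves norm
  0.\<close>

lemma expanded_component_zero: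
  assumes g: "riemannian_metric \<A> g"
    and f: "diff_map f" and h: "diff_map h" and hf: "\<And>x. h (f x) = x"
    and C: "C > 0" and \<kappa>: "0 < \<kappa>" "\<kappa> < 1"
    and a: "\<And>n. riemannian_norm g ((f ^^ n) p) (mderiv \<A> (f ^^ n) p a) \<le> C * \<kappa> ^ n * riemannian_norm g p a"
    and b: "\<And>n. riemannian_norm g p (mderiv \<A> (h ^^ n) ((f ^^ n) p) (mderiv \<A> (f ^^ n) p b))
        \<le> C * \<kappa> ^ n * riemannian_norm g ((f ^^ n) p) (mderiv \<A> (f ^^ n) p b)"
    and bounded: "\<And>n. g ((f ^^ n) p) (mderiv \<A> (f ^^ n) p (a + b)) (mderiv \<A> (f ^^ n) p (a + b)) \<le> R"
  shows "b = 0"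
proof -
  let ?N = "riemannian_norm g"
  have N: "?N q v \<ge> 0" "(?N q v)\<^sup>2 = g q v v" for q v
    using riemannian_metricD(4)[OF g] by (auto simp: riemannian_norm_def)
  define D where "D = sqrt (2 * R + 2 * (C * ?N p a)\<^sup>2)"
  have bn: "?N ((f ^^ n) p) (mderiv \<A> (f ^^ n) p b) \<le> D" for n
  proof -
    let ?L = "mderiv \<A> (f ^^ n) p" and ?q = "(f ^^ n) p"
    have lin: "linear ?L" by (intro linear_mderiv diff_map_funpow f)
    have "?N ?q (?L a) \<le> C * \<kappa> ^ n * ?N p a" by (rule a)
    also have "\<dots> \<le> C * 1 * ?N p a"
      using C \<kappa> N by (intro mult_right_mono mult_left_mono power_le_one) auto
    finally have "(?N ?q (?L a))\<^sup>2 \<le> (C * ?N p a)\<^sup>2" using N by (intro power_mono) auto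
    then have 1: "g ?q (?L a) (?L a) \<le> (C * ?N p a)\<^sup>2" using N by simp
    have "?L b = ?L (a + b) - ?L a" using linear_diff[OF lin, of "a + b" a] by simp
    then have "g ?q (?L b) (?L b) \<le> 2 * g ?q (?L (a + b)) (?L (a + b)) + 2 * g ?q (?L a) (?L a)"
      using riemannian_parallelogram[OF g] by metis
    also have "\<dots> \<le> 2 * R + 2 * (C * ?N p a)\<^sup>2" using bounded[of n] 1 by simp
    finally show ?thesis unfolding riemannian_norm_def[of g ?q "?L b"] D_def by (rule real_sqrt_le_mono)
  qed
  have "?N p b \<le> C * \<kappa> ^ n * D" for n
  proof -
    have "?N p b \<le> C * \<kappa> ^ n * ?N ((f ^^ n) p) (mderiv \<A> (f ^^ n) p b)"
      using b[of n] mderiv_funpow_inverse[OF f h hf] by simp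
    also have "\<dots> \<le> C * \<kappa> ^ n * D" using bn C \<kappa> by (intro mult_left_mono) auto
    finally show ?thesis .
  qed
  moreover have "(\<lambda>n. C * \<kappa> ^ n * D) \<longlonglongrightarrow> C * 0 * D"
    using \<kappa> by (intro tendsto_intros LIMSEQ_realpow_zero) auto
  ultimately have "?N p b \<le> 0" using LIMSEQ_le_const by force
  then have "g p b b \<le> 0" using riemannian_metricD(4)[OF g, of p b] by (simp add: riemannian_norm_def)
  then show "b = 0" using riemannian_metricD(3)[OF g, of b p] by (meson not_less)
qed

text \<open>The unstable part of \<open>w 0\<close> vanishes by boundedness in forward time, the
  stable part by the same argument applied to \<open>inv f\<close>. This is the only point at which
  the splitting enters.\<close>

lemma bounded_tangent_orbit_zero:
  assumes g: "riemannian_metric \<A> g" and f: "diff_map f" "diff_map (inv f)" "bij f"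
    and hyp: "hyperbolic_set \<A> g f X"
    and y: "\<And>i::int. y i \<in> X" "\<And>i. f (y i) = y (i + 1)"
    and w: "\<And>i. w (i + 1) = mderiv \<A> f (y i) (w i)" "\<And>i. g (y i) (w i) (w i) \<le> R"
  shows "w 0 = 0"
proof -
  obtain Es Eu C \<kappa> where C: "C > 0" "0 < \<kappa>" "\<kappa> < 1" and E: "\<forall>p\<in>X.
          subspace (Es p) \<and> subspace (Eu p) \<and>
          Es p \<inter> Eu p = {0} \<and> (\<forall>v. \<exists>a\<in>Es p. \<exists>b\<in>Eu p. v = a + b) \<and>
          mderiv \<A> f p ` Es p = Es (f p) \<and> mderiv \<A> f p ` Eu p = Eu (f p) \<and>
          (\<forall>n. \<forall>v\<in>Es p. riemannian_norm g ((f ^^ n) p) (mderiv \<A> (f ^^ n) p v) \<le> C * \<kappa> ^ n * riemannian_norm g p v) \<and>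
          (\<forall>n. \<forall>v\<in>Eu p. riemannian_norm g ((inv f ^^ n) p) (mderiv \<A> (inv f ^^ n) p v) \<le> C * \<kappa> ^ n * riemannian_norm g p v)"
    using hyp unfolding hyperbolic_set_def by (elim exE conjE)
  have invf: "inv f (f x) = x" "f (inv f x) = x" for x
    using f(3) by (simp_all add: bij_is_inj bij_is_surj surj_f_inv_f)
  have y': "inv f (y i) = y (i - 1)" for i using y(2)[of "i - 1"] invf(1) by (metis diff_add_cancel)
  have w': "mderiv \<A> (inv f) (y i) (w i) = w (i - 1)" for i
    using mderiv_inverse[OF f(1,2) invf(1), of "y (i - 1)" "w (i - 1)"] w(1)[of "i - 1"] y(2)[of "i - 1"] by simp
  have neg: "- 1 - int n = - int n - 1" for n by simp
  have yn: "(f ^^ n) (y 0) = y (int n)" "(inv f ^^ n) (y 0) = y (- int n)" for n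
    using y(2) y' by (induction n) (auto simp: neg add.commute)
  have wn: "mderiv \<A> (f ^^ n) (y 0) (w 0) = w (int n)" for n
  proof (induction n)
    case 0 then show ?case using mderiv_id by (simp add: id_def)
  next
    case (Suc n) then show ?case unfolding mderiv_funpow_Suc[OF f(1)] using w(1)[of "int n"] by (simp add: yn add.commute)
  qed
  have wn': "mderiv \<A> (inv f ^^ n) (y 0) (w 0) = w (- int n)" for n
  proof (induction n)
    case 0 then show ?case using mderiv_id by (simp add: id_def)
  next
    case (Suc n) then show ?case unfolding mderiv_funpow_Suc[OF f(2)] using w'[of "- int n"] by (simp add: yn neg)
  qed
  have Es_fwd: "mderiv \<A> f p v \<in> Es (f p)" if "p \<in> X" "v \<in> Es p" for p v using E that by blast
  have Eu_fwd: "mderiv \<A> f p v \<in> Eu (f p)" if "p \<in> X" "v \<in> Eu p" for p v using E that by blast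
  have Es_bwd: "mderiv \<A> (inv f) (f p) v \<in> Es p" if "p \<in> X" "v \<in> Es (f p)" for p v
  proof -
    have "v \<in> mderiv \<A> f p ` Es p" using E that by blast
    then show ?thesis using mderiv_inverse[OF f(1,2) invf(1)] by auto
  qed
  obtain a b where ab: "a \<in> Es (y 0)" "b \<in> Eu (y 0)" "w 0 = a + b" using E y(1)[of 0] by blast
  have bn: "mderiv \<A> (f ^^ n) (y 0) b \<in> Eu (y (int n))" for n
  proof (induction n)
    case 0 then show ?case using mderiv_id ab by (simp add: id_def)
  next
    case (Suc n) then show ?case
      unfolding mderiv_funpow_Suc[OF f(1)] using Eu_fwd[OF y(1) Suc] y(2)[of "int n"] by (simp add: yn add.commute)
  qed
  have an: "mderiv \<A> (inv f ^^ n) (y 0) a \<in> Es (y (- int n))" for n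
  proof (induction n)
    case 0 then show ?case using mderiv_id ab by (simp add: id_def)
  next
    case (Suc n)
    have pre: "f (y (- int n - 1)) = y (- int n)" using y(2)[of "- int n - 1"] by simp
    have "mderiv \<A> (inv f ^^ n) (y 0) a \<in> Es (f (y (- int n - 1)))" unfolding pre by (rule Suc)
    from Es_bwd[OF y(1) this] show ?case unfolding mderiv_funpow_Suc[OF f(2)] pre by (simp add: yn neg)
  qed
  have inv_inv: "(inv f ^^ n) (y (int n)) = y 0" "(f ^^ n) (y (- int n)) = y 0" for n
  proof -
    have "(inv f ^^ n) ((f ^^ n) x) = x" "(f ^^ n) ((inv f ^^ n) x) = x" for x
      using invf by (induction n arbitrary: x) (simp_all add: funpow_swap1)
    then show "(inv f ^^ n) (y (int n)) = y 0" "(f ^^ n) (y (- int n)) = y 0" by (metis yn)+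
  qed
  have "b = 0"
  proof (rule expanded_component_zero[OF g f(1,2) invf(1) C])
    show "riemannian_norm g ((f ^^ n) (y 0)) (mderiv \<A> (f ^^ n) (y 0) a) \<le> C * \<kappa> ^ n * riemannian_norm g (y 0) a" for n
      using E y(1)[of 0] ab(1) by blast
    show "riemannian_norm g (y 0) (mderiv \<A> (inv f ^^ n) ((f ^^ n) (y 0)) (mderiv \<A> (f ^^ n) (y 0) b))
        \<le> C * \<kappa> ^ n * riemannian_norm g ((f ^^ n) (y 0)) (mderiv \<A> (f ^^ n) (y 0) b)" for n
    proof -
      have "riemannian_norm g ((inv f ^^ n) (y (int n))) (mderiv \<A> (inv f ^^ n) (y (int n)) (mderiv \<A> (f ^^ n) (y 0) b))
        \<le> C * \<kappa> ^ n * riemannian_norm g (y (int n)) (mderiv \<A> (f ^^ n) (y 0) b)"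
        using E y(1)[of "int n"] bn[of n] by blast
      then show ?thesis by (simp only: inv_inv yn)
    qed
    show "g ((f ^^ n) (y 0)) (mderiv \<A> (f ^^ n) (y 0) (a + b)) (mderiv \<A> (f ^^ n) (y 0) (a + b)) \<le> R" for n
      using w(2)[of "int n"] by (simp only: ab(3)[symmetric] wn yn)
  qed
  moreover have "a = 0"
  proof (rule expanded_component_zero[OF g f(2,1) invf(2) C])
    show "riemannian_norm g ((inv f ^^ n) (y 0)) (mderiv \<A> (inv f ^^ n) (y 0) b) \<le> C * \<kappa> ^ n * riemannian_norm g (y 0) b" for n
      using E y(1)[of 0] ab(2) by blast
    show "riemannian_norm g (y 0) (mderiv \<A> (f ^^ n) ((inv f ^^ n) (y 0)) (mderiv \<A> (inv f ^^ n) (y 0) a))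
        \<le> C * \<kappa> ^ n * riemannian_norm g ((inv f ^^ n) (y 0)) (mderiv \<A> (inv f ^^ n) (y 0) a)" for n
    proof -
      have "riemannian_norm g ((f ^^ n) (y (- int n))) (mderiv \<A> (f ^^ n) (y (- int n)) (mderiv \<A> (inv f ^^ n) (y 0) a))
        \<le> C * \<kappa> ^ n * riemannian_norm g (y (- int n)) (mderiv \<A> (inv f ^^ n) (y 0) a)"
        using E y(1)[of "- int n"] an[of n] by blast
      then show ?thesis by (simp only: inv_inv yn)
    qed
    show "g ((inv f ^^ n) (y 0)) (mderiv \<A> (inv f ^^ n) (y 0) (b + a)) (mderiv \<A> (inv f ^^ n) (y 0) (b + a)) \<le> R" for n
      using w(2)[of "- int n"] by (simp only: add.commute[of b a] ab(3)[symmetric] wn' yn)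
  qed
  ultimately show ?thesis using ab(3) by simp
qed

end

section \<open>Periodic shadowing on a hyperbolic set\<close>

context smooth_manifold
begin

lemma continuous_on_dloc:
  assumes f: "C1_map \<A> f" and c: "c \<in> \<A>" "c' \<in> \<A>"
  shows "continuous_on (fst c \<inter> f -` fst c') (\<lambda>p. dloc c c' f p b)"
proof -
  have "Ck_on (Suc 0) (loc c c' f) (snd c ` (fst c \<inter> f -` fst c'))"
    using f c unfolding C1_map_def loc_def One_nat_def by blast
  then have 1: "continuous_on (snd c ` (fst c \<inter> f -` fst c')) (\<lambda>u. frechet_derivative (loc c c' f) (at u) b)"
    by simp
  have 2: "continuous_on (fst c \<inter> f -` fst c') (snd c)"
    using chart(3)[OF c(1)] by (rule continuous_on_subset) auto
  show ?thesis unfolding dloc_def by (rule continuous_on_compose2[OF 1 2]) auto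
qed

text \<open>Expansion in the basis turns continuity in the point for each fixed direction into joint
  continuity in point and vector.\<close>

lemma tendsto_dloc:
  assumes f: "C1_map \<A> f" and c: "c \<in> \<A>" "c' \<in> \<A>" "x \<in> fst c" "f x \<in> fst c'"
    and lim: "(p \<longlongrightarrow> x) G" "(v \<longlongrightarrow> v0) G"
  shows "((\<lambda>a. dloc c c' f (p a) (v a)) \<longlongrightarrow> dloc c c' f x v0) G"
proof -
  have df: "diff_map f" using C1_map_diff_map[OF f] .
  let ?U = "fst c \<inter> f -` fst c'"
  have U: "open ?U" using chart(1) c open_vimage_diff_map[OF df] by (intro open_Int) auto
  have ev: "\<forall>\<^sub>F a in G. p a \<in> ?U" using topological_tendstoD[OF lim(1) U] c by auto
  have rep: "dloc c c' f q u = (\<Sum>b\<in>Basis. (u \<bullet> b) *\<^sub>R dloc c c' f q b)" if "q \<in> ?U" for q u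
  proof -
    have lin: "linear (dloc c c' f q)" using that c by (intro linear_dloc df) auto
    have "dloc c c' f q u = dloc c c' f q (\<Sum>b\<in>Basis. (u \<bullet> b) *\<^sub>R b)" by (simp add: euclidean_representation)
    then show ?thesis by (simp add: linear_sum[OF lin] linear_cmul[OF lin])
  qed
  have "((\<lambda>a. dloc c c' f (p a) b) \<longlongrightarrow> dloc c c' f x b) G" for b
  proof -
    have "isCont (\<lambda>q. dloc c c' f q b) x"
      using continuous_on_dloc[OF f c(1,2)] U c(3,4) by (simp add: continuous_on_eq_continuous_at)
    then show ?thesis using lim(1) by (rule isCont_tendsto_compose)
  qed
  then have 1: "((\<lambda>a. \<Sum>b\<in>Basis. (v a \<bullet> b) *\<^sub>R dloc c c' f (p a) b) \<longlongrightarrow> (\<Sum>b\<in>Basis. (v0 \<bullet> b) *\<^sub>R dloc c c' f x b)) G"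
    using lim(2) by (intro tendsto_intros)
  have rep0: "dloc c c' f x v0 = (\<Sum>b\<in>Basis. (v0 \<bullet> b) *\<^sub>R dloc c c' f x b)" using rep[of x v0] c by blast
  have "\<forall>\<^sub>F a in G. (\<Sum>b\<in>Basis. (v a \<bullet> b) *\<^sub>R dloc c c' f (p a) b) = dloc c c' f (p a) (v a)"
    using ev by eventually_elim (rule rep[symmetric])
  then show ?thesis unfolding rep0 by (rule Lim_transform_eventually[OF 1])
qed

end

text \<open>
  Below, points of \<open>X\<close> are marked with the index of the chart in which they are read; since the
  \<open>K j\<close> are compact, so is the set of marked points.
\<close>

locale charted_hyperbolic_set = smooth_manifold \<A> + compact_metrized X d
  for \<A> :: "('m::t2_space, 'e::euclidean_space) chart set" and X :: "'m set" and d +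
  fixes g :: "'m \<Rightarrow> 'e \<Rightarrow> 'e \<Rightarrow> real" and f :: "'m \<Rightarrow> 'm"
    and N :: nat and ch :: "nat \<Rightarrow> ('m, 'e) chart" and K :: "nat \<Rightarrow> 'm set"
  assumes g: "riemannian_metric \<A> g" and diffeo: "C1_diffeo \<A> f" and hyp: "hyperbolic_set \<A> g f X"
    and ch: "\<And>j. j < N \<Longrightarrow> ch j \<in> \<A>" and K: "\<And>j. j < N \<Longrightarrow> compact (K j)" "\<And>j. j < N \<Longrightarrow> K j \<subseteq> fst (ch j)"
    and cover: "(\<Union>j<N. K j) = UNIV"
begin

definition marked :: "(nat \<times> 'm) set" where
  "marked = (\<Union>j<N. {j} \<times> (X \<inter> K j))"

definition ct :: "nat \<times> 'm \<Rightarrow> ('m, 'e) chart" where "ct s = ch (fst s)"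

text \<open>The derivative at the point of \<open>s\<close>, read from its own chart into the chart
  of \<open>t\<close>. Along a pseudo-orbit the point of \<open>t\<close> is only close to the
  image, so the target chart is not determined by \<open>s\<close>.\<close>

definition A :: "nat \<times> 'm \<Rightarrow> nat \<times> 'm \<Rightarrow> 'e \<Rightarrow> 'e" where
  "A s t = dloc (ct s) (ct t) f (snd s)"

lemma f: "C1_map \<A> f" "diff_map f" "diff_map (inv f)" "bij f" "continuous_on UNIV f"
  using diffeo C1_map_diff_map unfolding C1_diffeo_def C1_map_def by auto

lemma f_in: "x \<in> X \<Longrightarrow> f x \<in> X"
  using hyp by (auto simp: hyperbolic_set_def)

lemma markedD:
  assumes "s \<in> marked"
  shows "fst s < N" "snd s \<in> X" "snd s \<in> K (fst s)" "ct s \<in> \<A>" "snd s \<in> fst (ct s)"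
proof -
  obtain j x where s: "s = (j, x)" "j < N" "x \<in> X" "x \<in> K j" using assms unfolding marked_def by auto
  then show "fst s < N" "snd s \<in> X" "snd s \<in> K (fst s)" "ct s \<in> \<A>" "snd s \<in> fst (ct s)"
    using ch[of j] K(2)[of j] unfolding ct_def by auto
qed

lemma compact_marked: "compact marked"
  unfolding marked_def using K(1) compact_X
  by (intro compact_UN compact_Times compact_Int_closed compact_imp_closed) auto

lemma ex_mark: "x \<in> X \<Longrightarrow> \<exists>j. (j, x) \<in> marked"
  using cover unfolding marked_def by blast

text \<open>
  A limit of pseudo-orbits with almost invariant tangent vectors would be a bounded tangent orbit.
\<close>

lemma no_almost_tangent_orbits:
  "\<exists>k::nat. \<nexists>s v. (\<forall>i::int. s i \<in> marked \<and> norm (v i) \<le> 1 \<and> mdist d (f (snd (s i))) (snd (s (i + 1))) < 1 / Suc k \<and>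
      norm (v (i + 1) - A (s i) (s (i + 1)) (v i)) \<le> 1 / Suc k) \<and> norm (v 0) \<ge> 1 / 2"
proof (rule ccontr)
  assume "\<not> ?thesis"
  then have "\<forall>k::nat. \<exists>s v. (\<forall>i::int. s i \<in> marked \<and> norm (v i) \<le> 1 \<and> mdist d (f (snd (s i))) (snd (s (i + 1))) < 1 / Suc k \<and>
      norm (v (i + 1) - A (s i) (s (i + 1)) (v i)) \<le> 1 / Suc k) \<and> norm (v 0) \<ge> 1 / 2"
    by blast
  then obtain s v where sv: "\<forall>k. (\<forall>i::int. s k i \<in> marked \<and> norm (v k i) \<le> 1 \<and>
      mdist d (f (snd (s k i))) (snd (s k (i + 1))) < 1 / Suc k \<and>
      norm (v k (i + 1) - A (s k i) (s k (i + 1)) (v k i)) \<le> 1 / Suc k) \<and> norm (v k 0) \<ge> 1 / 2"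
    by metis
  define \<omega> where "\<omega> k i = (s k i, v k i)" for k i
  \<comment> \<open>Compact by Tychonoff's theorem, as the vectors are confined to the unit
    ball.\<close>
  define \<Omega> where "\<Omega> = {\<omega> :: int \<Rightarrow> (nat \<times> 'm) \<times> 'e. \<forall>i. \<omega> i \<in> marked \<times> cball 0 1}"
  have "compact \<Omega>" unfolding \<Omega>_def by (intro compact_sequences compact_Times compact_marked compact_cball)
  moreover have "\<omega> k \<in> \<Omega>" for k unfolding \<Omega>_def \<omega>_def using sv by simp
  ultimately obtain y G where y: "y \<in> \<Omega>" and G: "G \<noteq> bot" "G \<le> nhds y" "G \<le> filtermap \<omega> sequentially"
    using compact_cluster_sequence by metis
  define t u where "t i = fst (y i)" and "u i = snd (y i)" for i
  have t: "t i \<in> marked" and u: "norm (u i) \<le> 1" for i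
    using y unfolding \<Omega>_def t_def u_def by (auto simp: mem_Times_iff)
  have ev: "\<forall>\<^sub>F w in G. P w" if "\<forall>\<^sub>F k in sequentially. P (\<omega> k)" for P
    using that G(3) by (auto simp: le_filter_def eventually_filtermap)
  have lim: "((\<lambda>w. w i) \<longlongrightarrow> y i) G" for i
  proof (rule topological_tendstoI)
    fix U :: "((nat \<times> 'm) \<times> 'e) set" assume U: "open U" "y i \<in> U"
    have "open ((\<lambda>w::int \<Rightarrow> (nat \<times> 'm) \<times> 'e. w i) -` U)"
      using U(1) continuous_on_product_coordinates by (rule open_vimage)
    then have "\<forall>\<^sub>F w in nhds y. w i \<in> U" using U(2) by (auto simp: eventually_nhds)
    then show "\<forall>\<^sub>F w in G. w i \<in> U" using G(2) by (simp add: le_filter_def)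
  qed
  \<comment> \<open>Chart indices form a discrete space, so along \<open>G\<close> the charts are
    eventually those of the limit and derivatives can be compared in fixed coordinates.\<close>
  have lim_j: "\<forall>\<^sub>F w in G. fst (fst (w i)) = fst (t i)" for i
  proof -
    have "((\<lambda>w. fst (fst (w i))) \<longlongrightarrow> fst (t i)) G" unfolding t_def by (intro tendsto_fst lim)
    then show ?thesis by (rule tendsto_discrete[THEN iffD1])
  qed
  have lim_x: "((\<lambda>w. snd (fst (w i))) \<longlongrightarrow> snd (t i)) G" for i unfolding t_def by (intro tendsto_fst tendsto_snd lim)
  have lim_v: "((\<lambda>w. snd (w i)) \<longlongrightarrow> u i) G" for i unfolding u_def by (intro tendsto_snd lim)
  have in_X: "\<forall>\<^sub>F w in G. snd (fst (w i)) \<in> X" for i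
    using sv markedD(2) by (intro ev) (auto simp: \<omega>_def)
  have small: "\<forall>\<^sub>F k in sequentially. 1 / real (Suc k) < r" if "r > 0" for r
    using order_tendstoD(2)[OF LIMSEQ_inverse_real_of_nat that] by (simp add: inverse_eq_divide)
  have orbit: "f (snd (t i)) = snd (t (i + 1))" for i
  proof (rule ccontr)
    assume ne: "f (snd (t i)) \<noteq> snd (t (i + 1))"
    \<comment> \<open>Neighbourhoods at positive distance in \<open>X\<close> contradict jumps that
      tend to 0.\<close>
    obtain U V r where *: "open U" "f (snd (t i)) \<in> U" "open V" "snd (t (i + 1)) \<in> V" "r > 0"
      "\<forall>x\<in>U \<inter> X. \<forall>y\<in>V \<inter> X. mdist d x y \<ge> r"
      using separated_nhds[OF _ _ ne] f_in markedD(2)[OF t] by metis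
    have "((\<lambda>w. f (snd (fst (w i)))) \<longlongrightarrow> f (snd (t i))) G"
      using lim_x f(5) by (intro isCont_tendsto_compose[of _ f]) (simp_all add: continuous_on_eq_continuous_at)
    then have 1: "\<forall>\<^sub>F w in G. f (snd (fst (w i))) \<in> U" using *(1,2) by (rule topological_tendstoD)
    have 2: "\<forall>\<^sub>F w in G. snd (fst (w (i + 1))) \<in> V" using lim_x *(3,4) by (rule topological_tendstoD)
    have "\<forall>\<^sub>F k in sequentially. mdist d (f (snd (fst (\<omega> k i)))) (snd (fst (\<omega> k (i + 1)))) < r"
      using small[OF *(5)]
    proof eventually_elim
      case (elim k)
      then show ?case using sv less_trans by (fastforce simp: \<omega>_def)
    qed
    then have 3: "\<forall>\<^sub>F w in G. mdist d (f (snd (fst (w i)))) (snd (fst (w (i + 1)))) < r" by (rule ev)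
    have "\<forall>\<^sub>F w in G. False"
      using 1 2 3 in_X[of i] in_X[of "i + 1"]
    proof eventually_elim
      case (elim w)
      then show False using *(6) f_in by (meson IntI not_less)
    qed
    then show False using G(1) by (simp add: eventually_False)
  qed
  have tangent: "u (i + 1) = dloc (ct (t i)) (ct (t (i + 1))) f (snd (t i)) (u i)" for i
  proof -
    let ?c = "ct (t i)" and ?c' = "ct (t (i + 1))"
    have "f (snd (t i)) \<in> fst ?c'" unfolding orbit by (rule markedD(5)[OF t])
    then have "((\<lambda>w. snd (w (i + 1)) - dloc ?c ?c' f (snd (fst (w i))) (snd (w i)))
        \<longlongrightarrow> u (i + 1) - dloc ?c ?c' f (snd (t i)) (u i)) G"
      using markedD[OF t] by (intro tendsto_diff lim_v tendsto_dloc f lim_x) auto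
    moreover have "((\<lambda>w. snd (w (i + 1)) - dloc ?c ?c' f (snd (fst (w i))) (snd (w i))) \<longlongrightarrow> 0) G"
    proof (rule tendstoI)
      fix r :: real assume r: "r > 0"
      have "\<forall>\<^sub>F k in sequentially. norm (snd (\<omega> k (i + 1)) - A (fst (\<omega> k i)) (fst (\<omega> k (i + 1))) (snd (\<omega> k i))) < r"
        using small[OF r]
      proof eventually_elim
        case (elim k)
        then show ?case using sv le_less_trans by (fastforce simp: \<omega>_def)
      qed
      then have "\<forall>\<^sub>F w in G. norm (snd (w (i + 1)) - A (fst (w i)) (fst (w (i + 1))) (snd (w i))) < r" by (rule ev)
      then show "\<forall>\<^sub>F w in G. dist (snd (w (i + 1)) - dloc ?c ?c' f (snd (fst (w i))) (snd (w i))) 0 < r"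
        using lim_j[of i] lim_j[of "i + 1"]
        by eventually_elim (simp add: A_def ct_def)
    qed
    ultimately have "u (i + 1) - dloc ?c ?c' f (snd (t i)) (u i) = 0" by (rule tendsto_unique[OF G(1)])
    then show ?thesis by simp
  qed
  \<comment> \<open>Under the preferred identifications the limit is a genuine orbit of
    \<open>mderiv\<close>, and it is bounded because the metric is bounded on unit coordinate
    vectors over the finitely many compact pieces.\<close>
  define w where "w i = to_tangent \<A> (ct (t i)) (snd (t i)) (u i)" for i
  have "\<exists>C. \<forall>j<N. \<forall>p\<in>K j. \<forall>v. norm v \<le> 1 \<longrightarrow> g p (to_tangent \<A> (ch j) p v) (to_tangent \<A> (ch j) p v) \<le> C j"
    using riemannian_bound[OF g ch K] by metis
  then obtain C where C: "\<forall>j<N. \<forall>p\<in>K j. \<forall>v. norm v \<le> 1 \<longrightarrow> g p (to_tangent \<A> (ch j) p v) (to_tangent \<A> (ch j) p v) \<le> C j"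
    by blast
  define R where "R = Max (C ` {..<N})"
  have "w 0 = 0"
  proof (rule bounded_tangent_orbit_zero[OF g f(2,3,4) hyp, where y = "\<lambda>i. snd (t i)" and R = R])
    show "snd (t i) \<in> X" "f (snd (t i)) = snd (t (i + 1))" for i using markedD(2)[OF t] orbit by auto
    show "w (i + 1) = mderiv \<A> f (snd (t i)) (w i)" for i
      unfolding w_def tangent orbit[symmetric]
      using markedD[OF t] markedD(5)[OF t, of "i + 1"] by (intro to_tangent_dloc f) (auto simp: orbit)
    show "g (snd (t i)) (w i) (w i) \<le> R" for i
    proof -
      have "g (snd (t i)) (w i) (w i) \<le> C (fst (t i))"
        using C markedD[OF t] u unfolding w_def ct_def by blast
      also have "\<dots> \<le> R" unfolding R_def using markedD(1)[OF t] by (intro Max_ge) auto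
      finally show ?thesis .
    qed
  qed
  then have "u 0 = 0" using to_tangent_injective markedD[OF t] unfolding w_def by blast
  \<comment> \<open>The lower bound 1/2 passes to the limit and excludes the zero orbit.\<close>
  moreover have "norm (u 0) \<ge> 1 / 2"
  proof (rule tendsto_lowerbound[OF tendsto_norm[OF lim_v] _ G(1)])
    show "\<forall>\<^sub>F w in G. 1 / 2 \<le> norm (snd (w 0))" using sv by (intro ev) (simp add: \<omega>_def)
  qed
  ultimately show False by simp
qed

end

section \<open>Uniform linearization in charts\<close>

context smooth_manifold
begin

lemma chart_ball_nhd:
  assumes c: "c \<in> \<A>" "x \<in> fst c" and r: "r > 0"
  shows "\<exists>U. open U \<and> x \<in> U \<and> U \<subseteq> fst c \<and> snd c ` U \<subseteq> ball (snd c x) r"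
  using continuous_open_preimage[OF chart(3,1)[OF c(1)] open_ball, of "snd c x" r] c r
  by (intro exI[of _ "fst c \<inter> snd c -` ball (snd c x) r"]) auto

text \<open>The mean value inequality is applied to \<open>loc c c' f\<close> minus its derivative
  at \<open>x'\<close>. The comparison is with the derivative at the varying center
  \<open>x'\<close>, not at \<open>x\<close>, so that the estimate can be made uniform over a
  compact set of centers.\<close>

lemma local_linearization:
  assumes f: "C1_map \<A> f" and c: "c \<in> \<A>" "c' \<in> \<A>" "x \<in> fst c" "f x \<in> fst c'" and \<eta>: "\<eta> > 0"
  shows "\<exists>U \<rho>. open U \<and> x \<in> U \<and> \<rho> > 0 \<and> (\<forall>x'\<in>U. x' \<in> fst c \<and> f x' \<in> fst c' \<and>
    ball (snd c x') \<rho> \<subseteq> snd c ` (fst c \<inter> f -` fst c') \<and>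
    (\<forall>u\<in>ball (snd c x') \<rho>. \<forall>u'\<in>ball (snd c x') \<rho>.
        norm (loc c c' f u - loc c c' f u' - dloc c c' f x' (u - u')) \<le> \<eta> * norm (u - u')))"
proof -
  have df: "diff_map f" using C1_map_diff_map[OF f] .
  let ?W = "fst c \<inter> f -` fst c'" and ?F = "loc c c' f"
  let ?D = "\<lambda>u. frechet_derivative ?F (at u)"
  have W: "open ?W" using chart(1) c open_vimage_diff_map[OF df] by (intro open_Int) auto
  have oW: "open (snd c ` ?W)" by (intro open_chart_image c W) auto
  have p0: "snd c x \<in> snd c ` ?W" using c by auto
  have Ck: "Ck_on (Suc 0) ?F (snd c ` ?W)"
    using f c unfolding C1_map_def loc_def One_nat_def by blast
  have deriv: "(?F has_derivative ?D u) (at u)" if "u \<in> snd c ` ?W" for u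
  proof -
    have "\<forall>x\<in>snd c ` ?W. ?F differentiable (at x)" using Ck unfolding Ck_on.simps by (rule conjunct1)
    then show ?thesis using that frechet_derivative_works by blast
  qed
  \<comment> \<open>Two deviations from the derivative at \<open>x\<close> add up to
    \<open>\<eta> / DIM('e)\<close> on basis vectors, and passing to all vectors restores the factor
    \<open>DIM('e)\<close>.\<close>
  define e where "e = \<eta> / (2 * DIM('e))"
  have e: "e > 0" using \<eta> by (simp add: e_def)
  have ev: "\<forall>\<^sub>F u in nhds (snd c x). norm (?D u b - ?D (snd c x) b) < e" for b
  proof -
    have "continuous_on (snd c ` ?W) (\<lambda>u. ?D u b)" using Ck by simp
    then have "isCont (\<lambda>u. ?D u b) (snd c x)" using p0 unfolding continuous_on_eq_continuous_at[OF oW] by blast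
    then have "((\<lambda>u. ?D u b) \<longlongrightarrow> ?D (snd c x) b) (nhds (snd c x))"
      using tendsto_at_iff_tendsto_nhds[of "\<lambda>u. ?D u b" "snd c x"] by (simp add: continuous_at)
    from tendstoD[OF this e] show ?thesis by (simp only: dist_norm)
  qed
  have "\<forall>\<^sub>F u in nhds (snd c x). u \<in> snd c ` ?W \<and> (\<forall>b\<in>Basis. norm (?D u b - ?D (snd c x) b) < e)"
    using ev eventually_nhds_in_open[OF oW p0] by (intro eventually_conj eventually_ball_finite) auto
  then obtain r where r: "r > 0" "\<And>u. dist u (snd c x) < r \<Longrightarrow>
      u \<in> snd c ` ?W \<and> (\<forall>b\<in>Basis. norm (?D u b - ?D (snd c x) b) < e)"
    unfolding eventually_nhds_metric by blast
  define \<rho> where "\<rho> = r / 2"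
  have \<rho>: "\<rho> > 0" using r by (simp add: \<rho>_def)
  obtain U where U: "open U" "x \<in> U" "U \<subseteq> fst c" "snd c ` U \<subseteq> ball (snd c x) \<rho>"
    using chart_ball_nhd[OF c(1,3) \<rho>] by blast
  have "x' \<in> fst c \<and> f x' \<in> fst c' \<and> ball (snd c x') \<rho> \<subseteq> snd c ` ?W \<and>
    (\<forall>u\<in>ball (snd c x') \<rho>. \<forall>u'\<in>ball (snd c x') \<rho>.
        norm (?F u - ?F u' - dloc c c' f x' (u - u')) \<le> \<eta> * norm (u - u'))" if x': "x' \<in> U" for x'
  proof -
    have d: "dist (snd c x) (snd c x') < \<rho>" using U(4) x' by auto
    have near: "dist u (snd c x) < r" if "u \<in> ball (snd c x') \<rho>" for u
      using that d dist_triangle_less_add[of u "snd c x'" \<rho> "snd c x" \<rho>] by (simp add: \<rho>_def dist_commute)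
    have x'_fst: "x' \<in> fst c" using U(3) x' by blast
    have "snd c x' \<in> snd c ` ?W" using near[of "snd c x'"] r(2) \<rho> by auto
    then obtain z where z: "z \<in> ?W" "snd c x' = snd c z" by blast
    have "x' = z" using chart(5)[OF c(1) x'_fst] chart(5)[OF c(1), of z] z by simp
    then have fx': "f x' \<in> fst c'" using z by simp
    have sub: "ball (snd c x') \<rho> \<subseteq> snd c ` ?W" using near r(2) by blast
    have lin: "linear (?D u)" if "u \<in> snd c ` ?W" for u using deriv[OF that] by (rule has_derivative_linear)
    have lin': "linear (dloc c c' f x')" using x'_fst fx' c by (intro linear_dloc df)
    have main: "norm ((?F u - dloc c c' f x' u) - (?F u' - dloc c c' f x' u')) \<le> \<eta> * norm (u - u')"
      if uu': "u \<in> ball (snd c x') \<rho>" "u' \<in> ball (snd c x') \<rho>" for u u'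
    proof (rule differentiable_bound[OF convex_ball _ _ uu', where f' = "\<lambda>u w. ?D u w - dloc c c' f x' w"])
      fix w assume w: "w \<in> ball (snd c x') \<rho>"
      then have wW: "w \<in> snd c ` ?W" using sub by blast
      have dd: "(dloc c c' f x' has_derivative dloc c c' f x') (at w)"
        by (intro linear_imp_has_derivative lin')
      show "((\<lambda>u. ?F u - dloc c c' f x' u) has_derivative (\<lambda>v. ?D w v - dloc c c' f x' v)) (at w within ball (snd c x') \<rho>)"
        by (rule has_derivative_at_withinI[OF has_derivative_diff[OF deriv[OF wW] dd]])
      have "norm (?D w v - dloc c c' f x' v) \<le> \<eta> * norm v" for v
      proof -
        have "norm (?D w b - dloc c c' f x' b) \<le> \<eta> / DIM('e)" if "b \<in> Basis" for b
        proof -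
          have "norm (?D w b - ?D (snd c x) b) < e" "norm (?D (snd c x') b - ?D (snd c x) b) < e"
            using r(2)[OF near[OF w]] r(2)[OF near[of "snd c x'"]] that \<rho> by auto
          then have "norm ((?D w b - ?D (snd c x) b) - (?D (snd c x') b - ?D (snd c x) b)) < e + e"
            using norm_triangle_ineq4 by (smt (verit))
          then show ?thesis by (simp add: dloc_def e_def field_simps)
        qed
        from norm_linear_diff_bound[OF lin[OF wW] lin' this]
        have "norm (?D w v - dloc c c' f x' v) \<le> DIM('e) * (\<eta> / DIM('e)) * norm v" .
        then show ?thesis by simp
      qed
      then show "onorm (\<lambda>v. ?D w v - dloc c c' f x' v) \<le> \<eta>" by (rule onorm_le)
    qed
    have eq: "(?F u - dloc c c' f x' u) - (?F u' - dloc c c' f x' u') = ?F u - ?F u' - dloc c c' f x' (u - u')" for u u'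
      by (simp add: linear_diff[OF lin'])
    have "norm (?F u - ?F u' - dloc c c' f x' (u - u')) \<le> \<eta> * norm (u - u')"
      if "u \<in> ball (snd c x') \<rho>" "u' \<in> ball (snd c x') \<rho>" for u u'
      using main[OF that] by (simp only: eq)
    then show ?thesis using x'_fst fx' sub by blast
  qed
  then show ?thesis using U(1,2) \<rho> by blast
qed

end

context charted_hyperbolic_set
begin

definition pt :: "nat \<times> 'm \<Rightarrow> 'e" where "pt s = snd (ct s) (snd s)"

text \<open>An instance of \<open>near_diagonal\<close> on pairs of marked points. Chart indices are
  discrete, so the local hypothesis may fix them and only concerns points near \<open>x\<close> and
  \<open>f x\<close>.\<close>

lemma uniform_near_graph:
  assumes loc: "\<And>j j' x. (j, x) \<in> marked \<Longrightarrow> (j', f x) \<in> marked \<Longrightarrow>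
      \<exists>U V \<rho>. open U \<and> x \<in> U \<and> open V \<and> f x \<in> V \<and> \<rho> > 0 \<and> (\<forall>x'\<in>U. \<forall>y'\<in>V. P (j, x') (j', y') \<rho>)"
    and anti: "\<And>s t \<rho> \<rho>'. P s t \<rho> \<Longrightarrow> 0 < \<rho>' \<Longrightarrow> \<rho>' \<le> \<rho> \<Longrightarrow> P s t \<rho>'"
  shows "\<exists>\<rho>>0. \<forall>s\<in>marked. \<forall>t\<in>marked. mdist d (f (snd s)) (snd t) < \<rho> \<longrightarrow> P s t \<rho>"
proof -
  have "\<exists>\<rho>>0. \<forall>a\<in>marked \<times> marked. mdist d ((\<lambda>a. f (snd (fst a))) a) ((\<lambda>a. snd (snd a)) a) < \<rho> \<longrightarrow>
      (\<lambda>a. P (fst a) (snd a)) a \<rho>"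
  proof (rule near_diagonal)
    show "compact (marked \<times> marked)" by (intro compact_Times compact_marked)
    show "continuous_on (marked \<times> marked) (\<lambda>a. f (snd (fst a)))"
      by (intro continuous_on_compose2[OF f(5)] continuous_intros) auto
    show "continuous_on (marked \<times> marked) (\<lambda>a. snd (snd a))" by (intro continuous_intros)
    show "(\<lambda>a. f (snd (fst a))) ` (marked \<times> marked) \<subseteq> X" "(\<lambda>a. snd (snd a)) ` (marked \<times> marked) \<subseteq> X"
      using markedD(2) f_in by auto
    fix a assume a: "a \<in> marked \<times> marked" "f (snd (fst a)) = snd (snd a)"
    obtain j x j' where a': "a = ((j, x), (j', f x))" using a(2) by (metis prod.collapse)
    have m: "(j, x) \<in> marked" "(j', f x) \<in> marked" using a(1) a' by auto
    obtain U V \<rho> where U: "open U" "x \<in> U" "open V" "f x \<in> V" "\<rho> > 0"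
        "\<forall>x'\<in>U. \<forall>y'\<in>V. P (j, x') (j', y') \<rho>"
      using loc[OF m] by blast
    have "open (({j} \<times> U) \<times> ({j'} \<times> V))" using U by (intro open_Times discrete_topology_class.open_discrete)
    moreover have "a \<in> ({j} \<times> U) \<times> ({j'} \<times> V)" using U a' by simp
    moreover have "\<forall>t\<in>(({j} \<times> U) \<times> ({j'} \<times> V)) \<inter> marked \<times> marked. P (fst t) (snd t) \<rho>" using U(6) by auto
    ultimately show "\<exists>U \<rho>. open U \<and> a \<in> U \<and> 0 < \<rho> \<and> (\<forall>t\<in>U \<inter> marked \<times> marked. P (fst t) (snd t) \<rho>)"
      using U(5) by blast
  next
    fix a and \<rho> \<rho>' :: real
    assume "P (fst a) (snd a) \<rho>" "0 < \<rho>'" "\<rho>' \<le> \<rho>"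
    then show "P (fst a) (snd a) \<rho>'" by (rule anti)
  qed
  then show ?thesis by auto
qed

text \<open>Besides keeping the ball where \<open>f\<close> can be read in the two charts, this
  bounds the Lipschitz constant of the nonlinear part by \<eta>, as a contraction argument
  requires.\<close>

definition linearizes :: "nat \<times> 'm \<Rightarrow> nat \<times> 'm \<Rightarrow> real \<Rightarrow> real \<Rightarrow> bool" where
  "linearizes s t \<eta> \<rho> \<longleftrightarrow> f (snd s) \<in> fst (ct t) \<and>
    ball (pt s) \<rho> \<subseteq> snd (ct s) ` (fst (ct s) \<inter> f -` fst (ct t)) \<and>
    (\<forall>u\<in>ball (pt s) \<rho>. \<forall>u'\<in>ball (pt s) \<rho>.
      norm (loc (ct s) (ct t) f u - loc (ct s) (ct t) f u' - A s t (u - u')) \<le> \<eta> * norm (u - u'))"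

lemma linearizesD:
  assumes "linearizes s t \<eta> \<rho>"
  shows "f (snd s) \<in> fst (ct t)" "ball (pt s) \<rho> \<subseteq> snd (ct s) ` (fst (ct s) \<inter> f -` fst (ct t))"
    "\<And>u u'. u \<in> ball (pt s) \<rho> \<Longrightarrow> u' \<in> ball (pt s) \<rho> \<Longrightarrow>
      norm (loc (ct s) (ct t) f u - loc (ct s) (ct t) f u' - A s t (u - u')) \<le> \<eta> * norm (u - u')"
  using assms unfolding linearizes_def by blast+

lemma uniform_linearization:
  assumes \<eta>: "\<eta> > 0"
  shows "\<exists>\<rho>>0. \<forall>s\<in>marked. \<forall>t\<in>marked. mdist d (f (snd s)) (snd t) < \<rho> \<longrightarrow> linearizes s t \<eta> \<rho>"
proof (rule uniform_near_graph)
  fix j j' x assume m: "(j, x) \<in> marked" "(j', f x) \<in> marked"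
  have *: "ch j \<in> \<A>" "ch j' \<in> \<A>" "x \<in> fst (ch j)" "f x \<in> fst (ch j')"
    using markedD(4,5)[OF m(1)] markedD(4,5)[OF m(2)] by (auto simp: ct_def)
  obtain U \<rho> where U: "open U" "x \<in> U" "\<rho> > 0" "\<forall>x'\<in>U. x' \<in> fst (ch j) \<and> f x' \<in> fst (ch j') \<and>
    ball (snd (ch j) x') \<rho> \<subseteq> snd (ch j) ` (fst (ch j) \<inter> f -` fst (ch j')) \<and>
    (\<forall>u\<in>ball (snd (ch j) x') \<rho>. \<forall>u'\<in>ball (snd (ch j) x') \<rho>.
        norm (loc (ch j) (ch j') f u - loc (ch j) (ch j') f u' - dloc (ch j) (ch j') f x' (u - u')) \<le> \<eta> * norm (u - u'))"
    using local_linearization[OF f(1) * \<eta>] by blast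
  then have "\<forall>x'\<in>U. \<forall>y'\<in>UNIV. linearizes (j, x') (j', y') \<eta> \<rho>"
    by (simp add: linearizes_def ct_def pt_def A_def)
  then show "\<exists>U V \<rho>. open U \<and> x \<in> U \<and> open V \<and> f x \<in> V \<and> \<rho> > 0 \<and>
      (\<forall>x'\<in>U. \<forall>y'\<in>V. linearizes (j, x') (j', y') \<eta> \<rho>)"
    using U(1-3) by (intro exI[of _ U] exI[of _ UNIV] exI[of _ \<rho>]) simp
next
  fix s t and \<rho> \<rho>' :: real
  assume *: "linearizes s t \<eta> \<rho>" and le: "\<rho>' \<le> \<rho>"
  have "ball (pt s) \<rho>' \<subseteq> ball (pt s) \<rho>" using le by (rule subset_ball)
  then show "linearizes s t \<eta> \<rho>'" using * unfolding linearizes_def by blast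
qed

text \<open>The jump of a pseudo-orbit measured in coordinates; it is the inhomogeneous term of the
  shadowing equation.\<close>

lemma uniform_jump:
  assumes \<tau>: "\<tau> > 0"
  shows "\<exists>\<rho>>0. \<forall>s\<in>marked. \<forall>t\<in>marked. mdist d (f (snd s)) (snd t) < \<rho> \<longrightarrow>
    norm (snd (ct t) (f (snd s)) - pt t) < \<tau>"
proof (rule uniform_near_graph[where P = "\<lambda>s t \<rho>. norm (snd (ct t) (f (snd s)) - pt t) < \<tau>"])
  fix j j' x assume m: "(j, x) \<in> marked" "(j', f x) \<in> marked"
  have *: "ch j' \<in> \<A>" "f x \<in> fst (ch j')"
    using markedD(4,5)[OF m(2)] by (auto simp: ct_def)
  have "\<tau> / 2 > 0" using \<tau> by simp
  then obtain V where V: "open V" "f x \<in> V" "snd (ch j') ` V \<subseteq> ball (snd (ch j') (f x)) (\<tau> / 2)"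
    using chart_ball_nhd[OF *] by blast
  have "norm (snd (ch j') y - snd (ch j') y') < \<tau>" if "y \<in> V" "y' \<in> V" for y y'
  proof -
    have "dist (snd (ch j') (f x)) (snd (ch j') y) < \<tau> / 2" "dist (snd (ch j') (f x)) (snd (ch j') y') < \<tau> / 2"
      using V(3) that by auto
    then show ?thesis using dist_triangle_half_r[of "snd (ch j') (f x)" _ \<tau>] by (simp add: dist_norm)
  qed
  then show "\<exists>U V \<rho>. open U \<and> x \<in> U \<and> open V \<and> f x \<in> V \<and> (0::real) < \<rho> \<and> (\<forall>x'\<in>U. \<forall>y'\<in>V.
      norm (snd (ct (j', y')) (f (snd (j, x'))) - pt (j', y')) < \<tau>)"
    using V(1,2) open_vimage_diff_map[OF f(2) V(1)]
    by (intro exI[of _ "f -` V"] exI[of _ V] exI[of _ 1]) (simp add: ct_def pt_def)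
qed

text \<open>Translates closeness in coordinates back to the manifold. Membership in \<open>V\<close>
  feeds local maximality; a \<open>d\<close>-distance makes sense only once the point is known to
  lie in \<open>X\<close>, hence the conditional form.\<close>

lemma uniform_chart_closeness:
  assumes V: "open V" "X \<subseteq> V" and \<beta>: "\<beta> > 0"
  shows "\<exists>\<rho>>0. \<forall>s\<in>marked. \<forall>u\<in>ball (pt s) \<rho>. u \<in> snd (ct s) ` fst (ct s) \<longrightarrow>
    chart_inv (ct s) u \<in> V \<and> (chart_inv (ct s) u \<in> X \<longrightarrow> mdist d (chart_inv (ct s) u) (snd s) < \<beta>)"
proof (rule compact_uniform_radius[OF compact_marked])
  fix s assume s: "s \<in> marked"
  obtain j x where sjx: "s = (j, x)" by (cases s)
  have x: "x \<in> X" "ch j \<in> \<A>" "x \<in> fst (ch j)" using markedD[OF s] by (auto simp: sjx ct_def)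
  let ?c = "ch j"
  have "\<beta> / 2 > 0" using \<beta> by simp
  then obtain W where W: "open W" "x \<in> W" "\<And>y. y \<in> W \<Longrightarrow> y \<in> X \<Longrightarrow> mdist d x y < \<beta> / 2"
    using open_ball_nhd[OF x(1)] by blast
  have "open (snd ?c ` (fst ?c \<inter> (V \<inter> W)))"
    using V W chart(1)[OF x(2)] by (intro open_chart_image x) auto
  moreover have "snd ?c x \<in> snd ?c ` (fst ?c \<inter> (V \<inter> W))" using x V W by auto
  ultimately obtain r where r: "r > 0" "ball (snd ?c x) r \<subseteq> snd ?c ` (fst ?c \<inter> (V \<inter> W))"
    by (meson open_contains_ball)
  have "r / 2 > 0" using r by simp
  then obtain U where U: "open U" "x \<in> U" "snd ?c ` U \<subseteq> ball (snd ?c x) (r / 2)"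
    using chart_ball_nhd[OF x(2,3)] by blast
  have key: "chart_inv ?c u \<in> V \<and> chart_inv ?c u \<in> W" if "y \<in> U" "u \<in> ball (snd ?c y) (r / 2)" for y u
  proof -
    have "dist (snd ?c x) (snd ?c y) < r / 2" using U(3) that by auto
    moreover have "dist (snd ?c y) u < r / 2" using that by simp
    ultimately have "u \<in> ball (snd ?c x) r"
      using dist_triangle_less_add[of "snd ?c x" "snd ?c y" "r / 2" u "r / 2"] by (simp add: dist_commute)
    then obtain z where "u = snd ?c z" "z \<in> fst ?c" "z \<in> V" "z \<in> W" using r(2) by blast
    then show ?thesis using chart(5)[OF x(2)] by simp
  qed
  have "\<forall>t\<in>({j} \<times> (U \<inter> W)) \<inter> marked. \<forall>u\<in>ball (pt t) (r / 2). u \<in> snd (ct t) ` fst (ct t) \<longrightarrow>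
    chart_inv (ct t) u \<in> V \<and> (chart_inv (ct t) u \<in> X \<longrightarrow> mdist d (chart_inv (ct t) u) (snd t) < \<beta>)"
  proof (intro ballI impI conjI)
    fix t u assume t: "t \<in> ({j} \<times> (U \<inter> W)) \<inter> marked" and u: "u \<in> ball (pt t) (r / 2)"
    have ctt: "ct t = ?c" "snd t \<in> U" "snd t \<in> W" "snd t \<in> X" using t markedD(2)[of t] by (auto simp: ct_def)
    have kv: "chart_inv (ct t) u \<in> V" "chart_inv (ct t) u \<in> W" using key[OF ctt(2), of u] u ctt(1) by (auto simp: pt_def)
    then show "chart_inv (ct t) u \<in> V" by simp
    assume inX: "chart_inv (ct t) u \<in> X"
    show "mdist d (chart_inv (ct t) u) (snd t) < \<beta>"
      using W(3)[OF kv(2) inX] W(3)[OF ctt(3,4)] dist_triangle_d[OF inX x(1) ctt(4)] dist_commute_d[of x] by simp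
  qed
  moreover have "open ({j} \<times> (U \<inter> W))" using U W by (intro open_Times open_Int discrete_topology_class.open_discrete)
  ultimately show "\<exists>U \<rho>. open U \<and> s \<in> U \<and> 0 < \<rho> \<and> (\<forall>y\<in>U \<inter> marked. \<forall>u\<in>ball (pt y) \<rho>. u \<in> snd (ct y) ` fst (ct y) \<longrightarrow>
    chart_inv (ct y) u \<in> V \<and> (chart_inv (ct y) u \<in> X \<longrightarrow> mdist d (chart_inv (ct y) u) (snd y) < \<beta>))"
    using U W r(1) sjx by (intro exI[of _ "{j} \<times> (U \<inter> W)"] exI[of _ "r / 2"]) simp
qed auto

lemma linear_A:
  assumes "s \<in> marked" "t \<in> marked" "f (snd s) \<in> fst (ct t)"
  shows "linear (A s t)"
  unfolding A_def using markedD assms by (intro linear_dloc f) auto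

text \<open>By scaling: a counterexample, divided by its supremum \<open>M\<close> and shifted to an
  index where the norm exceeds \<open>M / 2\<close>, is an almost tangent orbit of the excluded
  kind. The constants hold for all bounded sequences and so involve no period.\<close>

lemma uniform_injectivity:
  "\<exists>\<alpha>>0. \<exists>c>0. \<forall>s v b. (\<forall>i::int. s i \<in> marked) \<and> (\<forall>i. mdist d (f (snd (s i))) (snd (s (i + 1))) < \<alpha>) \<and>
     bounded (range v) \<and> (\<forall>i. norm (v (i + 1) - A (s i) (s (i + 1)) (v i)) \<le> b) \<longrightarrow> (\<forall>i. c * norm (v i) \<le> b)"
proof -
  obtain k :: nat where k: "\<nexists>s v. (\<forall>i::int. s i \<in> marked \<and> norm (v i) \<le> 1 \<and> mdist d (f (snd (s i))) (snd (s (i + 1))) < 1 / Suc k \<and>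
      norm (v (i + 1) - A (s i) (s (i + 1)) (v i)) \<le> 1 / Suc k) \<and> norm (v 0) \<ge> 1 / 2"
    using no_almost_tangent_orbits by blast
  obtain \<rho> where \<rho>: "\<rho> > 0" "\<forall>s\<in>marked. \<forall>t\<in>marked. mdist d (f (snd s)) (snd t) < \<rho> \<longrightarrow> f (snd s) \<in> fst (ct t)"
    using uniform_linearization[of 1] linearizesD(1) by (metis zero_less_one)
  define c where "c = 1 / real (Suc k)"
  have c: "c > 0" by (simp add: c_def)
  define \<alpha> where "\<alpha> = min c \<rho>"
  have \<alpha>: "\<alpha> > 0" using c \<rho> by (simp add: \<alpha>_def)
  have "c * norm (v i0) \<le> b"
    if s: "\<forall>i::int. s i \<in> marked" and close: "\<forall>i. mdist d (f (snd (s i))) (snd (s (i + 1))) < \<alpha>"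
      and v: "bounded (range v)" and b: "\<forall>i. norm (v (i + 1) - A (s i) (s (i + 1)) (v i)) \<le> b" for s v b i0
  proof (rule ccontr)
    assume "\<not> ?thesis"
    then have big: "b < c * norm (v i0)" by simp
    have b0: "b \<ge> 0" using b norm_ge_zero order_trans by blast
    define M where "M = (SUP i. norm (v i))"
    have bdd: "bdd_above (range (\<lambda>i. norm (v i)))" using v unfolding bounded_iff by (auto intro: bdd_aboveI)
    have M: "norm (v i) \<le> M" for i unfolding M_def by (intro cSUP_upper bdd) auto
    have M0: "M > 0"
    proof -
      have "0 < c * norm (v i0)" using b0 big by linarith
      then have "norm (v i0) > 0" using c by (simp add: zero_less_mult_iff)
      then show ?thesis using M[of i0] by linarith
    qed
    have "\<exists>i1. M / 2 < norm (v i1)"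
    proof (rule ccontr)
      assume "\<not> ?thesis"
      then have "(SUP i. norm (v i)) \<le> M / 2" by (intro cSUP_least) (auto simp: not_less)
      then show False using M0 by (simp add: M_def)
    qed
    then obtain i1 where i1: "M / 2 < norm (v i1)" by blast
    define s' where "s' i = s (i + i1)" for i
    define v' where "v' i = (1 / M) *\<^sub>R v (i + i1)" for i
    have shift: "i + 1 + i1 = i + i1 + 1" for i by simp
    have "s' i \<in> marked \<and> norm (v' i) \<le> 1 \<and> mdist d (f (snd (s' i))) (snd (s' (i + 1))) < 1 / Suc k \<and>
      norm (v' (i + 1) - A (s' i) (s' (i + 1)) (v' i)) \<le> 1 / Suc k" for i
    proof (intro conjI)
      show "s' i \<in> marked" using s by (simp add: s'_def)
      show "norm (v' i) \<le> 1" using M[of "i + i1"] M0 by (simp add: v'_def)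
      have cl: "mdist d (f (snd (s (i + i1)))) (snd (s (i + i1 + 1))) < \<alpha>" using close by blast
      then show "mdist d (f (snd (s' i))) (snd (s' (i + 1))) < 1 / Suc k"
        by (simp only: s'_def shift) (simp add: \<alpha>_def c_def)
      have lin: "linear (A (s (i + i1)) (s (i + i1 + 1)))"
        using s cl \<rho>(2) by (intro linear_A) (auto simp: \<alpha>_def)
      have "v' (i + 1) - A (s' i) (s' (i + 1)) (v' i) = (1 / M) *\<^sub>R (v (i + i1 + 1) - A (s (i + i1)) (s (i + i1 + 1)) (v (i + i1)))"
        by (simp only: s'_def v'_def shift linear_cmul[OF lin] scaleR_diff_right)
      then have "norm (v' (i + 1) - A (s' i) (s' (i + 1)) (v' i)) = norm (v (i + i1 + 1) - A (s (i + i1)) (s (i + i1 + 1)) (v (i + i1))) / M"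
        using M0 by (simp add: divide_inverse mult.commute)
      also have "\<dots> \<le> b / M" using b M0 by (intro divide_right_mono) auto
      also have "\<dots> \<le> c * norm (v i0) / M" using big M0 by (intro divide_right_mono) auto
      also have "\<dots> \<le> c * M / M" using M[of i0] c M0 by (intro divide_right_mono mult_left_mono) auto
      also have "\<dots> = 1 / Suc k" using M0 by (simp add: c_def)
      finally show "norm (v' (i + 1) - A (s' i) (s' (i + 1)) (v' i)) \<le> 1 / Suc k" .
    qed
    moreover have "norm (v' 0) \<ge> 1 / 2" using i1 M0 by (simp add: v'_def field_simps)
    ultimately show False using k by blast
  qed
  then show ?thesis using \<alpha> c by (intro exI[of _ \<alpha>] conjI exI[of _ c]) blast+
qed

end

section \<open>Linear equations on periodic sequences\<close>

text \<open>A basis of \<open>V\<close> is mapped to an independent subset of \<open>V\<close> of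
  the same size, which must span \<open>V\<close>. The ambient space may be infinite-dimensional;
  \<open>B\<close> supplies the finiteness.\<close>

lemma linear_inj_subspace_surj:
  fixes L :: "'v::real_vector \<Rightarrow> 'v"
  assumes L: "linear L" and V: "subspace V" and B: "finite B" "V \<subseteq> span B"
    and LV: "L ` V \<subseteq> V" and inj: "inj_on L V"
  shows "L ` V = V"
proof -
  obtain B' where B': "B' \<subseteq> V" "independent B'" "V \<subseteq> span B'" using maximal_independent_subset[of V] by metis
  have span: "span B' = V" using B' V by (simp add: span_minimal subset_antisym)
  have fin: "finite B'" using independent_span_bound[OF B(1) B'(2)] B'(1) B(2) by blast
  have indep: "independent (L ` B')"
    using linear_independent_injective_image[OF L B'(2)] inj span by simp
  have card: "card (L ` B') = card B'"
    by (rule card_image[OF inj_on_subset[OF inj B'(1)]])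
  have "V \<subseteq> span (L ` B')"
  proof
    fix y assume y: "y \<in> V"
    show "y \<in> span (L ` B')"
    proof (rule ccontr)
      assume n: "y \<notin> span (L ` B')"
      then have "independent (insert y (L ` B'))" using indep by (rule independent_insertI)
      moreover have "insert y (L ` B') \<subseteq> span B'" using y B'(1) LV span by blast
      ultimately have "card (insert y (L ` B')) \<le> card B'" using independent_span_bound[OF fin] by blast
      moreover have "y \<notin> L ` B'" using n span_base[of y "L ` B'"] by blast
      ultimately show False using fin card by simp
    qed
  qed
  also have "span (L ` B') = L ` V" using linear_span_image[OF L] span by simp
  finally show ?thesis using LV by blast
qed

lemma apply_bcontfun_sum:
  "apply_bcontfun (\<Sum>a\<in>S. h a) i = (\<Sum>a\<in>S. apply_bcontfun (h a) i)"
  for h :: "'s \<Rightarrow> ('a::topological_space \<Rightarrow>\<^sub>C 'b::real_normed_vector)"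
  by (induction S rule: infinite_finite_induct) auto

lemma continuous_on_eval_bcontfun:
  "continuous_on UNIV (\<lambda>v :: 'a::topological_space \<Rightarrow>\<^sub>C 'b::real_normed_vector. apply_bcontfun v i)"
  unfolding continuous_on_iff
  by (metis dist_bounded le_less_trans)

text \<open>The topology of \<open>int\<close> is discrete, so every bounded sequence is a bounded
  continuous function and carries the supremum norm.\<close>

definition bounded_seq :: "(int \<Rightarrow> 'b::real_normed_vector) \<Rightarrow> int \<Rightarrow>\<^sub>C 'b" where
  "bounded_seq u = Bcontfun u"

lemma apply_bounded_seq: "bounded (range u) \<Longrightarrow> apply_bcontfun (bounded_seq u) i = u i"
  unfolding bounded_seq_def by (subst Bcontfun_inverse) (auto simp: bcontfun_def)

lemma periodic_mod:
  fixes u :: "int \<Rightarrow> 'b" and n :: nat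
  assumes "\<And>i. u (i + int n) = u i"
  shows "u (i mod int n) = u i"
proof -
  have pos: "u (i + int n * int k) = u i" for i k
  proof (induction k)
    case (Suc k)
    have "u (i + int n * int (Suc k)) = u ((i + int n * int k) + int n)" by (simp add: algebra_simps)
    then show ?case using assms Suc by simp
  qed simp
  have *: "u (i + int n * k) = u i" for i k
  proof (cases "k \<ge> 0")
    case True then show ?thesis using pos[of i "nat k"] by simp
  next
    case False then show ?thesis using pos[of "i + int n * k" "nat (- k)"] by simp
  qed
  have "u i = u (i mod int n + int n * (i div int n))" by simp
  then show ?thesis using *[of "i mod int n" "i div int n"] by simp
qed

lemma periodic_bounded:
  fixes u :: "int \<Rightarrow> 'b::real_normed_vector" and n :: nat
  assumes n: "n \<ge> 1" and u: "\<And>i. u (i + int n) = u i"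
  shows "bounded (range u)"
proof -
  have "range u \<subseteq> u ` {0..<int n}"
  proof (intro subsetI, elim rangeE)
    fix y i assume "y = u i"
    then have "y = u (i mod int n)" using periodic_mod[of u n, OF u] by simp
    then show "y \<in> u ` {0..<int n}" using n by (intro image_eqI) auto
  qed
  then show ?thesis by (meson finite_atLeastLessThan_int finite_imageI finite_imp_bounded finite_subset)
qed

definition periodic_seqs :: "nat \<Rightarrow> (int \<Rightarrow>\<^sub>C 'b::real_normed_vector) set" where
  "periodic_seqs n = {v. \<forall>i. apply_bcontfun v (i + int n) = apply_bcontfun v i}"

lemma subspace_periodic_seqs: "subspace (periodic_seqs n)"
  by (auto simp: subspace_def periodic_seqs_def)

lemma closed_periodic_seqs: "closed (periodic_seqs n)"
proof -
  have eq: "periodic_seqs n = (\<Inter>i. {v. apply_bcontfun v (i + int n) = apply_bcontfun v i})"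
    by (auto simp: periodic_seqs_def)
  show ?thesis
    unfolding eq by (intro closed_INT ballI closed_Collect_eq continuous_on_eval_bcontfun)
qed

text \<open>Spanned by the sequences that equal a basis vector on one residue class modulo
  \<open>n\<close> and vanish elsewhere.\<close>

lemma periodic_seqs_finite_span:
  assumes n: "n \<ge> 1"
  shows "\<exists>B :: (int \<Rightarrow>\<^sub>C 'b::euclidean_space) set. finite B \<and> periodic_seqs n \<subseteq> span B"
proof -
  define e :: "nat \<Rightarrow> 'b \<Rightarrow> int \<Rightarrow>\<^sub>C 'b" where
    "e k b = bounded_seq (\<lambda>i. if i mod int n = int k then b else 0)" for k b
  have e: "apply_bcontfun (e k b) i = (if i mod int n = int k then b else 0)" for k b i
    unfolding e_def by (intro apply_bounded_seq periodic_bounded[OF n]) simp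
  let ?B = "(\<lambda>(k, b). e k b) ` ({..<n} \<times> Basis)"
  have "v \<in> span ?B" if v: "v \<in> periodic_seqs n" for v
  proof -
    have vp: "apply_bcontfun v (i + int n) = apply_bcontfun v i" for i using v by (simp add: periodic_seqs_def)
    have "v = (\<Sum>k<n. \<Sum>b\<in>Basis. (apply_bcontfun v (int k) \<bullet> b) *\<^sub>R e k b)"
    proof (rule bcontfun_eqI)
      fix i :: int
      define k0 where "k0 = nat (i mod int n)"
      have "0 \<le> i mod int n" "i mod int n < int n" using n by simp_all
      then have k0: "k0 < n" "i mod int n = int k0" unfolding k0_def by linarith+
      have "apply_bcontfun (\<Sum>k<n. \<Sum>b\<in>Basis. (apply_bcontfun v (int k) \<bullet> b) *\<^sub>R e k b) i
          = (\<Sum>k<n. \<Sum>b\<in>Basis. (apply_bcontfun v (int k) \<bullet> b) *\<^sub>R (if k0 = k then b else 0))"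
        by (simp add: apply_bcontfun_sum e k0(2))
      also have "\<dots> = (\<Sum>k<n. if k0 = k then \<Sum>b\<in>Basis. (apply_bcontfun v (int k) \<bullet> b) *\<^sub>R b else 0)"
        by (intro sum.cong refl) simp
      also have "\<dots> = apply_bcontfun v (int k0)" using k0(1) by (simp add: sum.delta' euclidean_representation)
      also have "\<dots> = apply_bcontfun v i" using periodic_mod[of "apply_bcontfun v" n i, OF vp] k0 by simp
      finally show "apply_bcontfun v i = apply_bcontfun (\<Sum>k<n. \<Sum>b\<in>Basis. (apply_bcontfun v (int k) \<bullet> b) *\<^sub>R e k b) i" by simp
    qed
    also have "\<dots> \<in> span ?B" by (intro span_sum span_scale span_base) auto
    finally show ?thesis .
  qed
  then show ?thesis by (intro exI[of _ ?B]) auto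
qed

text \<open>
  On periodic sequences uniform injectivity already gives invertibility, by counting dimensions.
\<close>

lemma periodic_difference_equation:
  fixes A :: "int \<Rightarrow> 'b::euclidean_space \<Rightarrow> 'b"
  assumes n: "n \<ge> 1" and lin: "\<And>i. linear (A i)" and per: "\<And>i. A (i + int n) = A i" and c: "c > 0"
    and bound: "\<And>v b. bounded (range v) \<Longrightarrow> (\<And>i. norm (v i - A i (v (i - 1))) \<le> b) \<Longrightarrow> (\<And>i. c * norm (v i) \<le> b)"
  shows "\<exists>S. \<forall>w\<in>periodic_seqs n. S w \<in> periodic_seqs n \<and>
      (\<forall>i. apply_bcontfun (S w) i - A i (apply_bcontfun (S w) (i - 1)) = apply_bcontfun w i) \<and>
      c * norm (S w) \<le> norm w \<and> (\<forall>w'\<in>periodic_seqs n. c * norm (S w - S w') \<le> norm (w - w'))"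
proof -
  have "\<exists>M. \<forall>w. norm (A i w) \<le> M * norm w" for i
    using linear_bounded[OF lin[of i]] by blast
  then obtain M where M: "\<And>i w. norm (A i w) \<le> M i * norm w" by metis
  \<comment> \<open>By periodicity a bound over one period holds at every index, so \<open>L\<close>
    maps bounded sequences to bounded sequences.\<close>
  define M' where "M' = Max (M ` {0..<int n})"
  have M': "norm (A i w) \<le> M' * norm w" for i w
  proof -
    have "A i = A (i mod int n)" using periodic_mod[of A n i, OF per] by simp
    then have "norm (A i w) \<le> M (i mod int n) * norm w" using M by simp
    also have "\<dots> \<le> M' * norm w"
      unfolding M'_def using n by (intro mult_right_mono Max_ge) auto
    finally show ?thesis .
  qed
  define L where "L v = bounded_seq (\<lambda>i. apply_bcontfun v i - A i (apply_bcontfun v (i - 1)))" for v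
  have L: "apply_bcontfun (L v) i = apply_bcontfun v i - A i (apply_bcontfun v (i - 1))" for v i
  proof -
    have "norm (apply_bcontfun v i - A i (apply_bcontfun v (i - 1))) \<le> norm v + \<bar>M'\<bar> * norm v" for i
    proof -
      have "norm (A i (apply_bcontfun v (i - 1))) \<le> \<bar>M'\<bar> * norm v"
        using M'[of i "apply_bcontfun v (i - 1)"] norm_bounded[of v "i - 1"]
        by (intro order_trans[OF M' mult_mono]) auto
      then show ?thesis using norm_bounded[of v i] norm_triangle_ineq4 by (smt (verit))
    qed
    then have "bounded (range (\<lambda>i. apply_bcontfun v i - A i (apply_bcontfun v (i - 1))))"
      unfolding bounded_iff by blast
    then show ?thesis unfolding L_def by (rule apply_bounded_seq)
  qed
  have linL: "linear L"
    by (rule linearI; rule bcontfun_eqI) (simp_all add: L linear_add[OF lin] linear_cmul[OF lin] algebra_simps)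
  have LP: "L ` periodic_seqs n \<subseteq> periodic_seqs n"
  proof clarify
    fix v :: "int \<Rightarrow>\<^sub>C 'b" assume v: "v \<in> periodic_seqs n"
    have "apply_bcontfun v (i + int n - 1) = apply_bcontfun v (i - 1)" for i
    proof -
      have "apply_bcontfun v ((i - 1) + int n) = apply_bcontfun v (i - 1)"
        using v unfolding periodic_seqs_def by blast
      moreover have "(i - 1) + int n = i + int n - 1" by simp
      ultimately show ?thesis by simp
    qed
    then show "L v \<in> periodic_seqs n" using v by (simp add: periodic_seqs_def L per)
  qed
  \<comment> \<open>Besides injectivity, this gives the inverse on periodic sequences the norm bound
    \<open>1 / c\<close>, the same for every \<open>n\<close>.\<close>
  have lower: "c * norm v \<le> norm (L v)" for v
  proof -
    have "bounded (range (apply_bcontfun v))" using apply_bcontfun[of v] by (simp add: bcontfun_def)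
    moreover have "norm (apply_bcontfun v i - A i (apply_bcontfun v (i - 1))) \<le> norm (L v)" for i
      using norm_bounded[of "L v" i] by (simp add: L)
    ultimately have "c * norm (apply_bcontfun v i) \<le> norm (L v)" for i by (rule bound)
    then have "norm (apply_bcontfun v i) \<le> norm (L v) / c" for i using c by (simp add: pos_le_divide_eq mult.commute)
    then have "norm v \<le> norm (L v) / c" by (rule norm_bound)
    then show ?thesis using c by (simp add: pos_le_divide_eq mult.commute)
  qed
  have "inj_on L (periodic_seqs n)"
  proof (rule inj_onI)
    fix v w assume "L v = L w"
    then have "c * norm (v - w) \<le> 0" using lower[of "v - w"] linear_diff[OF linL, of v w] by simp
    then show "v = w" using c by (simp add: mult_le_0_iff)
  qed
  moreover obtain B :: "(int \<Rightarrow>\<^sub>C 'b) set" where "finite B" "periodic_seqs n \<subseteq> span B"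
    using periodic_seqs_finite_span[OF n] by blast
  ultimately have surj: "L ` periodic_seqs n = periodic_seqs n"
    using linear_inj_subspace_surj[OF linL subspace_periodic_seqs _ _ LP] by blast
  define S where "S = inv_into (periodic_seqs n) L"
  have S: "S w \<in> periodic_seqs n" "L (S w) = w" if "w \<in> periodic_seqs n" for w
    unfolding S_def using surj that by (auto intro: inv_into_into f_inv_into_f)
  show ?thesis
  proof (intro exI[of _ S] ballI conjI allI)
    fix w :: "int \<Rightarrow>\<^sub>C 'b" assume w: "w \<in> periodic_seqs n"
    show "S w \<in> periodic_seqs n" by (rule S(1)[OF w])
    show "apply_bcontfun (S w) i - A i (apply_bcontfun (S w) (i - 1)) = apply_bcontfun w i" for i
      using L[of "S w" i] S(2)[OF w] by simp
    show "c * norm (S w) \<le> norm w" using lower[of "S w"] S(2)[OF w] by simp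
    fix w' :: "int \<Rightarrow>\<^sub>C 'b" assume w': "w' \<in> periodic_seqs n"
    show "c * norm (S w - S w') \<le> norm (w - w')"
      using lower[of "S w - S w'"] S(2)[OF w] S(2)[OF w'] linear_diff[OF linL] by simp
  qed
qed

text \<open>In the library \<open>bcontfun\<close> is only complete over a metric domain, and \<open>int\<close> is not one.\<close>

lemma complete_closed_bcontfun:
  fixes S :: "('a::topological_space \<Rightarrow>\<^sub>C 'b::complete_space) set"
  assumes S: "closed S"
  shows "uniform_space_class.complete S"
proof (rule completeI)
  fix h assume h: "\<forall>n. h n \<in> S" "Cauchy h"
  have "uniformly_Cauchy_on UNIV (\<lambda>n. apply_bcontfun (h n))"
    unfolding uniformly_Cauchy_on_def
  proof (intro allI impI)
    fix e :: real assume "e > 0"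
    then obtain M where "\<forall>m\<ge>M. \<forall>n\<ge>M. dist (h m) (h n) < e" using h(2) unfolding Cauchy_def by blast
    then show "\<exists>M. \<forall>x\<in>UNIV. \<forall>m\<ge>M. \<forall>n\<ge>M. dist (apply_bcontfun (h m) x) (apply_bcontfun (h n) x) < e"
      using le_less_trans[OF dist_bounded] by blast
  qed
  then obtain u where "uniform_limit UNIV (\<lambda>n. apply_bcontfun (h n)) u sequentially"
    using Cauchy_uniformly_convergent unfolding uniformly_convergent_on_def by blast
  then obtain l where "h \<longlonglongrightarrow> l" using uniform_limit_bcontfunE[OF _ sequentially_bot] by blast
  then show "\<exists>l\<in>S. h \<longlonglongrightarrow> l" using closed_sequentially[OF S] h(1) by blast
qed

section \<open>The shadowing orbit as a fixed point\<close>

context charted_hyperbolic_set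
begin

text \<open>The orbit is sought in charts as \<open>pt (s i) + v i\<close>, which is the equation
  \<open>v i - A' i (v (i - 1)) = R v i\<close> with \<open>R v\<close> the jump plus the nonlinear
  part. The solution operator \<open>S\<close> has Lipschitz constant \<open>1 / c\<close> and
  \<open>R\<close> has \<open>c / 2\<close>, so \<open>H\<close> contracts by 1/2; together with
  \<open>norm (R 0) \<le> c / 2 * r\<close> this keeps the ball of radius \<open>r\<close>
  invariant. None of \<alpha>, \<open>c\<close> and \<open>r\<close> involves
  \<open>n\<close>.\<close>

lemma periodic_shadowing_f:
  assumes max: "locally_maximal f X"
  shows "periodic_shadowing X f d"
  unfolding periodic_shadowing_def
proof (intro allI impI)
  fix \<beta> :: real assume \<beta>: "\<beta> > 0"
  obtain V where V: "open V" "X \<subseteq> V" and XV: "X = {x. \<forall>n. (f ^^ n) x \<in> V \<and> (inv f ^^ n) x \<in> V}"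
    using max unfolding locally_maximal_def by (elim exE conjE)
  obtain \<alpha>1 c where c: "\<alpha>1 > 0" "c > 0" and inj: "\<forall>s v b. (\<forall>i::int. s i \<in> marked) \<and>
      (\<forall>i. mdist d (f (snd (s i))) (snd (s (i + 1))) < \<alpha>1) \<and> bounded (range v) \<and>
      (\<forall>i. norm (v (i + 1) - A (s i) (s (i + 1)) (v i)) \<le> b) \<longrightarrow> (\<forall>i. c * norm (v i) \<le> b)"
    using uniform_injectivity by (elim exE conjE)
  have "c / 2 > 0" using c by simp
  from uniform_linearization[OF this] obtain \<rho>1 where \<rho>1: "\<rho>1 > 0"
    and lin: "\<forall>s\<in>marked. \<forall>t\<in>marked. mdist d (f (snd s)) (snd t) < \<rho>1 \<longrightarrow> linearizes s t (c / 2) \<rho>1"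
    by (elim exE conjE)
  from uniform_chart_closeness[OF V \<beta>] obtain \<rho>2 where \<rho>2: "\<rho>2 > 0"
    and close: "\<forall>s\<in>marked. \<forall>u\<in>ball (pt s) \<rho>2. u \<in> snd (ct s) ` fst (ct s) \<longrightarrow>
      chart_inv (ct s) u \<in> V \<and> (chart_inv (ct s) u \<in> X \<longrightarrow> mdist d (chart_inv (ct s) u) (snd s) < \<beta>)"
    by (elim exE conjE)
  \<comment> \<open>Half, so that closed balls of radius \<open>r\<close> lie inside the open balls
    of both estimates.\<close>
  define r where "r = min \<rho>1 \<rho>2 / 2"
  have r: "r > 0" "r < \<rho>1" "r < \<rho>2" using \<rho>1 \<rho>2 by (auto simp: r_def)
  have "c / 2 * r > 0" using c r by simp
  from uniform_jump[OF this] obtain \<rho>3 where \<rho>3: "\<rho>3 > 0"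
    and jump: "\<forall>s\<in>marked. \<forall>t\<in>marked. mdist d (f (snd s)) (snd t) < \<rho>3 \<longrightarrow>
      norm (snd (ct t) (f (snd s)) - pt t) < c / 2 * r"
    by (elim exE conjE)
  define \<alpha> where "\<alpha> = min \<alpha>1 (min \<rho>1 \<rho>3)"
  have \<alpha>: "\<alpha> > 0" using c \<rho>1 \<rho>3 by (simp add: \<alpha>_def)
  have "\<exists>z\<in>X. (f ^^ n) z = z \<and> (\<forall>i<n. mdist d ((f ^^ i) z) (x i) < \<beta>)"
    if n: "n \<ge> 1" and x: "\<forall>i<n. x i \<in> X \<and> mdist d (f (x i)) (x (Suc i mod n)) < \<alpha>" for n :: nat and x :: "nat \<Rightarrow> 'm"
  proof -
    \<comment> \<open>Extends the pseudo-orbit to all integers with period \<open>n\<close>.\<close>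
    define idx where "idx i = nat (i mod int n)" for i
    have idx: "idx i < n" "idx (i + int n) = idx i" "idx (i + 1) = Suc (idx i) mod n" for i
    proof -
      have "0 \<le> i mod int n" "i mod int n < int n" using n by simp_all
      then show "idx i < n" unfolding idx_def by linarith
      show "idx (i + int n) = idx i" by (simp add: idx_def)
      have "int (Suc (idx i) mod n) = (i mod int n + 1) mod int n" using n by (simp add: idx_def zmod_int add.commute)
      also have "\<dots> = (i + 1) mod int n" by (simp add: mod_add_left_eq)
      finally show "idx (i + 1) = Suc (idx i) mod n" unfolding idx_def[of "i + 1"] by simp
    qed
    define mark where "mark y = (SOME j. (j, y) \<in> marked)" for y
    define s where "s i = (mark (x (idx i)), x (idx i))" for i
    have s: "s i \<in> marked" for i
      using ex_mark[of "x (idx i)"] x idx(1)[of i] unfolding s_def mark_def by (auto intro: someI_ex)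
    have s_per: "s (i + int n) = s i" for i by (simp add: s_def idx)
    have s_close: "mdist d (f (snd (s i))) (snd (s (i + 1))) < \<alpha>" for i
      using x idx(1)[of i] by (simp add: s_def idx(3))
    have s_close': "mdist d (f (snd (s (i - 1)))) (snd (s i)) < \<alpha>" for i using s_close[of "i - 1"] by simp
    have "linearizes (s (i - 1)) (s i) (c / 2) \<rho>1" for i
      using lin s s_close'[of i] by (simp add: \<alpha>_def)
    note lin' = linearizesD[OF this]
    define A' where "A' i = A (s (i - 1)) (s i)" for i
    define F where "F i = loc (ct (s (i - 1))) (ct (s i)) f" for i
    have s_per': "s (i + int n - 1) = s (i - 1)" for i
    proof -
      have eq: "i + int n - 1 = (i - 1) + int n" by simp
      show ?thesis unfolding eq by (rule s_per)
    qed
    have linA: "linear (A' i)" for i unfolding A'_def by (intro linear_A s lin'(1))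
    have perA: "A' (i + int n) = A' i" and perF: "F (i + int n) = F i" for i
      by (simp_all add: A'_def F_def s_per s_per')
    have bnd: "c * norm (v i) \<le> b"
      if "bounded (range v)" "\<And>i. norm (v i - A' i (v (i - 1))) \<le> b" for v b i
    proof -
      have "norm (v (i + 1) - A (s i) (s (i + 1)) (v i)) \<le> b" for i
        using that(2)[of "i + 1"] by (simp add: A'_def)
      moreover have "mdist d (f (snd (s i))) (snd (s (i + 1))) < \<alpha>1" for i using s_close[of i] by (simp add: \<alpha>_def)
      ultimately show ?thesis using inj[THEN spec, THEN spec, THEN spec, THEN mp, THEN spec, of s v b i] s that(1) by blast
    qed
    have "\<exists>S. \<forall>w\<in>periodic_seqs n. S w \<in> periodic_seqs n \<and>
      (\<forall>i. apply_bcontfun (S w) i - A' i (apply_bcontfun (S w) (i - 1)) = apply_bcontfun w i) \<and>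
      c * norm (S w) \<le> norm w \<and> (\<forall>w'\<in>periodic_seqs n. c * norm (S w - S w') \<le> norm (w - w'))"
    proof (rule periodic_difference_equation[where A = A', OF n linA perA c(2)])
      fix v :: "int \<Rightarrow> 'e" and b i
      assume "bounded (range v)" "\<And>i. norm (v i - A' i (v (i - 1))) \<le> b"
      then show "c * norm (v i) \<le> b" by (rule bnd[of v b i])
    qed
    then obtain S where S: "\<forall>w\<in>periodic_seqs n. S w \<in> periodic_seqs n \<and>
      (\<forall>i. apply_bcontfun (S w) i - A' i (apply_bcontfun (S w) (i - 1)) = apply_bcontfun w i) \<and>
      c * norm (S w) \<le> norm w \<and> (\<forall>w'\<in>periodic_seqs n. c * norm (S w - S w') \<le> norm (w - w'))"
      by (elim exE)
    define Q :: "(int \<Rightarrow>\<^sub>C 'e) set" where "Q = periodic_seqs n \<inter> cball 0 r"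
    \<comment> \<open>For periodic \<open>v\<close> outside \<open>Q\<close> the chart may be
      evaluated off its domain, but the values are still periodic and therefore bounded.\<close>
    define R where "R v = bounded_seq (\<lambda>i. F i (pt (s (i - 1)) + apply_bcontfun v (i - 1)) - pt (s i)
        - A' i (apply_bcontfun v (i - 1)))" for v
    have R_per: "F (i + int n) (pt (s (i + int n - 1)) + apply_bcontfun v (i + int n - 1)) - pt (s (i + int n))
        - A' (i + int n) (apply_bcontfun v (i + int n - 1))
        = F i (pt (s (i - 1)) + apply_bcontfun v (i - 1)) - pt (s i) - A' i (apply_bcontfun v (i - 1))"
      if v: "v \<in> periodic_seqs n" for v i
    proof -
      have eq: "i + int n - 1 = (i - 1) + int n" by simp
      have "apply_bcontfun v (i + int n - 1) = apply_bcontfun v (i - 1)"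
        unfolding eq using v unfolding periodic_seqs_def by blast
      then show ?thesis by (simp only: s_per s_per' perA perF)
    qed
    have R: "apply_bcontfun (R v) i = F i (pt (s (i - 1)) + apply_bcontfun v (i - 1)) - pt (s i)
        - A' i (apply_bcontfun v (i - 1))" if "v \<in> periodic_seqs n" for v i
      unfolding R_def by (intro apply_bounded_seq periodic_bounded[OF n] R_per that)
    have R_in: "R v \<in> periodic_seqs n" if v: "v \<in> periodic_seqs n" for v
      unfolding periodic_seqs_def mem_Collect_eq R[OF v] using R_per[OF v] by blast
    have in_ball: "pt (s i) + apply_bcontfun v i \<in> ball (pt (s i)) \<rho>1" "pt (s i) + apply_bcontfun v i \<in> ball (pt (s i)) \<rho>2"
      if "v \<in> Q" for v i
      using norm_bounded[of v i] that r unfolding Q_def by (auto simp: dist_norm)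
    have R_diff: "norm (R v - R v') \<le> c / 2 * norm (v - v')" if v: "v \<in> Q" "v' \<in> Q" for v v'
    proof (rule norm_bound)
      fix i
      have P: "v \<in> periodic_seqs n" "v' \<in> periodic_seqs n" using v by (auto simp: Q_def)
      let ?w = "apply_bcontfun v (i - 1)" and ?w' = "apply_bcontfun v' (i - 1)"
      have "apply_bcontfun (R v - R v') i
          = F i (pt (s (i - 1)) + ?w) - F i (pt (s (i - 1)) + ?w') - A' i ((pt (s (i - 1)) + ?w) - (pt (s (i - 1)) + ?w'))"
        by (simp add: R[OF P(1)] R[OF P(2)] linear_diff[OF linA])
      also have "norm \<dots> \<le> c / 2 * norm ((pt (s (i - 1)) + ?w) - (pt (s (i - 1)) + ?w'))"
        unfolding F_def A'_def by (intro lin'(3) in_ball v)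
      also have "\<dots> \<le> c / 2 * norm (v - v')"
        using norm_bounded[of "v - v'" "i - 1"] c by (intro mult_left_mono) auto
      finally show "norm (apply_bcontfun (R v - R v') i) \<le> c / 2 * norm (v - v')" .
    qed
    have zero_Q: "0 \<in> Q" using r subspace_0[OF subspace_periodic_seqs] by (simp add: Q_def)
    have R_zero: "norm (R 0) \<le> c / 2 * r"
    proof (rule norm_bound)
      fix i
      have "F i (pt (s (i - 1))) = snd (ct (s i)) (f (snd (s (i - 1))))"
        unfolding F_def loc_def pt_def comp_apply using chart(5)[OF markedD(4,5)[OF s]] by simp
      moreover have "norm (snd (ct (s i)) (f (snd (s (i - 1)))) - pt (s i)) < c / 2 * r"
        using jump s s_close'[of i] by (auto simp: \<alpha>_def)
      ultimately show "norm (apply_bcontfun (R 0) i) \<le> c / 2 * r"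
        using zero_Q linear_0[OF linA] by (simp add: R Q_def)
    qed
    define H where "H v = S (R v)" for v
    have "\<exists>!v\<in>Q. H v = v"
    proof (rule Banach_fix[OF complete_closed_bcontfun])
      show "closed Q" unfolding Q_def by (intro closed_Int closed_periodic_seqs closed_cball)
      show "Q \<noteq> {}" using zero_Q by blast
      show "(0::real) \<le> 1 / 2" "1 / 2 < (1::real)" by simp_all
      show "H ` Q \<subseteq> Q"
      proof clarify
        fix v assume v: "v \<in> Q"
        have "norm (R v) \<le> norm (R v - R 0) + norm (R 0)" using norm_triangle_ineq[of "R v - R 0" "R 0"] by simp
        also have "\<dots> \<le> c / 2 * norm v + c / 2 * r" using R_diff[OF v zero_Q] R_zero by simp
        also have "\<dots> \<le> c / 2 * r + c / 2 * r" using v c by (intro add_mono mult_left_mono) (auto simp: Q_def)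
        finally have "norm (R v) \<le> c * r" by simp
        moreover have RP: "R v \<in> periodic_seqs n" using R_in v by (simp add: Q_def)
        ultimately have "c * norm (S (R v)) \<le> c * r" using S by (meson order_trans)
        then have "norm (S (R v)) \<le> r" using c by simp
        then show "H v \<in> Q" using S RP by (simp add: Q_def H_def)
      qed
      fix v v' assume v: "v \<in> Q" "v' \<in> Q"
      have "R v \<in> periodic_seqs n" "R v' \<in> periodic_seqs n" using v R_in by (auto simp: Q_def)
      then have "c * norm (S (R v) - S (R v')) \<le> norm (R v - R v')" using S by blast
      also have "\<dots> \<le> c * (1 / 2 * norm (v - v'))" using R_diff[OF v] by simp
      finally show "dist (H v) (H v') \<le> 1 / 2 * dist v v'"
        using c unfolding dist_norm H_def by (simp only: mult_le_cancel_left_pos)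
    qed
    then obtain v where v: "v \<in> Q" "S (R v) = v" unfolding H_def by blast
    have vP: "v \<in> periodic_seqs n" using v by (simp add: Q_def)
    \<comment> \<open>At the fixed point the linear terms cancel, and the coordinates follow
      \<open>f\<close> exactly.\<close>
    have eq: "pt (s i) + apply_bcontfun v i = F i (pt (s (i - 1)) + apply_bcontfun v (i - 1))" for i
    proof -
      have "apply_bcontfun v i - A' i (apply_bcontfun v (i - 1)) = apply_bcontfun (R v) i"
        using S R_in[OF vP] v(2) by metis
      then show ?thesis unfolding R[OF vP] by (simp add: algebra_simps)
    qed
    define z where "z i = chart_inv (ct (s i)) (pt (s i) + apply_bcontfun v i)" for i
    have z_step: "f (z (i - 1)) = z i" for i
    proof -
      have "pt (s (i - 1)) + apply_bcontfun v (i - 1) \<in> snd (ct (s (i - 1))) ` (fst (ct (s (i - 1))) \<inter> f -` fst (ct (s i)))"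
        using in_ball(1)[OF v(1), of "i - 1"] lin'(2)[of i] by blast
      then have "f (z (i - 1)) \<in> fst (ct (s i))"
        unfolding z_def using chart(5)[OF markedD(4)[OF s]] by auto
      then have "f (z (i - 1)) = chart_inv (ct (s i)) (snd (ct (s i)) (f (z (i - 1))))"
        using chart(5)[OF markedD(4)[OF s]] by simp
      also have "snd (ct (s i)) (f (z (i - 1))) = F i (pt (s (i - 1)) + apply_bcontfun v (i - 1))"
        by (simp add: F_def loc_def z_def)
      finally show ?thesis unfolding z_def[of i] eq[of i] .
    qed
    have z_next: "f (z i) = z (i + 1)" for i using z_step[of "i + 1"] by simp
    have z_prev: "inv f (z i) = z (i - 1)" for i using z_step[of i] f(4) by (metis bij_inv_eq_iff)
    have img: "pt (s i) + apply_bcontfun v i \<in> snd (ct (s i)) ` fst (ct (s i))" for i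
      using in_ball(1)[OF v(1), of i] lin'(2)[of "i + 1"] by auto
    have zV: "z i \<in> V" and z_close: "z i \<in> X \<Longrightarrow> mdist d (z i) (snd (s i)) < \<beta>" for i
      using close s in_ball(2)[OF v(1), of i] img[of i] unfolding z_def by blast+
    have iter: "(f ^^ k) (z i) = z (i + int k)" "(inv f ^^ k) (z i) = z (i - int k)" for k i
      by (induction k) (simp_all add: z_next z_prev algebra_simps)
    \<comment> \<open>The whole two-sided orbit stays in \<open>V\<close>, so local maximality
      places it in \<open>X\<close>.\<close>
    have zX: "z i \<in> X" for i
    proof -
      have "\<forall>k. (f ^^ k) (z i) \<in> V \<and> (inv f ^^ k) (z i) \<in> V" unfolding iter using zV by blast
      then show ?thesis by (subst XV) (rule CollectI)
    qed
    have "z (0 + int n) = z 0"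
    proof -
      have "apply_bcontfun v (0 + int n) = apply_bcontfun v 0" using vP unfolding periodic_seqs_def by blast
      then show ?thesis unfolding z_def s_per by (simp only:)
    qed
    then have "(f ^^ n) (z 0) = z 0" unfolding iter .
    moreover have "mdist d ((f ^^ i) (z 0)) (x i) < \<beta>" if "i < n" for i
    proof -
      have "snd (s (int i)) = x i" using that by (simp add: s_def idx_def)
      then show ?thesis using z_close[OF zX, of "int i"] by (simp add: iter)
    qed
    ultimately show ?thesis using zX by blast
  qed
  then show "\<exists>\<alpha>>0. \<forall>n\<ge>1. \<forall>x. (\<forall>i<n. x i \<in> X \<and> mdist d (f (x i)) (x (Suc i mod n)) < \<alpha>) \<longrightarrow>
        (\<exists>z\<in>X. (f ^^ n) z = z \<and> (\<forall>i<n. mdist d ((f ^^ i) z) (x i) < \<beta>))"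
    using \<alpha> by (intro exI[of _ \<alpha>]) blast
qed

end

section \<open>The theorem\<close>

text \<open>\<open>T\<close> and \<open>f\<close> agree on the invariant set \<open>X\<close>, so
  they have the same orbits and pseudo-orbits there.\<close>

lemma axiom_A_periodic_shadowing:
  assumes sys: "C1_axiom_A_system \<A> g f X T" and met: "compact_metrized X d"
  shows "periodic_shadowing X T d"
proof -
  have A: "compact_smooth_manifold \<A>" "riemannian_metric \<A> g" "C1_diffeo \<A> f" "hyperbolic_set \<A> g f X"
    "locally_maximal f X" and Tf: "\<And>x. x \<in> X \<Longrightarrow> T x = f x"
    using sys unfolding C1_axiom_A_system_def basic_set_def by auto
  interpret smooth_manifold \<A> by standard (rule A(1))
  obtain N :: nat and ch K where C: "\<forall>j<N. ch j \<in> \<A> \<and> compact (K j) \<and> K j \<subseteq> fst (ch j)" "(\<Union>j<N. K j) = UNIV"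
    using finite_compact_chart_cover by (elim exE conjE)
  interpret charted_hyperbolic_set \<A> X d g f N ch K
    using A C met by (intro charted_hyperbolic_set.intro charted_hyperbolic_set_axioms.intro smooth_manifold_axioms) auto
  have iter: "(T ^^ i) z = (f ^^ i) z" if "z \<in> X" for z i
  proof -
    have "(f ^^ i) z \<in> X \<and> (T ^^ i) z = (f ^^ i) z" using that f_in Tf by (induction i) auto
    then show ?thesis by blast
  qed
  have step: "(\<forall>i<n. x i \<in> X \<and> mdist d (T (x i)) (x (Suc i mod n)) < \<alpha>) \<longleftrightarrow>
      (\<forall>i<n. x i \<in> X \<and> mdist d (f (x i)) (x (Suc i mod n)) < \<alpha>)" for n \<alpha> and x :: "nat \<Rightarrow> 'a"
    using Tf by auto
  have orbit: "(\<exists>z\<in>X. (T ^^ n) z = z \<and> (\<forall>i<n. mdist d ((T ^^ i) z) (x i) < \<beta>)) \<longleftrightarrow>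
      (\<exists>z\<in>X. (f ^^ n) z = z \<and> (\<forall>i<n. mdist d ((f ^^ i) z) (x i) < \<beta>))" for n \<beta> and x :: "nat \<Rightarrow> 'a"
    using iter by (intro bex_cong refl) simp
  show ?thesis
    using periodic_shadowing_f[OF A(5)] unfolding periodic_shadowing_def step orbit .
qed

theorem theorem1p7:
  fixes \<A> :: "('m::t2_space, 'e::euclidean_space) chart set"
    and g :: "'m \<Rightarrow> 'e \<Rightarrow> 'e \<Rightarrow> real"
    and f T :: "'m \<Rightarrow> 'm"
    and X :: "'m set"
    and d :: "'m metric"
    and q :: real
  assumes "C1_axiom_A_system \<A> g f X T"
    and "hyperbolic_metric X T d"
    and "q \<ge> 1"
  shows "residual_in (weak_topology X T)
           {\<mu> \<in> invariant_measures X T. upper_gen_dim d \<mu> q = 0}"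
proof -
  have f: "C1_diffeo \<A> f" "compact X" "f ` X = X" and Tf: "\<And>x. x \<in> X \<Longrightarrow> T x = f x"
    using assms(1) unfolding C1_axiom_A_system_def basic_set_def hyperbolic_set_def by auto
  have met: "mspace d = X" "mtopology_of d = top_of_set X" "Lipschitz_continuous_map d d T"
    and "\<exists>k>1. \<exists>\<epsilon>>0. \<forall>x\<in>X. \<forall>y\<in>X.
        max (mdist d (T x) (T y)) (mdist d (inv_into X T x) (inv_into X T y)) \<ge> min (k * mdist d x y) \<epsilon>"
    using assms(2) unfolding hyperbolic_metric_def by auto
  then obtain k \<epsilon> where k: "k > 1" "\<epsilon> > 0" "\<forall>x\<in>X. \<forall>y\<in>X.
        max (mdist d (T x) (T y)) (mdist d (inv_into X T x) (inv_into X T y)) \<ge> min (k * mdist d x y) \<epsilon>"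
    by (elim exE conjE)
  have "T ` X = f ` X" using Tf by (intro image_cong refl)
  moreover have "inj_on T X"
    using inj_on_cong[of X T f] Tf f(1) unfolding C1_diffeo_def bij_def by (metis inj_on_subset subset_UNIV)
  moreover have "continuous_on X T"
    using continuous_on_cong[of X X T f] Tf f(1) unfolding C1_diffeo_def C1_map_def
    by (metis continuous_on_subset subset_UNIV)
  ultimately interpret hyperbolic_system X d T k \<epsilon>
    using f met k by unfold_locales auto
  obtain L where "\<forall>x\<in>X. \<forall>y\<in>X. mdist d (T x) (T y) \<le> L * mdist d x y"
    using met(3) unfolding Lipschitz_continuous_map_def by auto
  \<comment> \<open>The constant is raised to at least 1, so that its powers are increasing.\<close>
  then have Lip: "mdist d (T x) (T y) \<le> max 1 L * mdist d x y" if "x \<in> X" "y \<in> X" for x y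
    using that by (meson max.cobounded2 mdist_nonneg mult_right_mono order_trans)
  show ?thesis
    by (rule residual_zero_dimension[OF Lip _ axiom_A_periodic_shadowing[OF assms(1)] assms(3)])
      (simp_all add: compact_metrized_axioms)
qed

end
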